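(* Let $\mathcal{H}_1$ and $\mathcal{H}_2$ be infinite dimensional separable complex Hilbert spaces, let $\mathcal{H}=\mathcal{H}_1\otimes\mathcal{H}_2$, and let $\rho_i\in\mathrm{T}_+(\mathcal{H}_i)$ for $i=1,2$. Assume that the sequence $\rho^{(n)}\in\mathrm{T}_+(\mathcal{H})$, $n\in\mathbb{N}$, converges in the weak operator topology to $\rho\in\mathrm{T}_+(\mathcal{H})$, and furthermore that $$\lim_{n\to\infty}\left(\|\mathrm{Tr}_1\rho^{(n)}-\rho_2\|_1+\|\mathrm{Tr}_2\rho^{(n)}-\rho_1\|_1\right)=0.$$ Then $$\lim_{n\to\infty}\|\rho^{(n)}-\rho\|_1=0.$$ In particular $\mathrm{Tr}\,\rho=\mathrm{Tr}\,\rho_1=\mathrm{Tr}\,\rho_2$. Hence $\rho$ is a density operator if and only if $\rho_1$ and $\rho_2$ are density operators.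
   Context: For a separable complex Hilbert space $\mathcal{H}$: $\mathrm{T}(\mathcal{H})$ is the Banach space of trace class operators with trace norm $\|\cdot\|_1$; $\mathrm{T}_+(\mathcal{H})$ is the cone of positive semidefinite trace class operators; a density operator is an element of $\mathrm{T}_+(\mathcal{H})$ of trace $1$. $\rho^{(n)}\to\rho$ in the weak operator topology means $\langle\rho^{(n)}\mathbf{x},\mathbf{y}\rangle\to\langle\rho\mathbf{x},\mathbf{y}\rangle$ for all $\mathbf{x},\mathbf{y}\in\mathcal{H}$. Inner products are linear in the first argument, and $\mathbf{x}\mathbf{y}^\vee$ denotes the operator $\mathbf{z}\mapsto\langle\mathbf{z},\mathbf{y}\rangle\mathbf{x}$. The partial traces $\mathrm{Tr}_1:\mathrm{T}(\mathcal{H}_1\otimes\mathcal{H}_2)\to\mathrm{T}(\mathcal{H}_2)$ and $\mathrm{Tr}_2:\mathrm{T}(\mathcal{H}_1\otimes\mathcal{H}_2)\to\mathrm{T}(\mathcal{H}_1)$ are the unique bounded linear maps with $\mathrm{Tr}_1((\mathbf{x}\otimes\mathbf{y})(\mathbf{u}\otimes\mathbf{v})^\vee)=\langle\mathbf{x},\mathbf{u}\rangle\,\mathbf{y}\mathbf{v}^\vee$ and $\mathrm{Tr}_2((\mathbf{x}\otimes\mathbf{y})(\mathbf{u}\otimes\mathbf{v})^\vee)=\langle\mathbf{y},\mathbf{v}\rangle\,\mathbf{x}\mathbf{u}^\vee$ (so $\mathrm{Tr}_i$ traces out the $i$-th factor). *)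

theory Defs
  imports "HOL-Analysis.Analysis"
begin

section \<open>Complex Hilbert spaces\<close>

text \<open>The inner product is linear in its first argument. Operators are plain functions
  together with an explicit boundedness and complex linearity predicate.\<close>

class complex_inner = real_normed_vector +
  fixes scaleC :: "complex \<Rightarrow> 'a \<Rightarrow> 'a" (infixr \<open>*\<^sub>C\<close> 75)
    and cinner :: "'a \<Rightarrow> 'a \<Rightarrow> complex"
  assumes scaleR_scaleC: "r *\<^sub>R x = complex_of_real r *\<^sub>C x"
    and scaleC_add_right: "a *\<^sub>C (x + y) = a *\<^sub>C x + a *\<^sub>C y"
    and scaleC_add_left: "(a + b) *\<^sub>C x = a *\<^sub>C x + b *\<^sub>C x"
    and scaleC_scaleC: "a *\<^sub>C (b *\<^sub>C x) = (a * b) *\<^sub>C x"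
    and scaleC_one: "1 *\<^sub>C x = x"
    and cinner_add_left: "cinner (x + y) z = cinner x z + cinner y z"
    and cinner_scaleC_left: "cinner (a *\<^sub>C x) y = a * cinner x y"
    and cinner_commute: "cinner x y = cnj (cinner y x)"
    and cinner_nonneg: "cinner x x \<in> \<real>\<^sub>\<ge>\<^sub>0"
    and norm_eq_sqrt_cinner: "norm x = sqrt (Re (cinner x x))"

class complex_hilbert = complex_inner + complete_space

global_interpretation complex_vector: vector_space "scaleC :: complex \<Rightarrow> 'a \<Rightarrow> 'a::complex_inner"
  by standard (simp_all add: scaleC_add_right scaleC_add_left scaleC_scaleC scaleC_one)

abbreviation cspan :: "'a::complex_inner set \<Rightarrow> 'a set" where
  "cspan \<equiv> complex_vector.span"

definition separable :: "'a::topological_space set \<Rightarrow> bool" where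
  "separable S \<longleftrightarrow> (\<exists>D. countable D \<and> D \<subseteq> S \<and> S \<subseteq> closure D)"

definition infinite_cdim :: "'a::complex_inner set \<Rightarrow> bool" where
  "infinite_cdim V \<longleftrightarrow> (\<nexists>B. finite B \<and> cspan B = V)"

definition is_onb :: "'a::complex_inner set \<Rightarrow> bool" where
  "is_onb E \<longleftrightarrow> (\<forall>e\<in>E. norm e = 1) \<and> (\<forall>e\<in>E. \<forall>f\<in>E. e \<noteq> f \<longrightarrow> cinner e f = 0)
     \<and> closure (cspan E) = UNIV"

definition some_onb :: "'a::complex_inner set" where
  "some_onb = (SOME E. is_onb E)"


section \<open>Trace class operators\<close>

definition bounded_clinear :: "('a::complex_inner \<Rightarrow> 'b::complex_inner) \<Rightarrow> bool" where
  "bounded_clinear T \<longleftrightarrow> bounded_linear T \<and> (\<forall>c x. T (c *\<^sub>C x) = c *\<^sub>C T x)"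

definition positive_op :: "('a::complex_inner \<Rightarrow> 'a) \<Rightarrow> bool" where
  "positive_op T \<longleftrightarrow> bounded_clinear T \<and> (\<forall>x. cinner (T x) x \<in> \<real>\<^sub>\<ge>\<^sub>0)"

definition adj_op :: "('a::complex_hilbert \<Rightarrow> 'b::complex_hilbert) \<Rightarrow> 'b \<Rightarrow> 'a" where
  "adj_op T = (THE S. \<forall>x y. cinner (T x) y = cinner x (S y))"

definition abs_op :: "('a::complex_hilbert \<Rightarrow> 'a) \<Rightarrow> 'a \<Rightarrow> 'a" where
  "abs_op T = (THE P. positive_op P \<and> P \<circ> P = adj_op T \<circ> T)"

definition trace_class :: "('a::complex_hilbert \<Rightarrow> 'a) \<Rightarrow> bool" where
  "trace_class T \<longleftrightarrow> bounded_clinear T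
     \<and> (\<exists>E. is_onb E \<and> (\<lambda>e. cinner (abs_op T e) e) summable_on E)"

text \<open>The sum does not depend on the orthonormal basis when \<open>T\<close> is trace class; for other
  operators \<open>op_trace\<close> and \<open>trace_norm\<close> carry no meaning.\<close>

definition op_trace :: "('a::complex_hilbert \<Rightarrow> 'a) \<Rightarrow> complex" where
  "op_trace T = (\<Sum>\<^sub>\<infinity>e\<in>some_onb. cinner (T e) e)"

definition trace_norm :: "('a::complex_hilbert \<Rightarrow> 'a) \<Rightarrow> real" where
  "trace_norm T = Re (op_trace (abs_op T))"

definition trace_class_pos :: "('a::complex_hilbert \<Rightarrow> 'a) set" where
  "trace_class_pos = {T. trace_class T \<and> positive_op T}"

definition density_op :: "('a::complex_hilbert \<Rightarrow> 'a) \<Rightarrow> bool" where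
  "density_op T \<longleftrightarrow> T \<in> trace_class_pos \<and> op_trace T = 1"

definition wot_tendsto :: "(nat \<Rightarrow> 'a::complex_hilbert \<Rightarrow> 'a) \<Rightarrow> ('a \<Rightarrow> 'a) \<Rightarrow> bool" where
  "wot_tendsto T S \<longleftrightarrow> (\<forall>x y. (\<lambda>n. cinner (T n x) y) \<longlonglongrightarrow> cinner (S x) y)"


section \<open>Tensor products and partial traces\<close>

text \<open>The type \<open>'c\<close> with the map \<open>tens\<close> is a Hilbert space tensor product of \<open>'a\<close> and \<open>'b\<close>.
  These conditions determine the pair up to a unique unitary compatible with \<open>tens\<close>.\<close>

definition hilbert_tensor ::
  "('a::complex_hilbert \<Rightarrow> 'b::complex_hilbert \<Rightarrow> 'c::complex_hilbert) \<Rightarrow> bool" where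
  "hilbert_tensor tens \<longleftrightarrow>
     (\<forall>x x' y. tens (x + x') y = tens x y + tens x' y) \<and>
     (\<forall>x y y'. tens x (y + y') = tens x y + tens x y') \<and>
     (\<forall>c x y. tens (c *\<^sub>C x) y = c *\<^sub>C tens x y) \<and>
     (\<forall>c x y. tens x (c *\<^sub>C y) = c *\<^sub>C tens x y) \<and>
     (\<forall>x y u v. cinner (tens x y) (tens u v) = cinner x u * cinner y v) \<and>
     closure (cspan {tens x y |x y. True}) = UNIV"

definition rank_one :: "'a::complex_inner \<Rightarrow> 'b::complex_inner \<Rightarrow> 'b \<Rightarrow> 'a" where
  "rank_one x y = (\<lambda>z. cinner z y *\<^sub>C x)"

text \<open>A bounded linear map between the Banach spaces of trace class operators. As \<open>F\<close> is a
  total function, it is set to zero off the trace class, so that the descriptions below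
  identify a single function.\<close>

definition bounded_clinear_tc ::
  "(('a::complex_hilbert \<Rightarrow> 'a) \<Rightarrow> ('b::complex_hilbert \<Rightarrow> 'b)) \<Rightarrow> bool" where
  "bounded_clinear_tc F \<longleftrightarrow>
     (\<forall>T. trace_class T \<longrightarrow> trace_class (F T)) \<and>
     (\<forall>S T. trace_class S \<longrightarrow> trace_class T \<longrightarrow>
        F (\<lambda>z. S z + T z) = (\<lambda>z. F S z + F T z)) \<and>
     (\<forall>c T. trace_class T \<longrightarrow> F (\<lambda>z. c *\<^sub>C T z) = (\<lambda>z. c *\<^sub>C F T z)) \<and>
     (\<exists>K. \<forall>T. trace_class T \<longrightarrow> trace_norm (F T) \<le> K * trace_norm T) \<and>
     (\<forall>T. \<not> trace_class T \<longrightarrow> F T = (\<lambda>z. 0))"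

definition partial_trace1 ::
  "('a::complex_hilbert \<Rightarrow> 'b::complex_hilbert \<Rightarrow> 'c::complex_hilbert) \<Rightarrow> ('c \<Rightarrow> 'c) \<Rightarrow> 'b \<Rightarrow> 'b" where
  "partial_trace1 tens = (THE F. bounded_clinear_tc F \<and>
     (\<forall>x y u v. F (rank_one (tens x y) (tens u v)) = (\<lambda>z. cinner x u *\<^sub>C rank_one y v z)))"

definition partial_trace2 ::
  "('a::complex_hilbert \<Rightarrow> 'b::complex_hilbert \<Rightarrow> 'c::complex_hilbert) \<Rightarrow> ('c \<Rightarrow> 'c) \<Rightarrow> 'a \<Rightarrow> 'a" where
  "partial_trace2 tens = (THE F. bounded_clinear_tc F \<and>
     (\<forall>x y u v. F (rank_one (tens x y) (tens u v)) = (\<lambda>z. cinner y v *\<^sub>C rank_one x u z)))"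

end

theory Submission
  imports Defs
begin

text \<open>The trace norm is handled by duality: \<open>\<parallel>T\<parallel>\<^sub>1 \<le> C\<close> holds iff
  \<open>\<Sum>\<^sub>g Re \<langle>W T g, g\<rangle> \<le> C\<close> for all contractions \<open>W\<close> and finite orthonormal sets of vectors
  \<open>g\<close>. This bound is visibly subadditive and stable under pointwise limits, and pinching a contraction along
  slices \<open>e \<otimes> _\<close> shows that partial traces do not increase it.

  Let \<open>F\<^sub>1\<close> and \<open>F\<^sub>2\<close> be finite parts of orthonormal bases of the factors. The trace
  of \<open>\<rho>\<^sup>(\<^sup>n\<^sup>)\<close> carried outside \<open>F\<^sub>1 \<times> F\<^sub>2\<close> is at most the sum of the tails of
  its two partial traces. These converge in trace norm, so the tails are uniformly small. Compressing a
  positive operator to a finite part that carries all but \<open>\<delta>\<close> of its trace costs only \<open>O(\<surd>\<delta>)\<close>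
  in trace norm, and on that finite part weak convergence is convergence of a matrix.\<close>

section \<open>Inner product spaces\<close>

text \<open>Weak convergence by itself can lose trace at infinity; convergence of the partial traces
  rules this out. What the partial traces control is diagonal sums, so off-diagonal errors have to
  be bounded by diagonal ones. This is Cauchy-Schwarz for Hilbert-Schmidt sums: if \<open>S\<close>
  is the root of a positive operator, its trace is a sum of \<open>|S e|^2\<close>, and truncating
  one side of \<open>S S\<close> makes only one of the two factors small, whence the square root of
  \<delta>. The limit \<rho> is not assumed to have \<rho>1 and \<rho>2 as partial traces; its tails
  are bounded by passing to the weak limit in finite sums.

  The definitions use definite descriptions, so adjoints, absolute values and partial traces acquire
  meaning only through existence and uniqueness proofs. One variational argument gives both the
  Riesz representation and the resolvents, and square roots come from a binomial series, so that
  neither spectral theory nor partial isometries enter.\<close>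

instance complex_hilbert \<subseteq> banach ..

lemma cinner_add_right: "cinner x (y + z) = cinner x y + cinner x (z::'a::complex_inner)"
  by (subst (1 2 3) cinner_commute) (simp add: cinner_add_left)

lemma cinner_scaleC_right: "cinner x (a *\<^sub>C y) = cnj a * cinner x (y::'a::complex_inner)"
  by (subst (1 2) cinner_commute) (simp add: cinner_scaleC_left)

lemma cinner_zero_left [simp]: "cinner 0 (x::'a::complex_inner) = 0"
  using cinner_add_left[of 0 0 x] by simp

lemma cinner_zero_right [simp]: "cinner (x::'a::complex_inner) 0 = 0"
  using cinner_add_right[of x 0 0] by simp

lemma cinner_minus_left: "cinner (- x) y = - cinner x (y::'a::complex_inner)"
  using cinner_add_left[of "-x" x y] by (simp add: eq_neg_iff_add_eq_0)

lemma cinner_minus_right: "cinner x (- y) = - cinner x (y::'a::complex_inner)"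
  using cinner_add_right[of x "-y" y] by (simp add: eq_neg_iff_add_eq_0)

lemma cinner_diff_left: "cinner (x - y) z = cinner x z - cinner y (z::'a::complex_inner)"
  using cinner_add_left[of x "-y" z] by (simp add: cinner_minus_left)

lemma cinner_diff_right: "cinner x (y - z) = cinner x y - cinner x (z::'a::complex_inner)"
  using cinner_add_right[of x y "-z"] by (simp add: cinner_minus_right)

lemma cinner_sum_left: "cinner (\<Sum>i\<in>A. f i) x = (\<Sum>i\<in>A. cinner (f i) (x::'a::complex_inner))"
  by (induction A rule: infinite_finite_induct) (auto simp: cinner_add_left)

lemma cinner_sum_right: "cinner x (\<Sum>i\<in>A. f i) = (\<Sum>i\<in>A. cinner (x::'a::complex_inner) (f i))"
  by (induction A rule: infinite_finite_induct) (auto simp: cinner_add_right)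

lemma cinner_scaleR_left: "cinner (r *\<^sub>R x) y = of_real r * cinner x (y::'a::complex_inner)"
  by (simp add: scaleR_scaleC cinner_scaleC_left)

lemma cinner_scaleR_right: "cinner x (r *\<^sub>R y) = of_real r * cinner x (y::'a::complex_inner)"
  by (simp add: scaleR_scaleC cinner_scaleC_right)

lemmas cinner_simps = cinner_add_left cinner_add_right cinner_diff_left cinner_diff_right
  cinner_minus_left cinner_minus_right cinner_scaleC_left cinner_scaleC_right
  cinner_scaleR_left cinner_scaleR_right

lemma cinner_self: "cinner x x = of_real ((norm (x::'a::complex_inner))\<^sup>2)"
proof -
  obtain r where r: "r \<ge> 0" "cinner x x = of_real r"
    using cinner_nonneg[of x] by (auto elim: nonneg_Reals_cases)
  then show ?thesis by (simp add: norm_eq_sqrt_cinner)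
qed

lemma cmod_cinner_self: "cmod (cinner x x) = (norm (x::'a::complex_inner))\<^sup>2"
  by (simp only: cinner_self norm_of_real) simp

lemma Re_cinner_commute: "Re (cinner x y) = Re (cinner y (x::'a::complex_inner))"
  by (subst cinner_commute) simp

lemma cmod_cinner_commute: "cmod (cinner x y) = cmod (cinner y (x::'a::complex_inner))"
  by (subst cinner_commute) simp

lemma norm_add_sq: "(norm (x + y))\<^sup>2 = (norm x)\<^sup>2 + (norm y)\<^sup>2 + 2 * Re (cinner x (y::'a::complex_inner))"
proof -
  have "(norm (x + y))\<^sup>2 = Re (cinner (x + y) (x + y))" by (simp add: cinner_self)
  also have "\<dots> = Re (cinner x x) + Re (cinner y y) + Re (cinner x y) + Re (cinner y x)"
    by (simp add: cinner_add_left cinner_add_right)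
  finally show ?thesis using Re_cinner_commute[of x y] by (simp add: cinner_self)
qed

lemma norm_diff_sq: "(norm (x - y))\<^sup>2 = (norm x)\<^sup>2 + (norm y)\<^sup>2 - 2 * Re (cinner x (y::'a::complex_inner))"
  using norm_add_sq[of x "-y"] by (simp add: cinner_minus_right)

lemma scaleC_simps [simp]:
  "1 *\<^sub>C x = x" "0 *\<^sub>C x = 0" "c *\<^sub>C 0 = (0::'a::complex_inner)" "(-1) *\<^sub>C x = - x"
  using complex_vector.scale_minus_left[of 1 x] by (simp_all add: scaleC_one)

lemma norm_scaleC: "norm (c *\<^sub>C x) = cmod c * norm (x::'a::complex_inner)"
proof -
  have "complex_of_real ((norm (c *\<^sub>C x))\<^sup>2) = of_real ((cmod c * norm x)\<^sup>2)"
    unfolding cinner_self[symmetric] cinner_scaleC_left cinner_scaleC_right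
    by (simp add: cinner_self power_mult_distrib complex_norm_square[symmetric] mult_ac
        flip: of_real_power)
  then have "(norm (c *\<^sub>C x))\<^sup>2 = (cmod c * norm x)\<^sup>2" using of_real_eq_iff by blast
  then show ?thesis by (simp add: power2_eq_iff_nonneg)
qed

lemma cinner_ext: "(\<And>z. cinner x z = cinner y z) \<Longrightarrow> x = (y::'a::complex_inner)"
proof -
  assume "\<And>z. cinner x z = cinner y z"
  then have "cinner (x - y) (x - y) = 0" by (simp add: cinner_diff_left)
  then show ?thesis by (simp add: cinner_self)
qed

lemma cinner_ext': "(\<And>z. cinner z x = cinner z y) \<Longrightarrow> x = (y::'a::complex_inner)"
  by (rule cinner_ext) (metis cinner_commute)


section \<open>Bounded operators\<close>

lemma bounded_clinearI:
  assumes "\<And>x y. T (x + y) = T x + T y" "\<And>c x. T (c *\<^sub>C x) = c *\<^sub>C T x"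
    and "\<And>x. norm (T x) \<le> K * norm x"
  shows "bounded_clinear T"
  unfolding bounded_clinear_def
proof (intro conjI allI bounded_linear_intro)
  show "norm (T x) \<le> norm x * K" for x using assms(3)[of x] by (simp add: mult.commute)
qed (use assms in \<open>auto simp: scaleR_scaleC\<close>)

lemma bounded_clinear_linear: "bounded_clinear T \<Longrightarrow> bounded_linear T"
  by (simp add: bounded_clinear_def)

lemma bounded_clinear_add: "bounded_clinear T \<Longrightarrow> T (x + y) = T x + T y"
  using bounded_clinear_linear[THEN bounded_linear.linear] linear_add by blast

lemma bounded_clinear_diff: "bounded_clinear T \<Longrightarrow> T (x - y) = T x - T y"
  using bounded_clinear_linear[THEN bounded_linear.linear] linear_diff by blast

lemma bounded_clinear_scaleC: "bounded_clinear T \<Longrightarrow> T (c *\<^sub>C x) = c *\<^sub>C T x"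
  by (simp add: bounded_clinear_def)

lemma bounded_clinear_scaleR: "bounded_clinear T \<Longrightarrow> T (c *\<^sub>R x) = c *\<^sub>R T x"
  by (simp add: bounded_clinear_def scaleR_scaleC)

lemma bounded_clinear_zero: "bounded_clinear T \<Longrightarrow> T 0 = 0"
  using bounded_clinear_linear[THEN bounded_linear.linear] linear_0 by blast

lemma bounded_clinear_sum: "bounded_clinear T \<Longrightarrow> T (\<Sum>i\<in>A. f i) = (\<Sum>i\<in>A. T (f i))"
  using bounded_clinear_linear[THEN bounded_linear.linear] linear_sum by blast

lemmas bounded_clinear_simps = bounded_clinear_add bounded_clinear_diff bounded_clinear_scaleC
  bounded_clinear_scaleR bounded_clinear_zero bounded_clinear_sum

lemma bounded_clinear_bound:
  assumes "bounded_clinear T"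
  obtains K where "K > 0" "\<And>x. norm (T x) \<le> K * norm x"
  using bounded_linear.pos_bounded[OF bounded_clinear_linear[OF assms]] by (auto simp: mult.commute)

lemma bounded_clinear_compose:
  "bounded_clinear S \<Longrightarrow> bounded_clinear T \<Longrightarrow> bounded_clinear (\<lambda>x. S (T x))"
  unfolding bounded_clinear_def using bounded_linear_compose by auto

lemma bounded_clinear_plus:
  "bounded_clinear S \<Longrightarrow> bounded_clinear T \<Longrightarrow> bounded_clinear (\<lambda>x. S x + T x)"
  unfolding bounded_clinear_def using bounded_linear_add by (auto simp: scaleC_add_right)

lemma bounded_clinear_cscale: "bounded_clinear T \<Longrightarrow> bounded_clinear (\<lambda>x. c *\<^sub>C T x)"
proof -
  assume T: "bounded_clinear T"
  then obtain K where K: "\<And>x. norm (T x) \<le> K * norm x" using bounded_clinear_bound by metis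
  show ?thesis
    by (rule bounded_clinearI[where K="cmod c * K"])
       (auto simp: bounded_clinear_simps[OF T] scaleC_add_right scaleC_scaleC mult.commute[of c] norm_scaleC
         mult.assoc intro!: mult_left_mono K)
qed

lemma bounded_clinear_minus:
  "bounded_clinear S \<Longrightarrow> bounded_clinear T \<Longrightarrow> bounded_clinear (\<lambda>x. S x - T x)"
  using bounded_clinear_plus[OF _ bounded_clinear_cscale[of T "-1"], of S] by simp

lemma bounded_clinear_scaleR_op: "bounded_clinear T \<Longrightarrow> bounded_clinear (\<lambda>x. r *\<^sub>R T x)"
  using bounded_clinear_cscale[of T "of_real r"] by (simp add: scaleR_scaleC)

lemma bounded_clinear_id: "bounded_clinear (\<lambda>x. x)"
  by (simp add: bounded_clinear_def bounded_linear_ident)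

lemma bounded_clinear_null: "bounded_clinear (\<lambda>x. 0)"
  by (rule bounded_clinearI[where K=0]) auto

lemma bounded_clinear_sum_op:
  "(\<And>i. i \<in> A \<Longrightarrow> bounded_clinear (T i)) \<Longrightarrow> bounded_clinear (\<lambda>x. \<Sum>i\<in>A. T i x)"
  by (induction A rule: infinite_finite_induct) (auto simp: bounded_clinear_plus bounded_clinear_null)

lemma positive_opD: "positive_op A \<Longrightarrow> bounded_clinear A"
  by (simp add: positive_op_def)

lemma positive_op_ge: "positive_op A \<Longrightarrow> Re (cinner (A x) x) \<ge> 0"
  by (simp add: positive_op_def complex_nonneg_Reals_iff)

lemma positive_op_Im: "positive_op A \<Longrightarrow> Im (cinner (A x) x) = 0"
  by (simp add: positive_op_def complex_nonneg_Reals_iff)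

lemma positive_op_of_real: "positive_op A \<Longrightarrow> cinner (A x) x = of_real (Re (cinner (A x) x))"
  by (simp add: complex_eq_iff positive_op_Im)

lemma positive_opI:
  "bounded_clinear A \<Longrightarrow> (\<And>x. Re (cinner (A x) x) \<ge> 0) \<Longrightarrow> (\<And>x. Im (cinner (A x) x) = 0) \<Longrightarrow> positive_op A"
  by (auto simp: positive_op_def complex_nonneg_Reals_iff)

text \<open>Complex polarisation: a quadratic form with real values comes from a self-adjoint operator.\<close>

lemma positive_op_self_adjoint:
  assumes A: "positive_op A"
  shows "cinner (A x) y = cinner x (A y)"
proof -
  have lin: "bounded_clinear A" using A by (rule positive_opD)
  have 1: "Im (cinner (A x) y) + Im (cinner (A y) x) = 0"
    using positive_op_Im[OF A, of "x + y"] positive_op_Im[OF A, of x] positive_op_Im[OF A, of y]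
    by (simp add: bounded_clinear_simps[OF lin] cinner_simps)
  have 2: "Re (cinner (A y) x) - Re (cinner (A x) y) = 0"
    using positive_op_Im[OF A, of "x + \<i> *\<^sub>C y"] positive_op_Im[OF A, of x] positive_op_Im[OF A, of y]
    by (simp add: bounded_clinear_simps[OF lin] cinner_simps)
  have "cinner (A x) y = cnj (cinner (A y) x)"
    using 1 2 by (simp add: complex_eq_iff)
  then show ?thesis by (metis cinner_commute)
qed

text \<open>This form arises by moving along \<open>- t * z\<close> times a vector with
  \<open>a = |z|^2\<close>, so that \<open>a\<close> multiplies both the linear and the quadratic
  term. The bound is read off at the minimum \<open>t = 1/q\<close>.\<close>

lemma quadratic_discriminant:
  fixes a p q :: real
  assumes "\<And>t. 0 \<le> p - 2 * t * a + t\<^sup>2 * a * q" "a \<ge> 0" "q \<ge> 0"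
  shows "a \<le> p * q"
proof (cases "q = 0")
  case True
  have "a = 0"
  proof (rule ccontr)
    assume "a \<noteq> 0"
    \<comment> \<open>With \<open>q = 0\<close> this \<open>t\<close> makes the expression equal to
      \<open>p - (p + 1) = -1\<close>.\<close>
    then show False using assms(1)[of "(p + 1) / (2 * a)"] True by simp
  qed
  then show ?thesis using True by simp
next
  case False
  then have q: "q > 0" using assms by simp
  have "0 \<le> p - 2 * (1/q) * a + (1/q)\<^sup>2 * a * q" by (rule assms)
  also have "(1/q)\<^sup>2 * a * q = a / q" using q by (simp add: power2_eq_square)
  finally have "a / q \<le> p" by (simp add: field_simps)
  then show ?thesis using q by (simp add: field_simps)
qed

text \<open>The coefficient \<open>c = - t <A x, y>\<close> has the phase that makes the cross term
  real, so positivity at \<open>x + c *\<^sub>C y\<close> is a real quadratic in \<open>t\<close>.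
  The form of \<open>A\<close> may be degenerate, hence a discriminant lemma that admits
  \<open>q = 0\<close>.\<close>

lemma positive_op_Cauchy_Schwarz:
  assumes A: "positive_op A"
  shows "(cmod (cinner (A x) y))\<^sup>2 \<le> Re (cinner (A x) x) * Re (cinner (A y) y)"
proof (rule quadratic_discriminant)
  have lin: "bounded_clinear A" using A by (rule positive_opD)
  fix t :: real
  let ?a = "cinner (A x) y"
  have sa: "cinner (A y) x = cnj ?a"
    using positive_op_self_adjoint[OF A, of y x] cinner_commute by metis
  have aa: "?a * cnj ?a = of_real ((cmod ?a)\<^sup>2)" by (rule complex_norm_square[symmetric])
  define c where "c = - of_real t * ?a"
  have "cinner (A (x + c *\<^sub>C y)) (x + c *\<^sub>C y)
     = cinner (A x) x + (cnj c * ?a + c * cnj ?a) + c * cnj c * cinner (A y) y"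
    by (simp add: bounded_clinear_simps[OF lin] cinner_simps sa algebra_simps)
  also have "cnj c * ?a + c * cnj ?a = - of_real (2 * t) * (?a * cnj ?a)"
    by (simp add: c_def algebra_simps)
  also have "c * cnj c = of_real (t\<^sup>2) * (?a * cnj ?a)"
    by (simp add: c_def power2_eq_square algebra_simps)
  finally have "Re (cinner (A (x + c *\<^sub>C y)) (x + c *\<^sub>C y))
     = Re (cinner (A x) x) - 2 * t * (cmod ?a)\<^sup>2 + t\<^sup>2 * (cmod ?a)\<^sup>2 * Re (cinner (A y) y)"
    unfolding aa by (simp flip: of_real_power)
  then show "0 \<le> Re (cinner (A x) x) - 2 * t * (cmod ?a)\<^sup>2 + t\<^sup>2 * (cmod ?a)\<^sup>2 * Re (cinner (A y) y)"
    using positive_op_ge[OF A] by metis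
qed (use positive_op_ge[OF A] in auto)

lemma positive_op_id: "positive_op (\<lambda>x. x)"
  by (rule positive_opI) (auto simp: bounded_clinear_id cinner_self)

lemma Cauchy_Schwarz: "cmod (cinner x y) \<le> norm x * norm (y::'a::complex_inner)"
proof -
  have "(cmod (cinner x y))\<^sup>2 \<le> (norm x * norm y)\<^sup>2"
    using positive_op_Cauchy_Schwarz[OF positive_op_id, of x y]
    by (simp add: cinner_self power_mult_distrib)
  then show ?thesis by (rule power2_le_imp_le) simp
qed

lemma bounded_bilinear_cinner: "bounded_bilinear (cinner :: 'a::complex_inner \<Rightarrow> 'a \<Rightarrow> complex)"
proof
  show "\<exists>K. \<forall>a b. norm (cinner a (b::'a)) \<le> norm a * norm b * K"
    by (rule exI[of _ 1]) (simp add: Cauchy_Schwarz)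
qed (simp_all add: cinner_simps scaleR_conv_of_real)

lemmas tendsto_cinner [tendsto_intros] = bounded_bilinear.tendsto[OF bounded_bilinear_cinner]
lemmas bounded_linear_cinner_left = bounded_bilinear.bounded_linear_left[OF bounded_bilinear_cinner]
lemmas bounded_linear_cinner_right = bounded_bilinear.bounded_linear_right[OF bounded_bilinear_cinner]
lemmas continuous_on_cinner [continuous_intros] = bounded_bilinear.continuous_on[OF bounded_bilinear_cinner]

lemma norm_le_of_cinner:
  assumes "K \<ge> 0" "\<And>y. cmod (cinner x y) \<le> K * norm y"
  shows "norm (x::'a::complex_inner) \<le> K"
proof -
  have "norm x * norm x \<le> K * norm x"
    using assms(2)[of x] by (simp add: cmod_cinner_self power2_eq_square)
  then show ?thesis using assms(1) by (cases "norm x = 0") (auto simp: mult_le_cancel_right)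
qed

text \<open>Cauchy-Schwarz for the form of \<open>A\<close> at the pair \<open>x\<close>,
  \<open>A x\<close>, divided by \<open>|A x|^2\<close>. As an inequality of forms this is
  \<open>A^2 \<le> K A\<close>; it recovers the operator norm from the quadratic form.\<close>

lemma positive_op_norm_sq:
  assumes A: "positive_op A" and K: "K \<ge> 0" "\<And>x. Re (cinner (A x) x) \<le> K * (norm x)\<^sup>2"
  shows "(norm (A x))\<^sup>2 \<le> K * Re (cinner (A x) x)"
proof -
  have "((norm (A x))\<^sup>2)\<^sup>2 \<le> Re (cinner (A x) x) * Re (cinner (A (A x)) (A x))"
    using positive_op_Cauchy_Schwarz[OF A, of x "A x"] by (simp add: cinner_self flip: of_real_power)
  also have "\<dots> \<le> Re (cinner (A x) x) * (K * (norm (A x))\<^sup>2)"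
    by (intro mult_left_mono K positive_op_ge[OF A])
  finally have "(norm (A x))\<^sup>2 * (norm (A x))\<^sup>2 \<le> (K * Re (cinner (A x) x)) * (norm (A x))\<^sup>2"
    by (simp add: power2_eq_square mult_ac)
  then have "norm (A x) \<noteq> 0 \<Longrightarrow> ?thesis" by (rule mult_right_le_imp_le) simp
  then show ?thesis using K(1) positive_op_ge[OF A, of x] by (cases "norm (A x) = 0") auto
qed

lemma positive_op_norm_le:
  assumes A: "positive_op A" and K: "K \<ge> 0" "\<And>x. Re (cinner (A x) x) \<le> K * (norm x)\<^sup>2"
  shows "norm (A x) \<le> K * norm x"
proof -
  have "(norm (A x))\<^sup>2 \<le> K * (K * (norm x)\<^sup>2)"
    using positive_op_norm_sq[OF A K, of x] K(2)[of x] K(1) by (meson mult_left_mono order_trans)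
  then have "(norm (A x))\<^sup>2 \<le> (K * norm x)\<^sup>2" by (simp add: power2_eq_square mult_ac)
  then show ?thesis by (rule power2_le_imp_le) (simp add: K(1))
qed

lemma positive_op_zero:
  assumes A: "positive_op A" and "Re (cinner (A x) x) = 0"
  shows "A x = 0"
proof -
  have "(cmod (cinner (A x) (A x)))\<^sup>2 \<le> 0"
    using positive_op_Cauchy_Schwarz[OF A, of x "A x"] assms(2) by simp
  then show ?thesis by (simp add: cinner_self)
qed


section \<open>The Lax--Milgram theorem and adjoints\<close>

text \<open>The solution minimises \<open>J\<close>: the parallelogram identity and coercivity make
  a minimising sequence Cauchy, and the first variation at the minimiser is the claim. It serves
  twice, with the identity for Riesz and with \<open>P + \<epsilon>\<close> for resolvents.\<close>

lemma Lax_Milgram: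
  fixes A :: "'a::complex_hilbert \<Rightarrow> 'a" and f :: "'a \<Rightarrow> complex"
  assumes A: "positive_op A" and \<epsilon>: "\<epsilon> > 0" "\<And>x. \<epsilon> * (norm x)\<^sup>2 \<le> Re (cinner (A x) x)"
    and f: "bounded_linear f" "\<And>c x. f (c *\<^sub>C x) = c * f x"
  obtains x where "\<And>y. f y = cinner y (A x)"
proof -
  have lin: "bounded_clinear A" using A by (rule positive_opD)
  note Asimps = bounded_clinear_simps[OF lin]
  have flin: "linear f" using f(1) by (rule bounded_linear.linear)
  note fs = linear_add[OF flin] linear_diff[OF flin] linear_scale[OF flin]
  define J where "J x = Re (cinner (A x) x) - 2 * Re (f x)" for x
  obtain K where K: "K > 0" "\<And>x. cmod (f x) \<le> K * norm x"
    using bounded_linear.pos_bounded[OF f(1)] by (auto simp: mult.commute)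
  have lower: "J x \<ge> - (K\<^sup>2 / \<epsilon>)" for x
  proof -
    have "Re (f x) \<le> K * norm x" using K(2)[of x] complex_Re_le_cmod order_trans by blast
    then have "J x \<ge> \<epsilon> * (norm x)\<^sup>2 - 2 * (K * norm x)" using \<epsilon>(2)[of x] by (simp add: J_def)
    moreover have "\<epsilon> * (norm x)\<^sup>2 - 2 * (K * norm x) = \<epsilon> * (norm x - K/\<epsilon>)\<^sup>2 - K\<^sup>2/\<epsilon>"
      using \<epsilon>(1) by (simp add: power2_eq_square field_simps)
    moreover have "\<epsilon> * (norm x - K/\<epsilon>)\<^sup>2 \<ge> 0" using \<epsilon>(1) by simp
    ultimately show ?thesis by linarith
  qed
  then have bdd: "bdd_below (range J)" by (auto intro!: bdd_belowI)
  define m where "m = Inf (range J)"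
  have mle: "m \<le> J x" for x unfolding m_def using bdd by (intro cINF_lower) auto
  have "\<exists>x. J x < m + 1 / Suc n" for n
    using cInf_less_iff[of "range J" "m + 1 / Suc n"] bdd by (auto simp: m_def)
  then obtain X where X: "\<And>n. J (X n) < m + 1 / Suc n" by metis
  \<comment> \<open>The linear part of \<open>J\<close> cancels, which leaves the parallelogram
    identity for the form of \<open>A\<close>.\<close>
  have par: "J x + J y - 2 * J ((1/2) *\<^sub>R (x + y)) = (1/2) * Re (cinner (A (x - y)) (x - y))" for x y
    by (simp add: J_def Asimps fs cinner_simps linear_add[OF flin] algebra_simps)
  have close: "(norm (X k - X n))\<^sup>2 \<le> (2/\<epsilon>) * (1 / Suc k + 1 / Suc n)" for k n
  proof -
    have "(1/2) * (\<epsilon> * (norm (X k - X n))\<^sup>2) \<le> J (X k) + J (X n) - 2 * J ((1/2) *\<^sub>R (X k + X n))"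
      unfolding par using \<epsilon>(2) by simp
    also have "\<dots> \<le> 1 / Suc k + 1 / Suc n"
      using X[of k] X[of n] mle[of "(1/2) *\<^sub>R (X k + X n)"] by linarith
    finally have "2 * ((1/2) * (\<epsilon> * (norm (X k - X n))\<^sup>2)) \<le> 2 * (1 / Suc k + 1 / Suc n)"
      by (rule mult_left_mono) simp
    then have "\<epsilon> * (norm (X k - X n))\<^sup>2 \<le> 2 * (1 / Suc k + 1 / Suc n)" by simp
    then have "(norm (X k - X n))\<^sup>2 \<le> 2 * (1 / Suc k + 1 / Suc n) / \<epsilon>"
      using \<epsilon>(1) by (simp only: pos_le_divide_eq mult.commute)
    then show ?thesis by (simp only: times_divide_eq_left)
  qed
  have "Cauchy X"
  proof (rule CauchyI)
    fix e :: real assume e: "e > 0"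
    have "(\<lambda>n. (2/\<epsilon>) * (1 / Suc n + 1 / Suc n)) \<longlonglongrightarrow> (2/\<epsilon>) * (0 + 0)"
      by (intro tendsto_intros LIMSEQ_Suc[OF lim_1_over_n])
    then have "eventually (\<lambda>n. (2/\<epsilon>) * (1 / Suc n + 1 / Suc n) < e\<^sup>2) sequentially"
      using e by (intro order_tendstoD(2)) auto
    then obtain N where N: "(2/\<epsilon>) * (1 / Suc N + 1 / Suc N) < e\<^sup>2"
      by (auto simp: eventually_sequentially)
    show "\<exists>M. \<forall>m\<ge>M. \<forall>n\<ge>M. norm (X m - X n) < e"
    proof (intro exI[of _ N] allI impI)
      fix k n assume kn: "k \<ge> N" "n \<ge> N"
      have "(2/\<epsilon>) * (1 / Suc k + 1 / Suc n) \<le> (2/\<epsilon>) * (1 / Suc N + 1 / Suc N)"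
        using kn \<epsilon>(1) by (intro mult_left_mono add_mono divide_left_mono) auto
      then have "(norm (X k - X n))\<^sup>2 < e\<^sup>2" using close[of k n] N by linarith
      then show "norm (X k - X n) < e" using e by (simp add: power_less_imp_less_base)
    qed
  qed
  then obtain x where x: "X \<longlonglongrightarrow> x" by (auto simp: Cauchy_convergent_iff convergent_def)
  have "(\<lambda>n. J (X n)) \<longlonglongrightarrow> J x"
    unfolding J_def
    by (intro tendsto_intros x bounded_linear.tendsto[OF bounded_clinear_linear[OF lin]]
        bounded_linear.tendsto[OF f(1)])
  moreover have "(\<lambda>n. m + 1 / Suc n) \<longlonglongrightarrow> m + 0"
    by (intro tendsto_intros LIMSEQ_Suc[OF lim_1_over_n])
  ultimately have "J x \<le> m + 0"
    by (rule LIMSEQ_le) (intro exI[of _ 0] allI impI less_imp_le X)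
  then have min: "J x \<le> J y" for y using mle[of y] by simp
  have re: "Re (f y) = Re (cinner y (A x))" for y
  proof -
    define d where "d = Re (cinner y (A x)) - Re (f y)"
    define q where "q = Re (cinner (A y) y)"
    have "0 \<le> 2 * t * d + t\<^sup>2 * q" for t
    proof -
      have "J (x + t *\<^sub>R y) - J x = t * (Re (cinner (A x) y) + Re (cinner (A y) x)) - 2 * t * Re (f y) + t\<^sup>2 * q"
        by (simp add: J_def Asimps fs cinner_simps q_def power2_eq_square algebra_simps)
      also have "cinner (A y) x = cinner y (A x)" by (rule positive_op_self_adjoint[OF A])
      also have "Re (cinner (A x) y) = Re (cinner y (A x))" by (rule Re_cinner_commute)
      finally show ?thesis using min[of "x + t *\<^sub>R y"] by (simp add: d_def algebra_simps)
    qed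
    \<comment> \<open>Replacing \<open>t\<close> by \<open>- d * t\<close> produces the form of
      \<open>quadratic_discriminant\<close> with \<open>p = 0\<close> and \<open>a = d^2\<close>,
      which forces \<open>d = 0\<close>.\<close>
    from this[of "-d * t" for t] have "d\<^sup>2 \<le> 0 * q"
      by (intro quadratic_discriminant) (auto simp: q_def positive_op_ge[OF A] power2_eq_square algebra_simps)
    then show ?thesis by (simp add: d_def)
  qed
  have "f y = cinner y (A x)" for y
  proof (rule complex_eqI)
    have "Im (f y) = - Re (f (\<i> *\<^sub>C y))" by (simp add: f(2))
    also have "\<dots> = Im (cinner y (A x))" by (simp add: re cinner_simps)
    finally show "Im (f y) = Im (cinner y (A x))" .
  qed (rule re)
  then show thesis by (rule that)
qed

lemma Riesz:
  fixes f :: "'a::complex_hilbert \<Rightarrow> complex"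
  assumes "bounded_linear f" "\<And>c x. f (c *\<^sub>C x) = c * f x"
  obtains x where "\<And>y. f y = cinner y x"
  by (rule Lax_Milgram[OF positive_op_id, of 1 f]) (use assms in \<open>auto simp: cinner_self\<close>)

lemma adj_eqI:
  fixes T :: "'a::complex_hilbert \<Rightarrow> 'b::complex_hilbert"
  assumes "\<And>x y. cinner (T x) y = cinner x (S y)"
  shows "adj_op T = S"
  unfolding adj_op_def
proof (rule the_equality)
  fix R assume "\<forall>x y. cinner (T x) y = cinner x (R y)"
  then have "R y = S y" for y using assms by (intro cinner_ext') metis
  then show "R = S" by blast
qed (simp add: assms)

text \<open>Riesz, applied for each \<open>y\<close>, supplies the operator to which the definite
  description \<open>adj_op\<close> refers.\<close>

lemma cinner_adj:
  fixes T :: "'a::complex_hilbert \<Rightarrow> 'b::complex_hilbert"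
  assumes T: "bounded_clinear T"
  shows "cinner (T x) y = cinner x (adj_op T y)"
proof -
  have "\<forall>y. \<exists>z. \<forall>x. cinner (T x) y = cinner x z"
  proof
    fix y
    have "bounded_linear (\<lambda>x. cinner (T x) y)"
      using bounded_linear_compose[OF bounded_linear_cinner_left bounded_clinear_linear[OF T]] .
    from Riesz[OF this] show "\<exists>z. \<forall>x. cinner (T x) y = cinner x z"
      by (metis bounded_clinear_scaleC[OF T] cinner_scaleC_left)
  qed
  then obtain S where "\<forall>y. \<forall>x. cinner (T x) y = cinner x (S y)" unfolding choice_iff by blast
  then have S: "\<And>x y. cinner (T x) y = cinner x (S y)" by blast
  have "adj_op T = S" by (rule adj_eqI) (rule S)
  then show ?thesis using S by simp
qed

lemma cinner_adj':
  fixes T :: "'a::complex_hilbert \<Rightarrow> 'b::complex_hilbert"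
  assumes T: "bounded_clinear T"
  shows "cinner (adj_op T y) x = cinner y (T x)"
  using cinner_adj[OF T, of x y] by (metis cinner_commute)

lemma adj_norm_le:
  fixes T :: "'a::complex_hilbert \<Rightarrow> 'b::complex_hilbert"
  assumes T: "bounded_clinear T" and K: "K \<ge> 0" "\<And>x. norm (T x) \<le> K * norm x"
  shows "norm (adj_op T y) \<le> K * norm y"
proof (rule norm_le_of_cinner)
  fix z
  have "cmod (cinner (adj_op T y) z) \<le> norm y * norm (T z)"
    unfolding cinner_adj'[OF T] by (rule Cauchy_Schwarz)
  also have "\<dots> \<le> norm y * (K * norm z)" by (intro mult_left_mono K) auto
  finally show "cmod (cinner (adj_op T y) z) \<le> K * norm y * norm z" by (simp add: mult_ac)
qed (use K in auto)

lemma bounded_clinear_adj: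
  fixes T :: "'a::complex_hilbert \<Rightarrow> 'b::complex_hilbert"
  assumes T: "bounded_clinear T"
  shows "bounded_clinear (adj_op T)"
proof -
  obtain K where K: "K > 0" "\<And>x. norm (T x) \<le> K * norm x" using bounded_clinear_bound[OF T] by metis
  show ?thesis
  proof (rule bounded_clinearI[where K=K])
    show "adj_op T (x + y) = adj_op T x + adj_op T y" for x y
      by (rule cinner_ext) (simp add: cinner_simps cinner_adj'[OF T])
    show "adj_op T (c *\<^sub>C x) = c *\<^sub>C adj_op T x" for c x
      by (rule cinner_ext) (simp add: cinner_simps cinner_adj'[OF T])
    show "norm (adj_op T x) \<le> K * norm x" for x
      by (rule adj_norm_le[OF T]) (use K in auto)
  qed
qed

lemma adj_positive_op: "positive_op A \<Longrightarrow> adj_op A = (A :: 'a::complex_hilbert \<Rightarrow> 'a)"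
  by (rule adj_eqI) (rule positive_op_self_adjoint)

section \<open>Square roots of positive operators\<close>

text \<open>The coefficients of the power series of \<open>sqrt (1 - t)\<close>.\<close>

definition sqrt_coeff :: "nat \<Rightarrow> real" where
  "sqrt_coeff n = pochhammer (- 1/2) n / fact n"

text \<open>Taking partial sums of coefficients multiplies a series by \<open>1/(1 - t)\<close>; the
  result is the series of \<open>1 / sqrt (1 - t)\<close>, whose coefficients are visibly
  positive.\<close>

lemma sum_sqrt_coeff: "(\<Sum>k\<le>n. sqrt_coeff k) = pochhammer (1/2) n / fact n"
proof (induction n)
  case (Suc n)
  define s :: real where "s = pochhammer (1/2) n / fact n"
  have "sqrt_coeff (Suc n) = - (1/2) * s / (real n + 1)"
    by (simp add: sqrt_coeff_def pochhammer_rec s_def add.commute)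
  moreover have "pochhammer (1/2) (Suc n) / fact (Suc n) = (1/2 + real n) * s / (real n + 1)"
    by (simp add: pochhammer_rec' s_def add.commute)
  moreover have "s - (1/2) * s / (real n + 1) = (1/2 + real n) * s / (real n + 1)"
    by (simp add: field_simps)
  ultimately show ?case using Suc by (simp flip: s_def)
qed (simp add: sqrt_coeff_def)

lemma sqrt_coeff_Suc_nonpos: "sqrt_coeff (Suc n) \<le> 0"
  using pochhammer_nonneg[of "1/2 :: real" n] by (simp add: sqrt_coeff_def pochhammer_rec)

text \<open>Only the zeroth coefficient, equal to \<open>1\<close>, is positive. Hence the partial
  sums of the coefficients and of their absolute values add up to exactly \<open>2\<close>, and the
  former are nonnegative.\<close>

lemma abs_sqrt_coeff_summable: "(\<lambda>n. \<bar>sqrt_coeff n\<bar>) summable_on UNIV"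
proof -
  have "(\<Sum>k\<le>n. \<bar>sqrt_coeff k\<bar>) + (\<Sum>k\<le>n. sqrt_coeff k) = 2" for n
  proof (induction n)
    case (Suc n)
    then show ?case using sqrt_coeff_Suc_nonpos[of n] by simp
  qed (simp add: sqrt_coeff_def)
  moreover have "(\<Sum>k\<le>n. sqrt_coeff k) \<ge> 0" for n
    unfolding sum_sqrt_coeff by (simp add: pochhammer_nonneg)
  ultimately have le: "(\<Sum>k\<le>n. \<bar>sqrt_coeff k\<bar>) \<le> 2" for n by (metis le_add_same_cancel1)
  have "(\<Sum>k<n. \<bar>sqrt_coeff k\<bar>) \<le> 2" for n
    by (rule order_trans[OF _ le[of n]], rule sum_mono2) auto
  then have "summable (\<lambda>n. \<bar>sqrt_coeff n\<bar>)"
    by (intro summableI_nonneg_bounded[where x=2]) auto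
  then show ?thesis by (simp add: summable_on_UNIV_nonneg_real_iff)
qed

lemma infsum_sqrt_coeff_nonneg: "(sqrt_coeff has_sum s) UNIV \<Longrightarrow> s \<ge> 0"
proof -
  assume "(sqrt_coeff has_sum s) UNIV"
  then have "(\<lambda>n. \<Sum>k\<le>n. sqrt_coeff k) \<longlonglongrightarrow> s"
    using has_sum_imp_sums sums_def_le by blast
  then show ?thesis
    by (rule LIMSEQ_le_const) (auto simp: sum_sqrt_coeff pochhammer_nonneg)
qed

text \<open>Vandermonde's identity for rising factorials: the squared series has the coefficients
  \<open>pochhammer (-1) k / fact k\<close>, which are those of \<open>1 - t\<close>.\<close>

lemma sqrt_coeff_convolution:
  "(\<Sum>i\<le>k. sqrt_coeff i * sqrt_coeff (k - i)) = (if k = 0 then 1 else if k = 1 then -1 else 0)"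
proof -
  have "(\<Sum>i\<le>k. sqrt_coeff i * sqrt_coeff (k - i))
      = (\<Sum>i\<le>k. of_nat (k choose i) * pochhammer (- 1/2) i * pochhammer (- 1/2) (k - i)) / fact k"
    unfolding sum_divide_distrib
    by (intro sum.cong) (auto simp: sqrt_coeff_def binomial_fact)
  also have "\<dots> = pochhammer (-1/2 + -1/2 :: real) k / fact k"
    by (simp only: pochhammer_binomial_sum)
  also have "pochhammer (-1/2 + -1/2 :: real) k = (if k = 0 then 1 else if k = 1 then -1 else 0)"
    by (cases k; cases "k - 1") (auto simp: pochhammer_rec)
  finally show ?thesis by auto
qed

lemma funpow_contraction:
  fixes A :: "'a::real_normed_vector \<Rightarrow> 'a"
  assumes "\<And>x. norm (A x) \<le> norm x"
  shows "norm ((A ^^ n) x) \<le> norm x"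
proof (induction n)
  case (Suc n)
  then show ?case using assms[of "(A ^^ n) x"] by simp
qed simp

lemma bounded_clinear_funpow:
  fixes A :: "'a::complex_inner \<Rightarrow> 'a"
  shows "bounded_clinear A \<Longrightarrow> bounded_clinear (A ^^ n)"
proof (induction n)
  case (Suc n)
  then show ?case using bounded_clinear_compose[of A "A ^^ n"] by (simp add: o_def)
qed (simp add: id_def bounded_clinear_id)

lemma funpow_self_adjoint:
  fixes A :: "'a::complex_inner \<Rightarrow> 'a"
  assumes "\<And>x y. cinner (A x) y = cinner x (A y)"
  shows "cinner ((A ^^ n) x) y = cinner x ((A ^^ n) y)"
  by (induction n arbitrary: x y) (simp_all add: assms funpow_swap1)

text \<open>Absolute summability of the coefficients together with \<open>|A^n x| \<le> |x|\<close>
  allows the series to be evaluated at \<open>A\<close>. The commutation clause is carried along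
  because uniqueness of the square root rests on it.\<close>

lemma sqrt_one_minus:
  fixes A :: "'a::complex_hilbert \<Rightarrow> 'a"
  assumes A: "positive_op A" and A1: "\<And>x. norm (A x) \<le> norm x"
  obtains R where "positive_op R" "\<And>x. R (R x) = x - A x"
    "\<And>S x. bounded_clinear S \<Longrightarrow> (\<And>x. S (A x) = A (S x)) \<Longrightarrow> S (R x) = R (S x)"
proof -
  note lin = positive_opD[OF A]
  note plin = bounded_clinear_funpow[OF lin]
  have p1: "norm ((A ^^ n) x) \<le> norm x" for n x by (rule funpow_contraction) (rule A1)
  define M where "M = (\<Sum>\<^sub>\<infinity>n. \<bar>sqrt_coeff n\<bar>)"
  have M: "((\<lambda>n. \<bar>sqrt_coeff n\<bar>) has_sum M) UNIV"
    unfolding M_def by (rule has_sum_infsum[OF abs_sqrt_coeff_summable])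
  define R where "R x = (\<Sum>\<^sub>\<infinity>n. sqrt_coeff n *\<^sub>R (A ^^ n) x)" for x
  have nsum: "(\<lambda>n. norm (sqrt_coeff n *\<^sub>R (A ^^ n) x)) summable_on UNIV" for x
    by (rule Infinite_Sum.abs_summable_on_comparison_test'[OF summable_on_cmult_left[OF abs_sqrt_coeff_summable, of "norm x"]])
       (auto intro!: mult_left_mono p1)
  have R: "((\<lambda>n. sqrt_coeff n *\<^sub>R (A ^^ n) x) has_sum R x) UNIV" for x
    unfolding R_def by (rule has_sum_infsum[OF abs_summable_summable[OF nsum]])
  have comm: "S (R x) = R (S x)" if S: "bounded_clinear S" "\<And>x. S (A x) = A (S x)" for S x
  proof -
    have "S ((A ^^ n) x) = (A ^^ n) (S x)" for n x
      by (induction n arbitrary: x) (auto simp: S(2))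
    then have "((\<lambda>n. sqrt_coeff n *\<^sub>R (A ^^ n) (S x)) has_sum S (R x)) UNIV"
      using has_sum_bounded_linear[OF bounded_clinear_linear[OF S(1)] R[of x]]
      by (simp add: bounded_clinear_simps[OF S(1)])
    then show ?thesis using R has_sum_unique by blast
  qed
  have Rlin: "bounded_clinear R"
  proof (rule bounded_clinearI[where K=M])
    show "R (x + y) = R x + R y" for x y
      using has_sum_add[OF R[of x] R[of y]] R[of "x + y"]
      by (simp add: bounded_clinear_simps[OF plin] has_sum_unique flip: scaleR_add_right)
    \<comment> \<open>Complex homogeneity is the commutation property for multiplication by
      \<open>c\<close>.\<close>
    show "R (c *\<^sub>C x) = c *\<^sub>C R x" for c x
      using comm[OF bounded_clinear_cscale[OF bounded_clinear_id, of c]]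
      by (simp add: bounded_clinear_simps[OF lin])
    show "norm (R x) \<le> M * norm x" for x
    proof -
      have "((\<lambda>n. \<bar>sqrt_coeff n\<bar> * norm x) has_sum (M * norm x)) UNIV"
        by (rule has_sum_cmult_left[OF M])
      then have "(\<Sum>\<^sub>\<infinity>n. norm (sqrt_coeff n *\<^sub>R (A ^^ n) x)) \<le> M * norm x"
        by (intro has_sum_mono[OF has_sum_infsum[OF nsum]]) (auto intro!: mult_left_mono p1)
      then show ?thesis
        unfolding R_def using norm_infsum_bound[OF nsum[of x]] by linarith
    qed
  qed
  have pos: "positive_op R"
  proof (rule positive_opI[OF Rlin])
    fix x :: 'a
    have bl: "bounded_linear (\<lambda>y. Re (cinner y x))"
      using bounded_linear_compose[OF bounded_linear_Re bounded_linear_cinner_left] .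
    have 1: "((\<lambda>n. sqrt_coeff n * Re (cinner ((A ^^ n) x) x)) has_sum Re (cinner (R x) x)) UNIV"
      using has_sum_bounded_linear[OF bl R[of x]] by (simp add: cinner_simps)
    obtain s where s: "(sqrt_coeff has_sum s) UNIV"
      using abs_summable_summable[of sqrt_coeff] abs_sqrt_coeff_summable by (auto simp: summable_on_def)
    have 2: "((\<lambda>n. sqrt_coeff n * (norm x)\<^sup>2) has_sum (s * (norm x)\<^sup>2)) UNIV"
      by (rule has_sum_cmult_left[OF s])
    \<comment> \<open>Beyond \<open>n = 0\<close> the coefficients are nonpositive and
      \<open>Re <A^n x, x> \<le> |x|^2\<close>, so replacing every form by \<open>|x|^2\<close> can
      only lower the sum. What remains is the value of the scalar series at \<open>t = 1\<close>, of
      which only the sign matters.\<close>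
    have "s * (norm x)\<^sup>2 \<le> Re (cinner (R x) x)"
    proof (rule has_sum_mono[OF 2 1])
      fix n
      have "Re (cinner ((A ^^ n) x) x) \<le> norm ((A ^^ n) x) * norm x"
        using complex_Re_le_cmod Cauchy_Schwarz order_trans by blast
      also have "\<dots> \<le> (norm x)\<^sup>2" by (auto simp: power2_eq_square intro!: mult_right_mono p1)
      finally show "sqrt_coeff n * (norm x)\<^sup>2 \<le> sqrt_coeff n * Re (cinner ((A ^^ n) x) x)"
        by (cases n) (auto simp: cinner_self intro!: mult_left_mono_neg sqrt_coeff_Suc_nonpos
            simp del: funpow.simps(2))
    qed
    then show "Re (cinner (R x) x) \<ge> 0"
      using infsum_sqrt_coeff_nonneg[OF s] by (meson mult_nonneg_nonneg order_trans zero_le_power2)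
    have "cinner (R x) x = cinner x (R x)"
    proof (rule has_sum_unique)
      show "((\<lambda>n. of_real (sqrt_coeff n) * cinner ((A ^^ n) x) x) has_sum cinner (R x) x) UNIV"
        using has_sum_bounded_linear[OF bounded_linear_cinner_left R[of x]] by (simp add: cinner_simps)
      show "((\<lambda>n. of_real (sqrt_coeff n) * cinner ((A ^^ n) x) x) has_sum cinner x (R x)) UNIV"
        using has_sum_bounded_linear[OF bounded_linear_cinner_right R[of x]]
        by (simp add: cinner_simps funpow_self_adjoint[OF positive_op_self_adjoint[OF A]])
    qed
    then have "Im (cinner (R x) x) = Im (cnj (cinner (R x) x))" by (metis cinner_commute)
    then show "Im (cinner (R x) x) = 0" by simp
  qed
  have sq: "R (R x) = x - A x" for x
  proof -
    define f where "f = (\<lambda>(m, n). (sqrt_coeff m * sqrt_coeff n) *\<^sub>R (A ^^ (m + n)) x)"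
    have "(\<lambda>p. norm (f p)) summable_on UNIV \<times> UNIV"
    proof (rule Infinite_Sum.abs_summable_on_comparison_test')
      show "(\<lambda>(m, n). (\<bar>sqrt_coeff m\<bar> * \<bar>sqrt_coeff n\<bar>) * norm x) summable_on UNIV \<times> UNIV"
      proof (rule summable_on_SigmaI)
        show "((\<lambda>n. case (m, n) of (m, n) \<Rightarrow> \<bar>sqrt_coeff m\<bar> * \<bar>sqrt_coeff n\<bar> * norm x)
            has_sum \<bar>sqrt_coeff m\<bar> * M * norm x) UNIV" for m
          by (auto intro!: has_sum_cmult_left has_sum_cmult_right M)
        show "(\<lambda>m. \<bar>sqrt_coeff m\<bar> * M * norm x) summable_on UNIV"
          by (intro summable_on_cmult_left abs_sqrt_coeff_summable)
      qed auto
    qed (auto simp: f_def abs_mult intro!: mult_left_mono p1)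
    then obtain S where S: "(f has_sum S) (UNIV \<times> UNIV)"
      using abs_summable_summable by (auto simp: summable_on_def)
    have "((\<lambda>m. sqrt_coeff m *\<^sub>R (A ^^ m) (R x)) has_sum S) UNIV"
    proof (rule has_sum_SigmaD[OF S])
      fix m
      have "bounded_linear (\<lambda>y. sqrt_coeff m *\<^sub>R (A ^^ m) y)"
        using bounded_clinear_linear[OF bounded_clinear_scaleR_op[OF plin]] .
      from has_sum_bounded_linear[OF this R[of x]]
      show "((\<lambda>n. f (m, n)) has_sum sqrt_coeff m *\<^sub>R (A ^^ m) (R x)) UNIV"
        by (simp add: f_def bounded_clinear_simps[OF plin] funpow_add)
    qed
    then have S1: "S = R (R x)" using R[of "R x"] has_sum_unique by blast
    \<comment> \<open>Summation along the diagonals \<open>k = m + n\<close> turns the double series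
      into a Cauchy product.\<close>
    have "((\<lambda>(k, i). f (i, k - i)) has_sum S) (SIGMA k:UNIV. {..k})"
      by (rule has_sum_reindex_bij_witness[of _ "\<lambda>(m, n). (m + n, m)" "\<lambda>(k, i). (i, k - i)",
            THEN iffD2, OF _ _ _ _ _ _ S]) auto
    then have "((\<lambda>k. \<Sum>i\<le>k. f (i, k - i)) has_sum S) UNIV"
      by (rule has_sum_SigmaD) (auto intro: has_sum_finiteI)
    moreover have "(\<Sum>i\<le>k. f (i, k - i)) = (if k = 0 then 1 else if k = 1 then -1 else 0) *\<^sub>R (A ^^ k) x" for k
    proof -
      have "(\<Sum>i\<le>k. f (i, k - i)) = (\<Sum>i\<le>k. sqrt_coeff i * sqrt_coeff (k - i)) *\<^sub>R (A ^^ k) x"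
        unfolding scaleR_sum_left by (intro sum.cong) (auto simp: f_def)
      then show ?thesis unfolding sqrt_coeff_convolution .
    qed
    ultimately have "((\<lambda>k. (if k = 0 then 1 else if k = 1 then -1 else 0) *\<^sub>R (A ^^ k) x) has_sum S) UNIV"
      by simp
    moreover have "((\<lambda>k. (if k = 0 then 1 else if k = 1 then -1 else 0) *\<^sub>R (A ^^ k) x) has_sum (x - A x)) UNIV"
      by (rule has_sum_finite_neutralI[of "{0, 1}"]) auto
    ultimately show ?thesis using S1 has_sum_unique by blast
  qed
  show thesis by (rule that[OF pos sq comm])
qed

text \<open>Rescaling: if \<open>K\<close> bounds the norm of \<open>P\<close>, then
  \<open>A = 1 - P/K\<close> is a positive contraction, and \<open>sqrt K\<close> times the root of
  \<open>1 - A\<close> is a root of \<open>P\<close>.\<close>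

lemma sqrt_op_exists:
  fixes P :: "'a::complex_hilbert \<Rightarrow> 'a"
  assumes P: "positive_op P"
  obtains R where "positive_op R" "\<And>x. R (R x) = P x"
    "\<And>S x. bounded_clinear S \<Longrightarrow> (\<And>x. S (P x) = P (S x)) \<Longrightarrow> S (R x) = R (S x)"
proof -
  note lin = positive_opD[OF P]
  obtain K where K: "K > 0" "\<And>x. norm (P x) \<le> K * norm x" using bounded_clinear_bound[OF lin] by metis
  define A where "A x = x - (1/K) *\<^sub>R P x" for x
  have Alin: "bounded_clinear A"
    unfolding A_def by (intro bounded_clinear_minus bounded_clinear_id bounded_clinear_scaleR_op lin)
  have A: "positive_op A"
  proof (rule positive_opI[OF Alin])
    fix x
    have "Re (cinner (P x) x) \<le> norm (P x) * norm x"
      using complex_Re_le_cmod Cauchy_Schwarz order_trans by blast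
    also have "\<dots> \<le> K * (norm x)\<^sup>2"
      using K(2)[of x] by (simp add: power2_eq_square mult_right_mono flip: mult.assoc)
    finally show "Re (cinner (A x) x) \<ge> 0"
      using K(1) by (simp add: A_def cinner_simps cinner_self field_simps)
    show "Im (cinner (A x) x) = 0"
      by (simp add: A_def cinner_simps cinner_self positive_op_Im[OF P])
  qed
  have "norm (A x) \<le> 1 * norm x" for x
  proof (rule positive_op_norm_le[OF A])
    show "Re (cinner (A x) x) \<le> 1 * (norm x)\<^sup>2" for x
      using positive_op_ge[OF P, of x] K(1) by (simp add: A_def cinner_simps cinner_self)
  qed simp
  then obtain R where R: "positive_op R" "\<And>x. R (R x) = x - A x"
    "\<And>S x. bounded_clinear S \<Longrightarrow> (\<And>x. S (A x) = A (S x)) \<Longrightarrow> S (R x) = R (S x)"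
    using sqrt_one_minus[OF A] by auto
  note Rlin = positive_opD[OF R(1)]
  define Q where "Q x = sqrt K *\<^sub>R R x" for x
  show thesis
  proof (rule that)
    have "bounded_clinear Q" unfolding Q_def by (rule bounded_clinear_scaleR_op[OF Rlin])
    then show "positive_op Q"
      using positive_op_ge[OF R(1)] positive_op_Im[OF R(1)] K(1)
      by (intro positive_opI) (auto simp: Q_def cinner_simps)
    show "Q (Q x) = P x" for x
      using K(1) by (simp add: Q_def bounded_clinear_simps[OF Rlin] R(2) A_def)
    show "S (Q x) = Q (S x)" if S: "bounded_clinear S" "\<And>x. S (P x) = P (S x)" for S x
      using R(3)[OF S(1)] by (simp add: Q_def A_def bounded_clinear_simps[OF S(1)] S(2))
  qed
qed

text \<open>Any square root of \<open>P\<close> commutes with \<open>P\<close>, hence with the root \<open>Q\<close> constructed above, so that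
  \<open>(R + Q) (R - Q) = 0\<close>.\<close>

lemma sqrt_op_unique:
  fixes P :: "'a::complex_hilbert \<Rightarrow> 'a"
  assumes P: "positive_op P"
    and R: "positive_op R" "\<And>x. R (R x) = P x" and S: "positive_op S" "\<And>x. S (S x) = P x"
  shows "R = S"
proof -
  obtain Q where Q: "positive_op Q" "\<And>x. Q (Q x) = P x"
    "\<And>S x. bounded_clinear S \<Longrightarrow> (\<And>x. S (P x) = P (S x)) \<Longrightarrow> S (Q x) = Q (S x)"
    using sqrt_op_exists[OF P] by metis
  have "T x = Q x" if T: "positive_op T" "\<And>x. T (T x) = P x" for T x
  proof -
    note Tl = positive_opD[OF T(1)] and Ql = positive_opD[OF Q(1)]
    have c: "T (Q x) = Q (T x)" for x by (rule Q(3)[OF Tl]) (simp flip: T(2))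
    define y where "y = T x - Q x"
    have "T y + Q y = 0"
      by (simp add: y_def bounded_clinear_simps[OF Tl] bounded_clinear_simps[OF Ql] c T(2) Q(2))
    \<comment> \<open>Two nonnegative forms with sum zero both vanish, so
      \<open>T y = Q y = 0\<close>; then \<open>|y|^2 = <x, (T - Q) y> = 0\<close>.\<close>
    then have "Re (cinner (T y) y) + Re (cinner (Q y) y) = 0"
      by (metis cinner_add_left cinner_zero_left plus_complex.simps(1) zero_complex.simps(1))
    then have "Re (cinner (T y) y) = 0" "Re (cinner (Q y) y) = 0"
      using positive_op_ge[OF T(1), of y] positive_op_ge[OF Q(1), of y] by linarith+
    then have 0: "T y = 0" "Q y = 0" using positive_op_zero T(1) Q(1) by blast+
    have "cinner (T x - Q x) y = cinner x (T y - Q y)"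
      by (simp only: cinner_diff_left cinner_diff_right positive_op_self_adjoint[OF T(1)]
          positive_op_self_adjoint[OF Q(1)])
    then have "cinner y y = 0" using 0 by (simp add: y_def)
    then show ?thesis by (simp add: cinner_self y_def)
  qed
  then show ?thesis using R S by (metis ext)
qed


section \<open>The absolute value\<close>

lemma positive_op_adj_comp:
  fixes T :: "'a::complex_hilbert \<Rightarrow> 'b::complex_hilbert"
  assumes T: "bounded_clinear T"
  shows "positive_op (\<lambda>x. adj_op T (T x))"
proof (rule positive_opI)
  show "bounded_clinear (\<lambda>x. adj_op T (T x))"
    by (rule bounded_clinear_compose[OF bounded_clinear_adj[OF T] T])
qed (simp_all add: cinner_adj'[OF T] cinner_self)

lemma
  fixes T :: "'a::complex_hilbert \<Rightarrow> 'a"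
  assumes T: "bounded_clinear T"
  shows positive_op_abs_op: "positive_op (abs_op T)"
    and abs_op_abs_op: "abs_op T (abs_op T x) = adj_op T (T x)"
proof -
  note pos = positive_op_adj_comp[OF T]
  obtain R where R: "positive_op R" "\<And>x. R (R x) = adj_op T (T x)"
    using sqrt_op_exists[OF pos] by metis
  have "abs_op T = R" unfolding abs_op_def
  proof (rule the_equality)
    fix S assume "positive_op S \<and> S \<circ> S = adj_op T \<circ> T"
    then show "S = R" using sqrt_op_unique[OF pos, of S R] R by (auto simp: o_def fun_eq_iff)
  qed (use R in \<open>auto simp: o_def\<close>)
  then show "positive_op (abs_op T)" "abs_op T (abs_op T x) = adj_op T (T x)" using R by simp_all
qed

lemma abs_op_positive:
  fixes A :: "'a::complex_hilbert \<Rightarrow> 'a"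
  assumes A: "positive_op A"
  shows "abs_op A = A"
proof -
  note lin = positive_opD[OF A]
  show ?thesis
    by (rule sqrt_op_unique[OF positive_op_adj_comp[OF lin] positive_op_abs_op[OF lin] abs_op_abs_op[OF lin] A])
       (simp add: adj_positive_op[OF A])
qed

lemma norm_abs_op:
  fixes T :: "'a::complex_hilbert \<Rightarrow> 'a"
  assumes T: "bounded_clinear T"
  shows "norm (abs_op T x) = norm (T x)"
proof -
  have "cinner (abs_op T x) (abs_op T x) = cinner (T x) (T x)"
    by (simp add: positive_op_self_adjoint[OF positive_op_abs_op[OF T]] abs_op_abs_op[OF T] cinner_adj[OF T])
  then have "(norm (abs_op T x))\<^sup>2 = (norm (T x))\<^sup>2" unfolding cinner_self of_real_eq_iff .
  then show ?thesis by (simp add: power2_eq_iff_nonneg)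
qed

definition contraction :: "('a::complex_inner \<Rightarrow> 'b::complex_inner) \<Rightarrow> bool" where
  "contraction W \<longleftrightarrow> bounded_clinear W \<and> (\<forall>x. norm (W x) \<le> norm x)"

lemma contractionD: "contraction W \<Longrightarrow> bounded_clinear W" "contraction W \<Longrightarrow> norm (W x) \<le> norm x"
  by (simp_all add: contraction_def)

lemma contraction_id: "contraction (\<lambda>x. x)"
  by (simp add: contraction_def bounded_clinear_id)

lemma contraction_compose: "contraction V \<Longrightarrow> contraction W \<Longrightarrow> contraction (\<lambda>x. V (W x))"
  by (auto simp: contraction_def bounded_clinear_compose intro: order_trans)

lemma contraction_adj:
  fixes W :: "'a::complex_hilbert \<Rightarrow> 'b::complex_hilbert"
  assumes "contraction W" shows "contraction (adj_op W)"
  using assms adj_norm_le[of W 1] bounded_clinear_adj[of W] by (simp add: contraction_def)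

text \<open>\<open>P + \<epsilon>\<close> is coercive, so Lax-Milgram solves
  \<open>(P + \<epsilon>) x = z\<close>, and
  \<open>\<epsilon> |x| \<le> |(P + \<epsilon>) x|\<close> gives injectivity and the norm bound. The
  two equations say that \<open>G\<close> inverts \<open>P + \<epsilon>\<close> from either
  side.\<close>

lemma resolvent_exists:
  fixes P :: "'a::complex_hilbert \<Rightarrow> 'a"
  assumes P: "positive_op P" and \<epsilon>: "\<epsilon> > 0"
  obtains G where "bounded_clinear G" "\<And>x. P (G x) + \<epsilon> *\<^sub>R G x = x" "\<And>x. G (P x) = x - \<epsilon> *\<^sub>R G x"
    "\<And>x y. cinner (G x) y = cinner x (G y)"
proof -
  note lin = positive_opD[OF P]
  define A where "A x = P x + \<epsilon> *\<^sub>R x" for x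
  have Alin: "bounded_clinear A"
    unfolding A_def by (intro bounded_clinear_plus bounded_clinear_id bounded_clinear_scaleR_op lin)
  have ge: "\<epsilon> * (norm x)\<^sup>2 \<le> Re (cinner (A x) x)" for x
    using positive_op_ge[OF P, of x] by (simp add: A_def cinner_simps cinner_self)
  have A: "positive_op A"
  proof (rule positive_opI[OF Alin])
    show "Re (cinner (A x) x) \<ge> 0" for x
      using ge[of x] \<epsilon> by (meson mult_nonneg_nonneg less_imp_le order_trans zero_le_power2)
    show "Im (cinner (A x) x) = 0" for x
      by (simp add: A_def cinner_simps cinner_self positive_op_Im[OF P])
  qed
  have bound: "\<epsilon> * norm x \<le> norm (A x)" for x
  proof -
    have "(\<epsilon> * norm x) * norm x \<le> norm (A x) * norm x"
      using ge[of x] complex_Re_le_cmod[of "cinner (A x) x"] Cauchy_Schwarz[of "A x" x]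
      by (simp add: power2_eq_square)
    then show ?thesis by (cases "norm x = 0") (auto simp: mult_le_cancel_right)
  qed
  have "\<forall>z. \<exists>x. A x = z"
  proof
    fix z :: 'a
    have "bounded_linear (\<lambda>y. cinner y z)" by (rule bounded_linear_cinner_left)
    from Lax_Milgram[OF A \<epsilon> ge this] obtain x where "\<And>y. cinner y z = cinner y (A x)"
      by (auto simp: cinner_simps)
    then show "\<exists>x. A x = z" using cinner_ext' by metis
  qed
  then obtain G where G: "\<And>z. A (G z) = z" by metis
  have inj: "x = y" if "A x = A y" for x y
    using bound[of "x - y"] \<epsilon> that by (simp add: bounded_clinear_simps[OF Alin] mult_le_0_iff)
  show thesis
  proof (rule that)
    show "bounded_clinear G"
    proof (rule bounded_clinearI[where K="1/\<epsilon>"])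
      show "G (x + y) = G x + G y" for x y
        by (rule inj) (simp add: G bounded_clinear_simps[OF Alin])
      show "G (c *\<^sub>C x) = c *\<^sub>C G x" for c x
        by (rule inj) (simp add: G bounded_clinear_simps[OF Alin])
      show "norm (G x) \<le> 1/\<epsilon> * norm x" for x
        using bound[of "G x"] \<epsilon> by (simp add: G field_simps)
    qed
    show "P (G x) + \<epsilon> *\<^sub>R G x = x" for x using G[of x] by (simp add: A_def)
    show "G (P x) = x - \<epsilon> *\<^sub>R G x" for x
    proof (rule inj)
      have "A (x - \<epsilon> *\<^sub>R G x) = A x - \<epsilon> *\<^sub>R x" by (simp add: bounded_clinear_simps[OF Alin] G)
      then show "A (G (P x)) = A (x - \<epsilon> *\<^sub>R G x)" by (simp add: G) (simp add: A_def)
    qed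
    show "cinner (G x) y = cinner x (G y)" for x y
      using positive_op_self_adjoint[OF A, of "G x" "G y"] by (simp add: G)
  qed
qed

text \<open>An approximate polar decomposition with \<open>U = T (|T| + \<epsilon>)\<^sup>-\<^sup>1\<close>; the resolvent replaces the
  extension of a partial isometry from the range of \<open>|T|\<close>.\<close>

lemma approx_polar:
  fixes T :: "'a::complex_hilbert \<Rightarrow> 'a"
  assumes T: "bounded_clinear T" and \<epsilon>: "\<epsilon> > 0"
  obtains U where "contraction U" "\<And>x. norm (U (abs_op T x) - T x) \<le> \<epsilon> * norm x"
    "\<And>x. norm (adj_op U (T x) - abs_op T x) \<le> \<epsilon> * norm x"
proof -
  define P where "P = abs_op T"
  have P: "positive_op P" unfolding P_def by (rule positive_op_abs_op[OF T])
  note lin = positive_opD[OF P]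
  obtain G where G: "bounded_clinear G" "\<And>x. P (G x) + \<epsilon> *\<^sub>R G x = x" "\<And>x. G (P x) = x - \<epsilon> *\<^sub>R G x"
    "\<And>x y. cinner (G x) y = cinner x (G y)"
    using resolvent_exists[OF P \<epsilon>] by metis
  \<comment> \<open>Positivity of \<open>P\<close> makes every term in the expansion of
    \<open>|P G x + \<epsilon> G x|^2\<close> nonnegative. Since \<open>|T v| = |P v|\<close>, this
    also makes \<open>U\<close> a contraction.\<close>
  have PG: "norm (P (G x)) \<le> norm x" for x
  proof -
    have "(norm (P (G x)))\<^sup>2 \<le> (norm (P (G x) + \<epsilon> *\<^sub>R G x))\<^sup>2"
      unfolding norm_add_sq using positive_op_ge[OF P, of "G x"] \<epsilon> by (simp add: cinner_simps)
    then show ?thesis unfolding G(2) by (rule power2_le_imp_le) simp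
  qed
  define U where "U x = T (G x)" for x
  have Ulin: "bounded_clinear U" unfolding U_def by (rule bounded_clinear_compose[OF T G(1)])
  have U1: "norm (U x) \<le> norm x" for x
    using PG[of x] norm_abs_op[OF T, of "G x"] by (simp add: U_def P_def)
  show thesis
  proof (rule that)
    show "contraction U" using Ulin U1 by (simp add: contraction_def)
    have "U (P x) - T x = - \<epsilon> *\<^sub>R U x" for x
      by (simp add: U_def G(3) bounded_clinear_simps[OF T])
    then show "norm (U (abs_op T x) - T x) \<le> \<epsilon> * norm x" for x
      using \<epsilon> U1[of x] by (simp add: P_def)
    \<comment> \<open>\<open>adj_op U\<close> is \<open>adj_op T\<close> followed by
      \<open>G\<close>, and \<open>adj_op T (T x) = P (P x)\<close>. Both errors in the claim are
      thus \<open>- \<epsilon>\<close> times a contraction applied to \<open>x\<close>.\<close>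
    have "adj_op U (T x) = G (P (P x))" for x
    proof (rule cinner_ext)
      fix y
      show "cinner (adj_op U (T x)) y = cinner (G (P (P x))) y"
        by (simp add: cinner_adj'[OF Ulin] U_def cinner_adj'[OF T, symmetric] G(4))
           (simp add: P_def abs_op_abs_op[OF T])
    qed
    moreover have "G (P (P x)) = P x - \<epsilon> *\<^sub>R G (P x)" for x by (rule G(3))
    moreover have "G (P x) = P (G x)" for x
      using G(2)[of x] G(3)[of x] by (metis eq_diff_eq)
    ultimately have "adj_op U (T x) - P x = - \<epsilon> *\<^sub>R P (G x)" for x by simp
    then show "norm (adj_op U (T x) - abs_op T x) \<le> \<epsilon> * norm x" for x
      using \<epsilon> PG[of x] by (simp add: P_def)
  qed
qed

section \<open>Orthonormal bases\<close>

definition orthonormal :: "'a::complex_inner set \<Rightarrow> bool" where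
  "orthonormal E \<longleftrightarrow> (\<forall>e\<in>E. \<forall>f\<in>E. cinner e f = (if e = f then 1 else 0))"

lemma orthonormalD: "orthonormal E \<Longrightarrow> e \<in> E \<Longrightarrow> f \<in> E \<Longrightarrow> cinner e f = (if e = f then 1 else 0)"
  by (simp add: orthonormal_def)

lemma orthonormal_subset: "orthonormal E \<Longrightarrow> F \<subseteq> E \<Longrightarrow> orthonormal F"
  unfolding orthonormal_def by blast

lemma orthonormal_norm: "orthonormal E \<Longrightarrow> e \<in> E \<Longrightarrow> norm e = 1"
  using orthonormalD[of E e e] by (simp add: norm_eq_sqrt_cinner)

lemma cinner_self_1: "norm e = 1 \<Longrightarrow> cinner e (e::'a::complex_inner) = 1"
  by (simp add: cinner_self)

lemma is_onb_iff: "is_onb E \<longleftrightarrow> orthonormal E \<and> closure (cspan E) = UNIV"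
  by (auto simp: is_onb_def orthonormal_def cinner_self_1 norm_eq_sqrt_cinner)

lemma is_onb_orthonormal: "is_onb E \<Longrightarrow> orthonormal E"
  by (simp add: is_onb_iff)

definition proj :: "'a::complex_inner set \<Rightarrow> 'a \<Rightarrow> 'a" where
  "proj F x = (\<Sum>e\<in>F. cinner x e *\<^sub>C e)"

lemma cinner_proj_left: "cinner (proj F x) y = (\<Sum>e\<in>F. cinner x e * cinner e y)"
  by (simp add: proj_def cinner_sum_left cinner_simps)

lemma proj_self_adjoint: "cinner (proj F x) y = cinner x (proj F y)"
proof -
  have "cnj (cinner y e) = cinner e y" for e by (metis cinner_commute)
  then show ?thesis
    by (simp add: proj_def cinner_sum_left cinner_sum_right cinner_simps mult.commute)
qed

lemma cinner_proj_basis: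
  assumes "orthonormal F" "finite F" "e \<in> F" shows "cinner (proj F x) e = cinner x e"
proof -
  have "cinner (proj F x) e = (\<Sum>f\<in>F. if f = e then cinner x f else 0)"
    unfolding cinner_proj_left using assms by (intro sum.cong) (auto simp: orthonormalD)
  then show ?thesis using assms by simp
qed

lemma cinner_mult_swap: "cinner x e * cinner e x = of_real ((cmod (cinner x (e::'a::complex_inner)))\<^sup>2)"
  by (metis cinner_commute complex_norm_square)

lemma Re_cinner_proj: "Re (cinner (proj F x) x) = (\<Sum>e\<in>F. (cmod (cinner x e))\<^sup>2)"
  unfolding cinner_proj_left cinner_mult_swap by simp

lemma norm_proj_sq:
  assumes "orthonormal F" "finite F"
  shows "(norm (proj F x))\<^sup>2 = (\<Sum>e\<in>F. (cmod (cinner x e))\<^sup>2)"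
proof -
  have "(norm (proj F x))\<^sup>2 = Re (cinner (proj F (proj F x)) x)"
    by (simp add: proj_self_adjoint[of F "proj F x"] cinner_self)
  also have "proj F (proj F x) = proj F x"
    using assms by (simp add: proj_def[of F "proj F x"] cinner_proj_basis) (simp add: proj_def)
  finally show ?thesis by (simp add: Re_cinner_proj)
qed

lemma norm_proj_compl_sq:
  assumes "orthonormal F" "finite F"
  shows "(norm (x - proj F x))\<^sup>2 = (norm x)\<^sup>2 - (\<Sum>e\<in>F. (cmod (cinner x e))\<^sup>2)"
  unfolding norm_diff_sq Re_cinner_commute[of x] Re_cinner_proj norm_proj_sq[OF assms] by simp

lemma Bessel:
  assumes "orthonormal F" "finite F"
  shows "(\<Sum>e\<in>F. (cmod (cinner x e))\<^sup>2) \<le> (norm x)\<^sup>2"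
  using norm_proj_compl_sq[OF assms, of x] zero_le_power2[of "norm (x - proj F x)"] by linarith

lemma contraction_proj:
  assumes "orthonormal F" "finite F" shows "contraction (proj F)"
proof -
  have n: "norm (proj F x) \<le> norm x" for x
    using Bessel[OF assms, of x] unfolding norm_proj_sq[OF assms, symmetric] by (rule power2_le_imp_le) simp
  moreover have "bounded_clinear (proj F)"
    by (rule bounded_clinearI[where K=1])
       (use n in \<open>auto simp: proj_def cinner_simps scaleC_add_left sum.distrib
         complex_vector.scale_sum_right scaleC_scaleC\<close>)
  ultimately show ?thesis by (simp add: contraction_def)
qed

lemma contraction_proj_compl:
  assumes "orthonormal F" "finite F" shows "contraction (\<lambda>x. x - proj F x)"
proof -
  have "norm (x - proj F x) \<le> norm x" for x
  proof (rule power2_le_imp_le)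
    have "0 \<le> (\<Sum>e\<in>F. (cmod (cinner x e))\<^sup>2)" by (simp add: sum_nonneg)
    then show "(norm (x - proj F x))\<^sup>2 \<le> (norm x)\<^sup>2" using norm_proj_compl_sq[OF assms, of x] by linarith
  qed simp
  then show ?thesis
    using contractionD(1)[OF contraction_proj[OF assms]]
    by (simp add: contraction_def bounded_clinear_minus bounded_clinear_id)
qed

section \<open>Parseval's identity and the existence of orthonormal bases\<close>

lemma has_sum_sum:
  fixes f :: "'i \<Rightarrow> 'b \<Rightarrow> 'a::topological_comm_monoid_add"
  assumes "finite I" "\<And>i. i \<in> I \<Longrightarrow> (f i has_sum s i) A"
  shows "((\<lambda>x. \<Sum>i\<in>I. f i x) has_sum (\<Sum>i\<in>I. s i)) A"
  using assms by (induction I) (auto intro!: has_sum_add)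

definition total :: "'a::complex_inner set \<Rightarrow> bool" where
  "total E \<longleftrightarrow> (\<forall>x. (\<forall>e\<in>E. cinner x e = 0) \<longrightarrow> x = 0)"

text \<open>The functional \<open>y \<mapsto> \<Sum>\<^sub>e \<langle>y,e\<rangle>\<langle>e,x\<rangle>\<close> is represented by a vector that has the same
  coefficients as \<open>x\<close>, which is \<open>x\<close> itself when \<open>E\<close> is total.\<close>

lemma Parseval_total:
  fixes E :: "'a::complex_hilbert set"
  assumes E: "orthonormal E" and tot: "total E"
  shows "((\<lambda>e. cinner y e * cinner e x) has_sum cinner y x) E"
proof -
  have sm: "(\<lambda>e. cinner y e * cinner e x) summable_on E" for y
  proof (rule abs_summable_summable, rule Infinite_Sum.abs_summable_on_comparison_test')
    have sq: "(\<lambda>e. (cmod (cinner z e))\<^sup>2) summable_on E" for z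
    proof (rule nonneg_bdd_above_summable_on)
      show "bdd_above (sum (\<lambda>e. (cmod (cinner z e))\<^sup>2) ` {F. F \<subseteq> E \<and> finite F})"
        using Bessel orthonormal_subset[OF E] by (intro bdd_aboveI[of _ "(norm z)\<^sup>2"]) auto
    qed simp
    show "(\<lambda>e. (cmod (cinner y e))\<^sup>2 + (cmod (cinner x e))\<^sup>2) summable_on E"
      by (intro summable_on_add sq)
    show "norm (cinner y e * cinner e x) \<le> (cmod (cinner y e))\<^sup>2 + (cmod (cinner x e))\<^sup>2" for e
    proof -
      have "norm (cinner y e * cinner e x) = cmod (cinner y e) * cmod (cinner x e)"
        by (simp add: norm_mult cmod_cinner_commute)
      moreover have "2 * cmod (cinner y e) * cmod (cinner x e) \<le> (cmod (cinner y e))\<^sup>2 + (cmod (cinner x e))\<^sup>2"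
        by (rule sum_squares_bound)
      moreover have "0 \<le> cmod (cinner y e) * cmod (cinner x e)" by simp
      ultimately show ?thesis by linarith
    qed
  qed
  define f where "f y = (\<Sum>\<^sub>\<infinity>e\<in>E. cinner y e * cinner e x)" for y
  have f: "((\<lambda>e. cinner y e * cinner e x) has_sum f y) E" for y
    unfolding f_def by (rule has_sum_infsum[OF sm])
  have scale: "f (c *\<^sub>C y) = c * f y" for c y
    using has_sum_cmult_right[OF f[of y], of c] f[of "c *\<^sub>C y"]
    by (simp add: cinner_simps mult.assoc has_sum_unique)
  have "bounded_linear f"
  proof (rule bounded_linear_intro[where K="norm x"])
    show "f (y + z) = f y + f z" for y z
      using has_sum_add[OF f[of y] f[of z]] f[of "y + z"]
      by (simp add: cinner_simps distrib_right has_sum_unique)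
    show "f (r *\<^sub>R y) = r *\<^sub>R f y" for r y
      by (simp add: scaleR_scaleC scale) (simp add: scaleR_conv_of_real)
    show "norm (f y) \<le> norm y * norm x" for y
    proof -
      have "((\<lambda>F. cmod (cinner (proj F y) x)) \<longlongrightarrow> norm (f y)) (finite_subsets_at_top E)"
        using f[of y] unfolding has_sum_def cinner_proj_left by (rule tendsto_norm)
      moreover have "\<forall>\<^sub>F F in finite_subsets_at_top E. cmod (cinner (proj F y) x) \<le> norm y * norm x"
      proof (rule eventually_finite_subsets_at_top_weakI)
        fix F assume "finite F" "F \<subseteq> E"
        then have "norm (proj F y) \<le> norm y"
          using contractionD(2)[OF contraction_proj] orthonormal_subset[OF E] by blast
        then show "cmod (cinner (proj F y) x) \<le> norm y * norm x"
          using Cauchy_Schwarz[of "proj F y" x] by (meson mult_right_mono norm_ge_zero order_trans)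
      qed
      ultimately show ?thesis by (rule tendsto_upperbound) simp
    qed
  qed
  then obtain w where w: "\<And>y. f y = cinner y w" using Riesz scale by metis
  have "cinner e w = cinner e x" if "e \<in> E" for e
  proof -
    have "((\<lambda>e'. cinner e e' * cinner e' x) has_sum cinner e x) E"
      by (rule has_sum_finite_neutralI[of "{e}"]) (use that E in \<open>auto simp: orthonormalD\<close>)
    then show ?thesis using f[of e] has_sum_unique unfolding w by blast
  qed
  then have "\<forall>e\<in>E. cinner (w - x) e = 0"
    by (metis cinner_commute cinner_diff_left complex_cnj_zero eq_iff_diff_eq_0)
  then have "w - x = 0" using tot unfolding total_def by blast
  then show ?thesis using f[of y] by (simp add: w)
qed

lemma total_of_dense_span:
  assumes "closure (cspan E) = UNIV" shows "total E"
  unfolding total_def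
proof (intro allI impI)
  fix x assume x: "\<forall>e\<in>E. cinner x e = 0"
  have "cinner x y = 0" if "y \<in> cspan E" for y
    using that by (induction rule: complex_vector.span_induct_alt) (auto simp: cinner_simps x)
  then have "cspan E \<subseteq> {y. cinner x y = 0}" by blast
  moreover have "closed {y. cinner x y = 0}"
    by (intro closed_Collect_eq continuous_intros)
  ultimately have "closure (cspan E) \<subseteq> {y. cinner x y = 0}" by (rule closure_minimal)
  then have "cinner x x = 0" using assms by auto
  then show "x = 0" by (simp add: cinner_self)
qed

lemma Parseval:
  fixes E :: "'a::complex_hilbert set"
  assumes "is_onb E"
  shows "((\<lambda>e. cinner y e * cinner e x) has_sum cinner y x) E"
  using Parseval_total total_of_dense_span assms is_onb_iff by blast

lemma Parseval_norm_total:
  fixes E :: "'a::complex_hilbert set"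
  assumes "orthonormal E" "total E"
  shows "((\<lambda>e. (cmod (cinner x e))\<^sup>2) has_sum (norm x)\<^sup>2) E"
  using Parseval_total[OF assms, of x x] unfolding cinner_mult_swap cinner_self has_sum_of_real_iff .

lemma Parseval_norm:
  fixes E :: "'a::complex_hilbert set"
  assumes "is_onb E"
  shows "((\<lambda>e. (cmod (cinner x e))\<^sup>2) has_sum (norm x)\<^sup>2) E"
  using Parseval_norm_total total_of_dense_span assms is_onb_iff by blast

text \<open>The squared distance from \<open>x\<close> to \<open>proj F x\<close> is the tail of the
  Parseval sum, so totality yields density of the span.\<close>

lemma is_onb_total:
  fixes E :: "'a::complex_hilbert set"
  assumes E: "orthonormal E" and tot: "total E"
  shows "is_onb E"
proof -
  have "x \<in> closure (cspan E)" for x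
    unfolding closure_approachable
  proof (intro allI impI)
    fix \<epsilon> :: real assume \<epsilon>: "\<epsilon> > 0"
    then obtain F where F: "finite F" "F \<subseteq> E"
      "dist (\<Sum>e\<in>F. (cmod (cinner x e))\<^sup>2) ((norm x)\<^sup>2) \<le> (\<epsilon>/2)\<^sup>2"
      using has_sum_finite_approximation[OF Parseval_norm_total[OF E tot, of x], of "(\<epsilon>/2)\<^sup>2"] by auto
    have "(norm (x - proj F x))\<^sup>2 \<le> (\<epsilon>/2)\<^sup>2"
      using F(3) unfolding norm_proj_compl_sq[OF orthonormal_subset[OF E F(2)] F(1)] dist_real_def by linarith
    then have "norm (x - proj F x) \<le> \<epsilon>/2" by (rule power2_le_imp_le) (use \<epsilon> in simp)
    moreover have "proj F x \<in> cspan E"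
      unfolding proj_def using F(2)
      by (intro complex_vector.span_sum complex_vector.span_scale complex_vector.span_base) auto
    ultimately show "\<exists>y\<in>cspan E. dist y x < \<epsilon>"
      using \<epsilon> by (intro bexI[of _ "proj F x"]) (auto simp: dist_norm norm_minus_commute)
  qed
  then show ?thesis using E by (auto simp: is_onb_iff)
qed

text \<open>Zorn's lemma: a nonzero vector orthogonal to a maximal orthonormal set could be
  normalised and added to it. This gives \<open>some_onb\<close> its meaning.\<close>

lemma onb_exists: "\<exists>E :: 'a::complex_hilbert set. is_onb E"
proof -
  have "\<exists>M\<in>{E::'a set. orthonormal E}. \<forall>X\<in>{E. orthonormal E}. M \<subseteq> X \<longrightarrow> X = M"
  proof (rule subset_Zorn')
    fix C :: "'a set set" assume C: "subset.chain {E. orthonormal E} C"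
    have "cinner e f = (if e = f then 1 else 0)" if "X \<in> C" "Y \<in> C" "e \<in> X" "f \<in> Y" for X Y e f
    proof -
      have "X \<subseteq> Y \<or> Y \<subseteq> X" "orthonormal X" "orthonormal Y"
        using C that by (auto simp: subset_chain_def)
      then show ?thesis using that orthonormalD by (metis subsetD)
    qed
    then show "\<Union>C \<in> {E. orthonormal E}" unfolding orthonormal_def by blast
  qed
  then obtain M :: "'a set" where M: "orthonormal M" "\<And>X. orthonormal X \<Longrightarrow> M \<subseteq> X \<Longrightarrow> X = M" by auto
  have "total M" unfolding total_def
  proof (intro allI impI, rule ccontr)
    fix x assume x: "\<forall>e\<in>M. cinner x e = 0" "x \<noteq> 0"
    define u where "u = (1 / norm x) *\<^sub>R x"
    have u: "norm u = 1" using x(2) by (simp add: u_def)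
    have ue: "cinner u e = 0" "cinner e u = 0" if "e \<in> M" for e
      using x(1) that cinner_commute[of e x] by (auto simp: u_def cinner_simps)
    have uM: "u \<notin> M" using ue(1)[of u] u by (auto simp: cinner_self_1)
    have "orthonormal (insert u M)"
      using M(1) u ue uM by (auto simp: orthonormal_def cinner_self_1)
    then show False using M(2)[of "insert u M"] uM by blast
  qed
  then show ?thesis using is_onb_total[OF M(1)] by blast
qed

lemma is_onb_some_onb: "is_onb (some_onb :: 'a::complex_hilbert set)"
  unfolding some_onb_def by (rule someI_ex[OF onb_exists])

lemma Bessel_pairing:
  assumes "orthonormal G" "finite G"
  shows "(\<Sum>g\<in>G. Re (cinner g y * cinner x g)) \<le> norm x * norm (y::'a::complex_inner)"
proof -
  have "(\<Sum>g\<in>G. Re (cinner g y * cinner x g)) = Re (cinner (proj G x) y)"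
    by (simp add: cinner_proj_left mult.commute)
  also have "\<dots> \<le> norm (proj G x) * norm y"
    using complex_Re_le_cmod Cauchy_Schwarz order_trans by blast
  also have "\<dots> \<le> norm x * norm y"
    by (intro mult_right_mono contractionD(2)[OF contraction_proj] assms) simp
  finally show ?thesis .
qed


section \<open>The trace norm by duality\<close>

text \<open>A relation instead of a supremum, so that bounds can be handled before anything is known
  to be finite; \<open>trace_norm\<close> is later shown to be the least such \<open>C\<close>. Real
  parts suffice because \<open>W\<close> can absorb a phase.\<close>

definition trace_norm_le :: "('a::complex_inner \<Rightarrow> 'a) \<Rightarrow> real \<Rightarrow> bool" where
  "trace_norm_le T C \<longleftrightarrow> bounded_clinear T \<and>
     (\<forall>W G. contraction W \<longrightarrow> finite G \<longrightarrow> orthonormal G \<longrightarrow> (\<Sum>g\<in>G. Re (cinner (W (T g)) g)) \<le> C)"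

lemma trace_norm_leI:
  "bounded_clinear T \<Longrightarrow>
    (\<And>W G. contraction W \<Longrightarrow> finite G \<Longrightarrow> orthonormal G \<Longrightarrow> (\<Sum>g\<in>G. Re (cinner (W (T g)) g)) \<le> C) \<Longrightarrow>
    trace_norm_le T C"
  by (simp add: trace_norm_le_def)

lemma trace_norm_leD:
  "trace_norm_le T C \<Longrightarrow> contraction W \<Longrightarrow> finite G \<Longrightarrow> orthonormal G \<Longrightarrow> (\<Sum>g\<in>G. Re (cinner (W (T g)) g)) \<le> C"
  by (simp add: trace_norm_le_def)

lemma trace_norm_le_clinear: "trace_norm_le T C \<Longrightarrow> bounded_clinear T"
  by (simp add: trace_norm_le_def)

lemma trace_norm_le_mono: "trace_norm_le T C \<Longrightarrow> C \<le> D \<Longrightarrow> trace_norm_le T D"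
  unfolding trace_norm_le_def by (meson order_trans)

lemma trace_norm_le_nonneg: "trace_norm_le T C \<Longrightarrow> 0 \<le> C"
  using trace_norm_leD[of T C "\<lambda>x. x" "{}"] by (simp add: contraction_id orthonormal_def)

lemma trace_norm_le_add:
  assumes "trace_norm_le S C" "trace_norm_le T D"
  shows "trace_norm_le (\<lambda>x. S x + T x) (C + D)"
proof (rule trace_norm_leI)
  show "bounded_clinear (\<lambda>x. S x + T x)"
    using assms by (intro bounded_clinear_plus trace_norm_le_clinear)
  fix W :: "'a \<Rightarrow> 'a" and G :: "'a set" assume W: "contraction W" and G: "finite G" "orthonormal G"
  have "(\<Sum>g\<in>G. Re (cinner (W (S g + T g)) g)) = (\<Sum>g\<in>G. Re (cinner (W (S g)) g)) + (\<Sum>g\<in>G. Re (cinner (W (T g)) g))"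
    by (simp add: bounded_clinear_add[OF contractionD(1)[OF W]] cinner_simps sum.distrib)
  then show "(\<Sum>g\<in>G. Re (cinner (W (S g + T g)) g)) \<le> C + D"
    using assms[THEN trace_norm_leD, OF W G] by linarith
qed

lemma trace_norm_le_compose_left:
  assumes V: "contraction V" and T: "trace_norm_le T C"
  shows "trace_norm_le (\<lambda>x. V (T x)) C"
proof (rule trace_norm_leI)
  show "bounded_clinear (\<lambda>x. V (T x))"
    by (rule bounded_clinear_compose[OF contractionD(1)[OF V] trace_norm_le_clinear[OF T]])
  fix W :: "'a \<Rightarrow> 'a" and G :: "'a set" assume W: "contraction W" and G: "finite G" "orthonormal G"
  show "(\<Sum>g\<in>G. Re (cinner (W (V (T g))) g)) \<le> C"
    by (rule trace_norm_leD[OF T contraction_compose[OF W V] G])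
qed

text \<open>The phase \<open>c / cmod c\<close> is itself a contraction, which leaves only a
  positive factor; for \<open>c = 0\<close> there is no phase, hence the separate case.\<close>

lemma trace_norm_le_scaleC:
  assumes T: "trace_norm_le T C"
  shows "trace_norm_le (\<lambda>x. c *\<^sub>C T x) (cmod c * C)"
proof (cases "c = 0")
  case True
  then show ?thesis by (simp add: trace_norm_le_def bounded_clinear_null bounded_clinear_zero contractionD(1))
next
  case False
  have "contraction (\<lambda>x. (c / cmod c) *\<^sub>C x)" using False
    by (simp add: contraction_def bounded_clinear_cscale bounded_clinear_id norm_scaleC norm_divide)
  from trace_norm_le_compose_left[OF this T]
  have *: "trace_norm_le (\<lambda>x. (c / cmod c) *\<^sub>C T x) C" .
  show ?thesis
  proof (rule trace_norm_leI)
    show "bounded_clinear (\<lambda>x. c *\<^sub>C T x)" by (rule bounded_clinear_cscale[OF trace_norm_le_clinear[OF T]])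
    fix W :: "'a \<Rightarrow> 'a" and G :: "'a set" assume W: "contraction W" and G: "finite G" "orthonormal G"
    have "(\<Sum>g\<in>G. Re (cinner (W (c *\<^sub>C T g)) g)) = cmod c * (\<Sum>g\<in>G. Re (cinner (W ((c / cmod c) *\<^sub>C T g)) g))"
    proof -
      have "c *\<^sub>C T g = cmod c *\<^sub>R ((c / cmod c) *\<^sub>C T g)" for g
        using False by (simp add: scaleR_scaleC scaleC_scaleC)
      then have "W (c *\<^sub>C T g) = cmod c *\<^sub>R W ((c / cmod c) *\<^sub>C T g)" for g
        using bounded_clinear_scaleR[OF contractionD(1)[OF W]] by metis
      then show ?thesis by (simp add: cinner_scaleR_left sum_distrib_left)
    qed
    then show "(\<Sum>g\<in>G. Re (cinner (W (c *\<^sub>C T g)) g)) \<le> cmod c * C"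
      using trace_norm_leD[OF * W G] by (simp add: mult_left_mono)
  qed
qed

lemma trace_norm_le_uminus: "trace_norm_le T C \<Longrightarrow> trace_norm_le (\<lambda>x. - T x) C"
  using trace_norm_le_scaleC[of T C "-1"] by simp

lemma trace_norm_le_diff:
  "trace_norm_le S C \<Longrightarrow> trace_norm_le T D \<Longrightarrow> trace_norm_le (\<lambda>x. S x - T x) (C + D)"
  using trace_norm_le_add[OF _ trace_norm_le_uminus] by simp

lemma trace_norm_le_0: "trace_norm_le (\<lambda>x. 0) 0"
  by (rule trace_norm_leI) (auto simp: bounded_clinear_null bounded_clinear_zero contractionD(1))

lemma trace_norm_le_sum:
  "(\<And>i. i \<in> I \<Longrightarrow> trace_norm_le (T i) (C i)) \<Longrightarrow> trace_norm_le (\<lambda>x. \<Sum>i\<in>I. T i x) (\<Sum>i\<in>I. C i)"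
  by (induction I rule: infinite_finite_induct) (auto intro!: trace_norm_le_add trace_norm_le_0)

text \<open>A test pair \<open>W\<close>, \<open>G\<close> sees only finitely many vectors, so
  strong convergence is enough. The filter is general because limits are taken both along sequences
  and along finite subsets of a basis.\<close>

lemma trace_norm_le_limit:
  assumes T: "bounded_clinear T" and F: "F \<noteq> bot"
    and lim: "\<And>x. ((\<lambda>i. S i x) \<longlongrightarrow> T x) F" and le: "\<forall>\<^sub>F i in F. trace_norm_le (S i) C"
  shows "trace_norm_le T C"
proof (rule trace_norm_leI[OF T])
  fix W :: "'a \<Rightarrow> 'a" and G :: "'a set" assume W: "contraction W" and G: "finite G" "orthonormal G"
  have "((\<lambda>i. \<Sum>g\<in>G. Re (cinner (W (S i g)) g)) \<longlongrightarrow> (\<Sum>g\<in>G. Re (cinner (W (T g)) g))) F"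
    by (intro tendsto_intros lim
        bounded_linear.tendsto[OF bounded_clinear_linear[OF contractionD(1)[OF W]]])
  moreover have "\<forall>\<^sub>F i in F. (\<Sum>g\<in>G. Re (cinner (W (S i g)) g)) \<le> C"
    using le by eventually_elim (rule trace_norm_leD[OF _ W G])
  ultimately show "(\<Sum>g\<in>G. Re (cinner (W (T g)) g)) \<le> C" using F by (rule tendsto_upperbound)
qed

lemma rank_one_bounded: "bounded_clinear (rank_one x y)"
proof (rule bounded_clinearI[where K="norm y * norm x"])
  show "norm (rank_one x y z) \<le> norm y * norm x * norm z" for z
    using mult_right_mono[OF Cauchy_Schwarz[of z y], of "norm x"]
    by (simp add: rank_one_def norm_scaleC mult_ac)
qed (simp_all add: rank_one_def cinner_simps scaleC_add_left scaleC_scaleC)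

lemma trace_norm_le_rank_one: "trace_norm_le (rank_one x y) (norm x * norm y)"
proof (rule trace_norm_leI[OF rank_one_bounded])
  fix W :: "'a \<Rightarrow> 'a" and G :: "'a set" assume W: "contraction W" and G: "finite G" "orthonormal G"
  have "(\<Sum>g\<in>G. Re (cinner (W (rank_one x y g)) g)) = (\<Sum>g\<in>G. Re (cinner g y * cinner (W x) g))"
    by (simp add: rank_one_def bounded_clinear_scaleC[OF contractionD(1)[OF W]] cinner_simps)
  also have "\<dots> \<le> norm (W x) * norm y" by (rule Bessel_pairing[OF G(2,1)])
  also have "\<dots> \<le> norm x * norm y" by (intro mult_right_mono contractionD(2)[OF W]) simp
  finally show "(\<Sum>g\<in>G. Re (cinner (W (rank_one x y g)) g)) \<le> norm x * norm y" .
qed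

text \<open>Moduli of matrix entries survive passage to the adjoint:
  \<open>|<S B g, e>| = |<B' S e, g>|\<close>. Parseval in \<open>E\<close> on one side and Bessel
  for \<open>G\<close> on the other carry the bound from the basis to a finite orthonormal
  set.\<close>

lemma Hilbert_Schmidt_swap:
  fixes E :: "'a::complex_hilbert set"
  assumes E: "is_onb E" and G: "finite G" "orthonormal G"
    and S: "\<And>x y. cinner (S x) y = cinner x (S y)"
    and B: "\<And>x y. cinner (B x) y = cinner x (B' y)"
    and le: "\<And>F. finite F \<Longrightarrow> F \<subseteq> E \<Longrightarrow> (\<Sum>e\<in>F. (norm (B' (S e)))\<^sup>2) \<le> c"
  shows "(\<Sum>g\<in>G. (norm (S (B g)))\<^sup>2) \<le> c"
proof (rule has_sum_le_finite_sums)
  show "((\<lambda>e. \<Sum>g\<in>G. (cmod (cinner (S (B g)) e))\<^sup>2) has_sum (\<Sum>g\<in>G. (norm (S (B g)))\<^sup>2)) E"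
    by (intro has_sum_sum G Parseval_norm E)
  fix F assume F: "finite F" "F \<subseteq> E"
  have "(\<Sum>e\<in>F. \<Sum>g\<in>G. (cmod (cinner (S (B g)) e))\<^sup>2) = (\<Sum>e\<in>F. \<Sum>g\<in>G. (cmod (cinner (B' (S e)) g))\<^sup>2)"
    by (simp add: S B cmod_cinner_commute)
  also have "\<dots> \<le> (\<Sum>e\<in>F. (norm (B' (S e)))\<^sup>2)" by (intro sum_mono Bessel G)
  also have "\<dots> \<le> c" by (rule le[OF F])
  finally show "(\<Sum>e\<in>F. \<Sum>g\<in>G. (cmod (cinner (S (B g)) e))\<^sup>2) \<le> c" .
qed

text \<open>The product is cut between the two \<open>S\<close>, and Cauchy-Schwarz over
  \<open>G\<close> is applied to the factors \<open>S A\<close> and \<open>B S\<close>; the test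
  contraction is absorbed into the second. The first hypothesis concerns \<open>A' S\<close> because
  the swap replaces \<open>S A\<close> by its adjoint.\<close>

lemma trace_norm_le_Hilbert_Schmidt:
  fixes E :: "'a::complex_hilbert set" and A B S :: "'a \<Rightarrow> 'a"
  assumes E: "is_onb E" and S: "positive_op S" and A: "bounded_clinear A" and B: "bounded_clinear B"
    and A': "\<And>x y. cinner (A x) y = cinner x (A' y)"
    and a: "\<And>F. finite F \<Longrightarrow> F \<subseteq> E \<Longrightarrow> (\<Sum>e\<in>F. (norm (A' (S e)))\<^sup>2) \<le> a"
    and b: "\<And>F. finite F \<Longrightarrow> F \<subseteq> E \<Longrightarrow> (\<Sum>e\<in>F. (norm (B (S e)))\<^sup>2) \<le> b"
  shows "trace_norm_le (\<lambda>x. B (S (S (A x)))) (sqrt a * sqrt b)"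
proof (rule trace_norm_leI)
  note Sl = positive_opD[OF S] and sa = positive_op_self_adjoint[OF S]
  show "bounded_clinear (\<lambda>x. B (S (S (A x))))"
    by (rule bounded_clinear_compose[OF B bounded_clinear_compose[OF Sl bounded_clinear_compose[OF Sl A]]])
  fix W :: "'a \<Rightarrow> 'a" and G :: "'a set" assume W: "contraction W" and G: "finite G" "orthonormal G"
  define V where "V x = W (B x)" for x
  have V: "bounded_clinear V" unfolding V_def by (rule bounded_clinear_compose[OF contractionD(1)[OF W] B])
  have sa_a: "(\<Sum>g\<in>G. (norm (S (A g)))\<^sup>2) \<le> a"
    by (rule Hilbert_Schmidt_swap[OF E G sa A' a])
  have sa_b: "(\<Sum>g\<in>G. (norm (S (adj_op V g)))\<^sup>2) \<le> b"
  proof (rule Hilbert_Schmidt_swap[OF E G sa cinner_adj'[OF V]])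
    fix F assume F: "finite F" "F \<subseteq> E"
    have "(\<Sum>e\<in>F. (norm (V (S e)))\<^sup>2) \<le> (\<Sum>e\<in>F. (norm (B (S e)))\<^sup>2)"
      unfolding V_def by (intro sum_mono power_mono contractionD(2)[OF W]) simp
    then show "(\<Sum>e\<in>F. (norm (V (S e)))\<^sup>2) \<le> b" using b[OF F] by linarith
  qed
  have "(\<Sum>g\<in>G. Re (cinner (W (B (S (S (A g))))) g)) \<le> (\<Sum>g\<in>G. norm (S (A g)) * norm (S (adj_op V g)))"
  proof (intro sum_mono)
    fix g
    have "cinner (W (B (S (S (A g))))) g = cinner (S (A g)) (S (adj_op V g))"
      using cinner_adj[OF V, of "S (S (A g))" g] by (simp add: V_def sa)
    then show "Re (cinner (W (B (S (S (A g))))) g) \<le> norm (S (A g)) * norm (S (adj_op V g))"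
      using complex_Re_le_cmod Cauchy_Schwarz order_trans by metis
  qed
  also have "\<dots> \<le> L2_set (\<lambda>g. norm (S (A g))) G * L2_set (\<lambda>g. norm (S (adj_op V g))) G"
    using L2_set_mult_ineq[of "\<lambda>g. norm (S (A g))" "\<lambda>g. norm (S (adj_op V g))" G] by simp
  also have "\<dots> \<le> sqrt a * sqrt b"
    unfolding L2_set_def using sa_a sa_b a[of "{}"]
    by (intro mult_mono real_sqrt_le_mono) (auto intro!: sum_nonneg)
  finally show "(\<Sum>g\<in>G. Re (cinner (W (B (S (S (A g))))) g)) \<le> sqrt a * sqrt b" .
qed

lemma norm_sqrt_op:
  "positive_op S \<Longrightarrow> (norm (S x))\<^sup>2 = Re (cinner (S (S x)) x)"
  by (simp add: positive_op_self_adjoint[of S "S x" x] cinner_self)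

text \<open>\<open>T\<close> is the strong limit of \<open>U |T| = U S S\<close> with the
  contractions \<open>U\<close> of approximate polar decompositions. The Hilbert-Schmidt bound does
  not depend on \<open>U\<close> and so survives the limit. The slot \<open>A\<close> is where a
  truncation can enter.\<close>

lemma trace_norm_le_compose_right:
  fixes T :: "'a::complex_hilbert \<Rightarrow> 'a"
  assumes E: "is_onb E" and T: "bounded_clinear T"
    and S: "positive_op S" "\<And>x. S (S x) = abs_op T x"
    and t: "\<And>F. finite F \<Longrightarrow> F \<subseteq> E \<Longrightarrow> (\<Sum>e\<in>F. Re (cinner (abs_op T e) e)) \<le> t"
    and A: "bounded_clinear A" "\<And>x y. cinner (A x) y = cinner x (A' y)"
    and a: "\<And>F. finite F \<Longrightarrow> F \<subseteq> E \<Longrightarrow> (\<Sum>e\<in>F. (norm (A' (S e)))\<^sup>2) \<le> a"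
  shows "trace_norm_le (\<lambda>x. T (A x)) (sqrt a * sqrt t)"
proof -
  have "\<exists>U. contraction U \<and> (\<forall>x. norm (U (abs_op T x) - T x) \<le> inverse (real (Suc n)) * norm x)" for n
    by (rule approx_polar[OF T, of "inverse (real (Suc n))"]) auto
  then obtain U where U: "\<And>n. contraction (U n)"
    "\<And>n x. norm (U n (abs_op T x) - T x) \<le> inverse (real (Suc n)) * norm x"
    by metis
  show ?thesis
  proof (rule trace_norm_le_limit[where S="\<lambda>n x. U n (S (S (A x)))" and F=sequentially])
    show "bounded_clinear (\<lambda>x. T (A x))" by (rule bounded_clinear_compose[OF T A(1)])
    show "(\<lambda>n. U n (S (S (A x)))) \<longlonglongrightarrow> T (A x)" for x
    proof (rule LIM_zero_cancel, rule Lim_null_comparison)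
      show "\<forall>\<^sub>F n in sequentially. norm (U n (S (S (A x))) - T (A x)) \<le> inverse (real (Suc n)) * norm (A x)"
        using U(2)[of _ "A x"] by (simp add: S(2))
      show "(\<lambda>n. inverse (real (Suc n)) * norm (A x)) \<longlonglongrightarrow> 0"
        by (rule tendsto_mult_left_zero[OF LIMSEQ_inverse_real_of_nat])
    qed
    have "trace_norm_le (\<lambda>x. U n (S (S (A x)))) (sqrt a * sqrt t)" for n
    proof (rule trace_norm_le_Hilbert_Schmidt[OF E S(1) A(1) contractionD(1)[OF U(1)] A(2) a])
      fix F assume F: "finite F" "F \<subseteq> E"
      have "(\<Sum>e\<in>F. (norm (U n (S e)))\<^sup>2) \<le> (\<Sum>e\<in>F. Re (cinner (abs_op T e) e))"
        unfolding norm_sqrt_op[OF S(1), unfolded S(2), symmetric]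
        by (intro sum_mono power_mono contractionD(2)[OF U(1)]) simp
      then show "(\<Sum>e\<in>F. (norm (U n (S e)))\<^sup>2) \<le> t" using t[OF F] by linarith
    qed
    then show "\<forall>\<^sub>F n in sequentially. trace_norm_le (\<lambda>x. U n (S (S (A x)))) (sqrt a * sqrt t)" by simp
  qed simp
qed

text \<open>One half of the duality: with the identity for \<open>A\<close>, both Hilbert-Schmidt
  factors are at most \<open>sqrt t\<close>.\<close>

lemma trace_norm_leI_abs_op:
  fixes T :: "'a::complex_hilbert \<Rightarrow> 'a"
  assumes E: "is_onb E" and T: "bounded_clinear T"
    and t: "\<And>F. finite F \<Longrightarrow> F \<subseteq> E \<Longrightarrow> (\<Sum>e\<in>F. Re (cinner (abs_op T e) e)) \<le> t"
  shows "trace_norm_le T t"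
proof -
  obtain S where S: "positive_op S" "\<And>x. S (S x) = abs_op T x"
    using sqrt_op_exists[OF positive_op_abs_op[OF T]] by metis
  have "trace_norm_le (\<lambda>x. T x) (sqrt t * sqrt t)"
    by (rule trace_norm_le_compose_right[OF E T S t bounded_clinear_id refl])
       (use t in \<open>simp_all add: norm_sqrt_op[OF S(1), unfolded S(2)]\<close>)
  then show ?thesis using t[of "{}"] by simp
qed

text \<open>The other half of the duality: the contraction \<open>adj_op U\<close> of an approximate
  polar decomposition recovers \<open>|T|\<close> from \<open>T\<close> up to an arbitrarily small
  error.\<close>

lemma sum_abs_op_le:
  fixes T :: "'a::complex_hilbert \<Rightarrow> 'a"
  assumes T: "trace_norm_le T C" and G: "finite G" "orthonormal G"
  shows "(\<Sum>g\<in>G. Re (cinner (abs_op T g) g)) \<le> C"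
proof (rule field_le_epsilon)
  fix \<epsilon> :: real assume \<epsilon>: "\<epsilon> > 0"
  \<comment> \<open>The error is shared among the elements of \<open>G\<close>; the added
    \<open>1\<close> covers the empty set.\<close>
  define d where "d = \<epsilon> / (card G + 1)"
  have d: "d > 0" "d * card G \<le> \<epsilon>" using \<epsilon> by (auto simp: d_def field_simps)
  obtain U where U: "contraction U" "\<And>x. norm (adj_op U (T x) - abs_op T x) \<le> d * norm x"
    using approx_polar[OF trace_norm_le_clinear[OF T] d(1)] by metis
  have "Re (cinner (abs_op T g) g) \<le> Re (cinner (adj_op U (T g)) g) + d" if "g \<in> G" for g
  proof -
    have g: "norm g = 1" using orthonormal_norm G that by blast
    have "Re (cinner (abs_op T g - adj_op U (T g)) g) \<le> norm (abs_op T g - adj_op U (T g)) * norm g"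
      using complex_Re_le_cmod Cauchy_Schwarz order_trans by blast
    then show ?thesis using U(2)[of g] by (simp add: g cinner_simps norm_minus_commute)
  qed
  then have "(\<Sum>g\<in>G. Re (cinner (abs_op T g) g)) \<le> (\<Sum>g\<in>G. Re (cinner (adj_op U (T g)) g) + d)"
    by (rule sum_mono)
  also have "\<dots> = (\<Sum>g\<in>G. Re (cinner (adj_op U (T g)) g)) + d * card G"
    by (simp add: sum.distrib mult.commute)
  also have "\<dots> \<le> C + \<epsilon>"
    using trace_norm_leD[OF T contraction_adj[OF U(1)] G] d(2) by linarith
  finally show "(\<Sum>g\<in>G. Re (cinner (abs_op T g) g)) \<le> C + \<epsilon>" .
qed

lemma cinner_abs_op_of_real:
  fixes T :: "'a::complex_hilbert \<Rightarrow> 'a"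
  assumes "bounded_clinear T"
  shows "cinner (abs_op T e) e = of_real (Re (cinner (abs_op T e) e))"
  by (rule positive_op_of_real[OF positive_op_abs_op[OF assms]])

text \<open>The sum over one basis is again a dual bound, and dual bounds do not mention a basis.
  This makes sums over two bases comparable.\<close>

lemma sum_abs_op_has_sum:
  fixes T :: "'a::complex_hilbert \<Rightarrow> 'a"
  assumes T: "trace_norm_le T C" and E: "is_onb E"
  obtains t where "((\<lambda>e. Re (cinner (abs_op T e) e)) has_sum t) E" "t \<le> C" "trace_norm_le T t"
proof -
  note Tl = trace_norm_le_clinear[OF T]
  note nonneg = positive_op_ge[OF positive_op_abs_op[OF Tl]]
  have le: "(\<Sum>e\<in>F. Re (cinner (abs_op T e) e)) \<le> C" if "finite F" "F \<subseteq> E" for F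
    by (rule sum_abs_op_le[OF T that(1) orthonormal_subset[OF is_onb_orthonormal[OF E] that(2)]])
  have "(\<lambda>e. Re (cinner (abs_op T e) e)) summable_on E"
    by (rule nonneg_bdd_above_summable_on) (use le nonneg in \<open>auto intro!: bdd_aboveI[of _ C]\<close>)
  then obtain t where t: "((\<lambda>e. Re (cinner (abs_op T e) e)) has_sum t) E" by (auto simp: summable_on_def)
  show thesis
  proof (rule that[OF t])
    show "t \<le> C" by (rule has_sum_le_finite_sums[OF t le])
    show "trace_norm_le T t"
      by (rule trace_norm_leI_abs_op[OF E Tl]) (auto intro!: finite_sum_le_has_sum[OF t] nonneg)
  qed
qed

section \<open>The trace norm as the least dual bound\<close>

lemma trace_class_iff:
  fixes T :: "'a::complex_hilbert \<Rightarrow> 'a"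
  shows "trace_class T \<longleftrightarrow> (\<exists>C. trace_norm_le T C)"
proof
  assume "trace_class T"
  then obtain E where T: "bounded_clinear T" and E: "is_onb E"
    and sm: "(\<lambda>e. cinner (abs_op T e) e) summable_on E" by (auto simp: trace_class_def)
  have "(\<lambda>e. Re (cinner (abs_op T e) e)) summable_on E" by (rule summable_on_Re[OF sm])
  then obtain t where t: "((\<lambda>e. Re (cinner (abs_op T e) e)) has_sum t) E" by (auto simp: summable_on_def)
  have "trace_norm_le T t"
    by (rule trace_norm_leI_abs_op[OF E T])
       (auto intro!: finite_sum_le_has_sum[OF t] positive_op_ge[OF positive_op_abs_op[OF T]])
  then show "\<exists>C. trace_norm_le T C" ..
next
  assume "\<exists>C. trace_norm_le T C"
  then obtain C where C: "trace_norm_le T C" ..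
  obtain E :: "'a set" where E: "is_onb E" using onb_exists by blast
  obtain t where t: "((\<lambda>e. Re (cinner (abs_op T e) e)) has_sum t) E"
    using sum_abs_op_has_sum[OF C E] by metis
  have "((\<lambda>e. cinner (abs_op T e) e) has_sum of_real t) E"
    using has_sum_of_real[OF t, where 'a=complex] by (simp flip: cinner_abs_op_of_real[OF trace_norm_le_clinear[OF C]])
  then show "trace_class T"
    using E trace_norm_le_clinear[OF C] by (auto simp: trace_class_def summable_on_def)
qed

lemma trace_class_clinear: "trace_class T \<Longrightarrow> bounded_clinear T"
  by (simp add: trace_class_def)

text \<open>The sums over \<open>E\<close> and over \<open>some_onb\<close> are both dual bounds, so
  each is at most the other; this is independence of the basis.\<close>

lemma trace_norm_has_sum:
  fixes T :: "'a::complex_hilbert \<Rightarrow> 'a"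
  assumes T: "trace_class T" and E: "is_onb E"
  shows "((\<lambda>e. Re (cinner (abs_op T e) e)) has_sum trace_norm T) E"
proof -
  obtain C where C: "trace_norm_le T C" using T trace_class_iff by blast
  obtain t where t: "((\<lambda>e. Re (cinner (abs_op T e) e)) has_sum t) E" "t \<le> C" "trace_norm_le T t"
    by (rule sum_abs_op_has_sum[OF C E])
  obtain s where s: "((\<lambda>e. Re (cinner (abs_op T e) e)) has_sum s) some_onb" "trace_norm_le T s"
    using sum_abs_op_has_sum[OF C is_onb_some_onb] by metis
  have "t \<le> s" using sum_abs_op_has_sum[OF s(2) E] t(1) has_sum_unique by metis
  moreover have "s \<le> t" using sum_abs_op_has_sum[OF t(3) is_onb_some_onb] s(1) has_sum_unique by metis
  moreover have "trace_norm T = s"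
  proof -
    have "((\<lambda>e. cinner (abs_op T e) e) has_sum of_real s) some_onb"
      using has_sum_of_real[OF s(1), where 'a=complex] by (simp flip: cinner_abs_op_of_real[OF trace_norm_le_clinear[OF C]])
    then show ?thesis unfolding trace_norm_def op_trace_def by (simp add: infsumI)
  qed
  ultimately show ?thesis using t(1) by simp
qed

lemma trace_norm_least:
  fixes T :: "'a::complex_hilbert \<Rightarrow> 'a"
  assumes T: "trace_norm_le T C" shows "trace_norm T \<le> C"
  using sum_abs_op_has_sum[OF T is_onb_some_onb] trace_norm_has_sum[OF _ is_onb_some_onb]
    trace_class_iff T has_sum_unique by metis

lemma trace_norm_le_trace_norm:
  fixes T :: "'a::complex_hilbert \<Rightarrow> 'a"
  assumes T: "trace_class T" shows "trace_norm_le T (trace_norm T)"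
  using sum_abs_op_has_sum[OF _ is_onb_some_onb] trace_norm_has_sum[OF T is_onb_some_onb]
    trace_class_iff T has_sum_unique by metis

lemma trace_class_of_le: "trace_norm_le T C \<Longrightarrow> trace_class (T :: 'a::complex_hilbert \<Rightarrow> 'a)"
  using trace_class_iff by blast

lemma trace_norm_nonneg: "trace_class T \<Longrightarrow> 0 \<le> trace_norm (T :: 'a::complex_hilbert \<Rightarrow> 'a)"
  using trace_norm_le_trace_norm trace_norm_le_nonneg by blast

lemma trace_norm_has_sum_positive:
  fixes A :: "'a::complex_hilbert \<Rightarrow> 'a"
  assumes "trace_class A" "positive_op A" "is_onb E"
  shows "((\<lambda>e. Re (cinner (A e) e)) has_sum trace_norm A) E"
  using trace_norm_has_sum[OF assms(1,3)] by (simp add: abs_op_positive[OF assms(2)])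

lemma op_trace_positive:
  fixes A :: "'a::complex_hilbert \<Rightarrow> 'a"
  assumes "trace_class A" "positive_op A"
  shows "op_trace A = of_real (trace_norm A)"
proof -
  have "((\<lambda>e. cinner (A e) e) has_sum of_real (trace_norm A)) some_onb"
    using has_sum_of_real[OF trace_norm_has_sum_positive[OF assms is_onb_some_onb], where 'a=complex]
    by (simp flip: positive_op_of_real[OF assms(2)])
  then show ?thesis unfolding op_trace_def by (rule infsumI)
qed

text \<open>\<open>S\<close> is self-adjoint, so by Parseval the total of
  \<open>|proj F (S e)|^2\<close> over \<open>E\<close> equals that of \<open>|S f|^2\<close> over
  \<open>F\<close>. Subtracting it from \<open>t\<close> leaves the tail.\<close>

lemma Hilbert_Schmidt_compl:
  fixes E :: "'a::complex_hilbert set"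
  assumes E: "is_onb E" and S: "positive_op S"
    and t: "((\<lambda>e. (norm (S e))\<^sup>2) has_sum t) E" and F: "finite F" "F \<subseteq> E" and K: "finite K" "K \<subseteq> E"
  shows "(\<Sum>e\<in>K. (norm (S e - proj F (S e)))\<^sup>2) \<le> t - (\<Sum>e\<in>F. (norm (S e))\<^sup>2)"
proof (rule finite_sum_le_has_sum[OF _ K])
  have oF: "orthonormal F" using orthonormal_subset[OF is_onb_orthonormal[OF E] F(2)] .
  have "((\<lambda>e. \<Sum>f\<in>F. (cmod (cinner (S e) f))\<^sup>2) has_sum (\<Sum>f\<in>F. (norm (S f))\<^sup>2)) E"
  proof (rule has_sum_sum[OF F(1)])
    show "((\<lambda>e. (cmod (cinner (S e) f))\<^sup>2) has_sum (norm (S f))\<^sup>2) E" for f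
      using Parseval_norm[OF E, of "S f"]
      by (simp add: positive_op_self_adjoint[OF S] cmod_cinner_commute[of _ "S f"])
  qed
  from has_sum_add[OF t has_sum_uminusI[OF this]]
  show "((\<lambda>e. (norm (S e - proj F (S e)))\<^sup>2) has_sum (t - (\<Sum>e\<in>F. (norm (S e))\<^sup>2))) E"
    by (simp add: norm_proj_compl_sq[OF oF F(1)])
qed simp

text \<open>Finite rank approximation, used to extend identities from rank one operators to the
  trace class. The truncation makes one of the two Hilbert-Schmidt factors of \<open>T\<close>
  small.\<close>

lemma trace_class_proj_approx:
  fixes T :: "'a::complex_hilbert \<Rightarrow> 'a"
  assumes T: "trace_class T" and E: "is_onb E" and \<epsilon>: "\<epsilon> > 0"
  obtains F where "finite F" "F \<subseteq> E" "trace_norm_le (\<lambda>x. T (x - proj F x)) \<epsilon>"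
proof -
  note Tl = trace_class_clinear[OF T]
  note nonneg = positive_op_ge[OF positive_op_abs_op[OF Tl]]
  obtain S where S: "positive_op S" "\<And>x. S (S x) = abs_op T x"
    using sqrt_op_exists[OF positive_op_abs_op[OF Tl]] by metis
  define t where "t = trace_norm T"
  have t0: "t \<ge> 0" unfolding t_def by (rule trace_norm_nonneg[OF T])
  have ht: "((\<lambda>e. Re (cinner (abs_op T e) e)) has_sum t) E" unfolding t_def by (rule trace_norm_has_sum[OF T E])
  then have hS: "((\<lambda>e. (norm (S e))\<^sup>2) has_sum t) E" by (simp add: norm_sqrt_op[OF S(1), unfolded S(2)])
  \<comment> \<open>Chosen so that \<open>d * t\<close> is at most the square of \<epsilon>; the
    \<open>1\<close> covers \<open>t = 0\<close>.\<close>
  define d where "d = \<epsilon>\<^sup>2 / (t + 1)"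
  have d: "d > 0" using \<epsilon> t0 by (simp add: d_def)
  obtain F where F: "finite F" "F \<subseteq> E" "dist (\<Sum>e\<in>F. (norm (S e))\<^sup>2) t \<le> d"
    using has_sum_finite_approximation[OF hS d] by blast
  have oF: "orthonormal F" using orthonormal_subset[OF is_onb_orthonormal[OF E] F(2)] .
  note Q = contraction_proj_compl[OF oF F(1)]
  have "trace_norm_le (\<lambda>x. T (x - proj F x)) (sqrt d * sqrt t)"
  proof (rule trace_norm_le_compose_right[OF E Tl S _ contractionD(1)[OF Q]])
    show "(\<Sum>e\<in>K. Re (cinner (abs_op T e) e)) \<le> t" if "finite K" "K \<subseteq> E" for K
      by (rule finite_sum_le_has_sum[OF ht that]) (rule nonneg)
    show "cinner (x - proj F x) y = cinner x (y - proj F y)" for x y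
      by (simp add: cinner_simps proj_self_adjoint)
    show "(\<Sum>e\<in>K. (norm (S e - proj F (S e)))\<^sup>2) \<le> d" if "finite K" "K \<subseteq> E" for K
      using Hilbert_Schmidt_compl[OF E S(1) hS F(1,2) that] F(3) by (simp add: dist_real_def)
  qed
  moreover have "sqrt d * sqrt t \<le> \<epsilon>"
  proof -
    have "d * t \<le> \<epsilon>\<^sup>2" using t0 by (simp add: d_def field_simps)
    then show ?thesis using \<epsilon> by (simp add: real_le_lsqrt flip: real_sqrt_mult)
  qed
  ultimately have "trace_norm_le (\<lambda>x. T (x - proj F x)) \<epsilon>" by (rule trace_norm_le_mono)
  then show thesis by (rule that[OF F(1,2)])
qed

text \<open>With \<open>P = proj F\<close>, \<open>Q = 1 - P\<close> and \<open>A = S S\<close>, the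
  difference is \<open>A Q + Q A P\<close>. In each term the factor that contains \<open>Q\<close>
  contributes \<open>sqrt d\<close> and the other one at most the root of the full trace, whence the
  \<open>2\<close> and the square root.\<close>

lemma trace_norm_le_compression:
  fixes A :: "'a::complex_hilbert \<Rightarrow> 'a"
  assumes A: "trace_class A" "positive_op A" and E: "is_onb E" and F: "finite F" "F \<subseteq> E"
    and d: "trace_norm A - (\<Sum>e\<in>F. Re (cinner (A e) e)) \<le> d"
  shows "trace_norm_le (\<lambda>x. A x - proj F (A (proj F x))) (2 * sqrt (d * trace_norm A))"
proof -
  define t where "t = trace_norm A"
  obtain S where S: "positive_op S" "\<And>x. S (S x) = A x" using sqrt_op_exists[OF A(2)] by metis
  note nS = norm_sqrt_op[OF S(1), unfolded S(2)]
  have hS: "((\<lambda>e. (norm (S e))\<^sup>2) has_sum t) E"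
    using trace_norm_has_sum_positive[OF A E] by (simp add: nS t_def)
  have oF: "orthonormal F" using orthonormal_subset[OF is_onb_orthonormal[OF E] F(2)] .
  note P = contraction_proj[OF oF F(1)] and Q = contraction_proj_compl[OF oF F(1)]
  have 1: "(\<Sum>e\<in>K. (norm (S e - proj F (S e)))\<^sup>2) \<le> d" if "finite K" "K \<subseteq> E" for K
    using Hilbert_Schmidt_compl[OF E S(1) hS F that] d by (simp add: nS t_def)
  have 2: "(\<Sum>e\<in>K. (norm (S e))\<^sup>2) \<le> t" if "finite K" "K \<subseteq> E" for K
    by (rule finite_sum_le_has_sum[OF hS that]) simp
  have 3: "(\<Sum>e\<in>K. (norm (proj F (S e)))\<^sup>2) \<le> t" if "finite K" "K \<subseteq> E" for K
  proof -
    have "(\<Sum>e\<in>K. (norm (proj F (S e)))\<^sup>2) \<le> (\<Sum>e\<in>K. (norm (S e))\<^sup>2)"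
      by (intro sum_mono power_mono contractionD(2)[OF P]) simp
    then show ?thesis using 2[OF that] by linarith
  qed
  have "trace_norm_le (\<lambda>x. S (S (x - proj F x))) (sqrt d * sqrt t)"
    by (rule trace_norm_le_Hilbert_Schmidt[OF E S(1) contractionD(1)[OF Q] bounded_clinear_id _ 1 2])
       (simp add: cinner_simps proj_self_adjoint)
  moreover have "trace_norm_le (\<lambda>x. S (S (proj F x)) - proj F (S (S (proj F x)))) (sqrt t * sqrt d)"
    by (rule trace_norm_le_Hilbert_Schmidt[OF E S(1) contractionD(1)[OF P] contractionD(1)[OF Q] proj_self_adjoint 3 1])
  ultimately have "trace_norm_le (\<lambda>x. A (x - proj F x) + (A (proj F x) - proj F (A (proj F x))))
      (sqrt d * sqrt t + sqrt t * sqrt d)"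
    unfolding S(2) by (rule trace_norm_le_add)
  then show ?thesis
    by (simp add: bounded_clinear_diff[OF positive_opD[OF A(2)]] t_def mult.commute flip: real_sqrt_mult)
qed

section \<open>Partial traces\<close>

lemma sum_orthonormal_left:
  assumes "finite F" "orthonormal F" "f \<in> F"
  shows "(\<Sum>e\<in>F. cinner e f * h e) = h f"
proof -
  have "(\<Sum>e\<in>F. cinner e f * h e) = (\<Sum>e\<in>F. if e = f then h e else 0)"
    using assms by (intro sum.cong) (auto simp: orthonormalD)
  then show ?thesis using assms by simp
qed

text \<open>The test is \<open>G = {u}\<close> with the rank one contraction that carries the
  direction \<open>v\<close> of \<open>T x\<close> to the direction \<open>u\<close> of
  \<open>x\<close>.\<close>

lemma norm_le_trace_norm_le:
  assumes T: "trace_norm_le T C" shows "norm (T x) \<le> C * norm x"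
proof (cases "x = 0 \<or> T x = 0")
  case True
  then show ?thesis
    using trace_norm_le_nonneg[OF T] bounded_clinear_zero[OF trace_norm_le_clinear[OF T]] by auto
next
  case False
  define u where "u = (1 / norm x) *\<^sub>R x"
  define v where "v = (1 / norm (T x)) *\<^sub>R T x"
  have uv: "norm u = 1" "norm v = 1" using False by (auto simp: u_def v_def)
  have "contraction (rank_one u v)"
    using Cauchy_Schwarz[of _ v] uv by (simp add: contraction_def rank_one_bounded) (simp add: rank_one_def norm_scaleC)
  then have "Re (cinner (rank_one u v (T u)) u) \<le> C"
    using trace_norm_leD[OF T, of "rank_one u v" "{u}"] uv(1) by (simp add: orthonormal_def cinner_self_1)
  also have "cinner (rank_one u v (T u)) u = of_real (norm (T x) / norm x)"
    using uv(1) False by (simp add: rank_one_def cinner_simps cinner_self_1 u_def[symmetric])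
      (simp add: u_def v_def bounded_clinear_scaleR[OF trace_norm_le_clinear[OF T]] cinner_simps cinner_self
        power2_eq_square field_simps)
  finally show ?thesis using False by (simp add: field_simps)
qed

lemma bounded_linear_scaleC_left: "bounded_linear (\<lambda>c. c *\<^sub>C (w::'a::complex_inner))"
  by (rule bounded_linear_intro[where K="norm w"])
     (simp_all add: scaleC_add_left scaleR_scaleC scaleC_scaleC scaleR_conv_of_real norm_scaleC)

section \<open>Tensor products, slices and the construction of the partial trace\<close>

locale tensor_product =
  fixes tens :: "'a::complex_hilbert \<Rightarrow> 'b::complex_hilbert \<Rightarrow> 'c::complex_hilbert"
  assumes tensor: "hilbert_tensor tens"
begin

lemma tens_simps:
  "tens (x + x') y = tens x y + tens x' y" "tens x (y + y') = tens x y + tens x y'"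
  "tens (c *\<^sub>C x) y = c *\<^sub>C tens x y" "tens x (c *\<^sub>C y) = c *\<^sub>C tens x y"
  using tensor by (auto simp: hilbert_tensor_def)

lemma cinner_tens: "cinner (tens x y) (tens u v) = cinner x u * cinner y v"
  using tensor by (auto simp: hilbert_tensor_def)

lemma norm_tens: "norm (tens x y) = norm x * norm y"
proof -
  have "complex_of_real ((norm (tens x y))\<^sup>2) = of_real ((norm x * norm y)\<^sup>2)"
    unfolding cinner_self[symmetric] cinner_tens by (simp add: cinner_self power_mult_distrib)
  then have "(norm (tens x y))\<^sup>2 = (norm x * norm y)\<^sup>2" unfolding of_real_eq_iff .
  then show ?thesis by (simp add: power2_eq_iff_nonneg)
qed

lemma bounded_clinear_tens: "bounded_clinear (tens x)"
  by (rule bounded_clinearI[where K="norm x"]) (auto simp: tens_simps norm_tens)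

lemma bounded_clinear_tens_left: "bounded_clinear (\<lambda>x. tens x y)"
  by (rule bounded_clinearI[where K="norm y"]) (auto simp: tens_simps norm_tens)

text \<open>Interpreting the locale for the flipped tensor map turns statements about the first
  partial trace into statements about the second.\<close>

lemma swap: "tensor_product (\<lambda>y x. tens x y)"
proof
  have "{tens x y |y x. True} = {tens x y |x y. True}" by blast
  then show "hilbert_tensor (\<lambda>y x. tens x y)"
    using tensor by (simp add: hilbert_tensor_def mult.commute)
qed

text \<open>Contraction of the first factor against \<open>e\<close>. The map
  \<open>y \<mapsto> slice e (T (tens e y))\<close> is the diagonal block of \<open>T\<close> at
  \<open>e\<close>, and the partial trace is the sum of these blocks.\<close>

abbreviation slice :: "'a \<Rightarrow> 'c \<Rightarrow> 'b" where "slice e \<equiv> adj_op (tens e)"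

lemma cinner_slice: "cinner (slice e z) y = cinner z (tens e y)"
  by (rule cinner_adj'[OF bounded_clinear_tens])

lemmas bounded_clinear_slice = bounded_clinear_adj[OF bounded_clinear_tens]

lemma slice_tens: "slice e (tens x y) = cinner x e *\<^sub>C y"
  by (rule cinner_ext) (simp add: cinner_slice cinner_tens cinner_simps)

lemma cinner_sum_tens:
  assumes F: "finite F" "orthonormal F"
  shows "cinner (\<Sum>e\<in>F. tens e (u e)) (\<Sum>e\<in>F. tens e (v e)) = (\<Sum>e\<in>F. cinner (u e) (v e))"
proof -
  have "cinner (\<Sum>e\<in>F. tens e (u e)) (\<Sum>e\<in>F. tens e (v e))
      = (\<Sum>f\<in>F. \<Sum>e\<in>F. cinner e f * cinner (u e) (v f))"
    unfolding cinner_sum_left cinner_sum_right cinner_tens by (rule refl)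
  also have "\<dots> = (\<Sum>f\<in>F. cinner (u f) (v f))"
    by (intro sum.cong refl sum_orthonormal_left F)
  finally show ?thesis .
qed

lemma norm_sum_tens:
  assumes F: "finite F" "orthonormal F"
  shows "(norm (\<Sum>e\<in>F. tens e (u e)))\<^sup>2 = (\<Sum>e\<in>F. (norm (u e))\<^sup>2)"
proof -
  have "complex_of_real ((norm (\<Sum>e\<in>F. tens e (u e)))\<^sup>2) = of_real (\<Sum>e\<in>F. (norm (u e))\<^sup>2)"
    unfolding cinner_self[symmetric] cinner_sum_tens[OF F] by (simp add: cinner_self)
  then show ?thesis unfolding of_real_eq_iff .
qed

text \<open>\<open>p\<close> is the orthogonal projection of \<open>z\<close> onto the span of the
  vectors \<open>tens e y\<close> with \<open>e\<close> in \<open>F\<close>, and the inequality is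
  \<open>|z - p|^2 \<ge> 0\<close>.\<close>

lemma slice_Bessel:
  assumes F: "finite F" "orthonormal F"
  shows "(\<Sum>e\<in>F. (norm (slice e z))\<^sup>2) \<le> (norm z)\<^sup>2"
proof -
  define p where "p = (\<Sum>e\<in>F. tens e (slice e z))"
  have "cinner p z = of_real (\<Sum>e\<in>F. (norm (slice e z))\<^sup>2)"
    by (simp add: p_def cinner_sum_left cinner_adj[OF bounded_clinear_tens] cinner_self)
  then have "Re (cinner z p) = (\<Sum>e\<in>F. (norm (slice e z))\<^sup>2)" by (subst Re_cinner_commute) simp
  then have "(norm (z - p))\<^sup>2 = (norm z)\<^sup>2 - (\<Sum>e\<in>F. (norm (slice e z))\<^sup>2)"
    using norm_sum_tens[OF F, of "\<lambda>e. slice e z"] unfolding norm_diff_sq p_def by simp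
  then show ?thesis using zero_le_power2[of "norm (z - p)"] by linarith
qed

lemma contraction_pinching:
  assumes F: "finite F" "orthonormal F" and W: "\<And>e. e \<in> F \<Longrightarrow> contraction (W e)"
  shows "contraction (\<lambda>z. \<Sum>e\<in>F. tens e (W e (slice e z)))"
  unfolding contraction_def
proof (intro conjI allI)
  show "bounded_clinear (\<lambda>z. \<Sum>e\<in>F. tens e (W e (slice e z)))"
    by (intro bounded_clinear_sum_op bounded_clinear_compose[OF bounded_clinear_tens]
        bounded_clinear_compose[OF contractionD(1)[OF W] bounded_clinear_slice])
  fix z
  have "(norm (\<Sum>e\<in>F. tens e (W e (slice e z))))\<^sup>2 \<le> (\<Sum>e\<in>F. (norm (slice e z))\<^sup>2)"
    unfolding norm_sum_tens[OF F] by (intro sum_mono power_mono contractionD(2)[OF W]) simp_all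
  then have "(norm (\<Sum>e\<in>F. tens e (W e (slice e z))))\<^sup>2 \<le> (norm z)\<^sup>2"
    using slice_Bessel[OF F, of z] by linarith
  then show "norm (\<Sum>e\<in>F. tens e (W e (slice e z))) \<le> norm z" by (rule power2_le_imp_le) simp
qed

lemma inj_on_tens:
  assumes "orthonormal F" "orthonormal G"
  shows "inj_on (\<lambda>(e, g). tens e g) (F \<times> G)"
proof (rule inj_onI, clarify)
  fix e g e' g' assume m: "e \<in> F" "g \<in> G" "e' \<in> F" "g' \<in> G" and eq: "tens e g = tens e' g'"
  have "cinner (tens e g) (tens e' g') = 1"
    using m assms unfolding eq by (simp add: cinner_tens orthonormalD)
  then show "e = e' \<and> g = g'" using m assms by (auto simp: cinner_tens orthonormalD split: if_splits)
qed

lemma orthonormal_tens: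
  assumes "orthonormal F" "orthonormal G"
  shows "orthonormal ((\<lambda>(e, g). tens e g) ` (F \<times> G))"
  unfolding orthonormal_def
proof clarify
  fix e g e' g' assume m: "e \<in> F" "g \<in> G" "e' \<in> F" "g' \<in> G"
  have "tens e g = tens e' g' \<longleftrightarrow> e = e' \<and> g = g'"
    using inj_on_tens[OF assms] m by (auto simp: inj_on_def)
  then show "cinner (tens e g) (tens e' g') = (if tens e g = tens e' g' then 1 else 0)"
    using m assms by (auto simp: cinner_tens orthonormalD)
qed

text \<open>The block diagonal contraction with blocks \<open>W e\<close> is tested on a finite
  product set. The blocks may vary with \<open>e\<close>, and the absolute convergence of the series
  for the partial trace relies on this.\<close>

lemma sum_pinching_le:
  assumes T: "trace_norm_le T C" and F: "finite F" "orthonormal F" and G: "finite G" "orthonormal G"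
    and W: "\<And>e. e \<in> F \<Longrightarrow> contraction (W e)"
  shows "(\<Sum>e\<in>F. \<Sum>g\<in>G. Re (cinner (W e (slice e (T (tens e g)))) g)) \<le> C"
proof -
  define V where "V z = (\<Sum>e\<in>F. tens e (W e (slice e z)))" for z
  have V: "contraction V" unfolding V_def by (rule contraction_pinching[OF F W])
  have "cinner (V z) (tens e g) = cinner (W e (slice e z)) g" if "e \<in> F" for z e g
    unfolding V_def cinner_sum_left cinner_tens by (rule sum_orthonormal_left[OF F that])
  then have "(\<Sum>e\<in>F. \<Sum>g\<in>G. Re (cinner (W e (slice e (T (tens e g)))) g))
     = (\<Sum>e\<in>F. \<Sum>g\<in>G. Re (cinner (V (T (tens e g))) (tens e g)))" by simp
  also have "\<dots> = (\<Sum>z\<in>(\<lambda>(e, g). tens e g) ` (F \<times> G). Re (cinner (V (T z)) z))"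
    by (subst sum.reindex[OF inj_on_tens[OF F(2) G(2)]]) (simp add: sum.cartesian_product case_prod_unfold)
  also have "\<dots> \<le> C"
    by (rule trace_norm_leD[OF T V _ orthonormal_tens[OF F(2) G(2)]]) (use F G in simp)
  finally show ?thesis .
qed

lemma trace_norm_le_slices:
  assumes T: "trace_norm_le T C" and F: "finite F" "orthonormal F"
  shows "trace_norm_le (\<lambda>y. \<Sum>e\<in>F. slice e (T (tens e y))) C"
proof (rule trace_norm_leI)
  show "bounded_clinear (\<lambda>y. \<Sum>e\<in>F. slice e (T (tens e y)))"
    by (intro bounded_clinear_sum_op bounded_clinear_compose[OF bounded_clinear_slice]
        bounded_clinear_compose[OF trace_norm_le_clinear[OF T] bounded_clinear_tens])
  fix W :: "'b \<Rightarrow> 'b" and G :: "'b set" assume W: "contraction W" and G: "finite G" "orthonormal G"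
  have "(\<Sum>g\<in>G. Re (cinner (W (\<Sum>e\<in>F. slice e (T (tens e g)))) g))
      = (\<Sum>g\<in>G. \<Sum>e\<in>F. Re (cinner (W (slice e (T (tens e g)))) g))"
    by (simp add: bounded_clinear_sum[OF contractionD(1)[OF W]] cinner_sum_left)
  also have "\<dots> = (\<Sum>e\<in>F. \<Sum>g\<in>G. Re (cinner (W (slice e (T (tens e g)))) g))" by (rule sum.swap)
  also have "\<dots> \<le> C" by (rule sum_pinching_le[OF T F G W])
  finally show "(\<Sum>g\<in>G. Re (cinner (W (\<Sum>e\<in>F. slice e (T (tens e g)))) g)) \<le> C" .
qed

text \<open>The block \<open>rank_one u (sgn (v e))\<close> turns \<open>v e\<close> into
  \<open>norm (v e)\<close> times \<open>u\<close>, so that the tested sum becomes a sum of norms;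
  where \<open>v e = 0\<close> the block is zero, still a contraction.\<close>

lemma sum_norm_slices_le:
  assumes T: "trace_norm_le T C" and F: "finite F" "orthonormal F"
  shows "(\<Sum>e\<in>F. norm (slice e (T (tens e y)))) \<le> C * norm y"
proof (cases "y = 0")
  case True
  note l = bounded_clinear_zero[OF bounded_clinear_tens] bounded_clinear_zero[OF trace_norm_le_clinear[OF T]]
    bounded_clinear_zero[OF bounded_clinear_slice]
  show ?thesis by (simp add: True l)
next
  case False
  define u where "u = (1 / norm y) *\<^sub>R y"
  define v where "v e = slice e (T (tens e u))" for e
  have u: "norm u = 1" "y = norm y *\<^sub>R u" using False by (auto simp: u_def)
  have "contraction (rank_one u (sgn (v e)))" for e
  proof -
    have "cmod (cinner z (sgn (v e))) \<le> norm z" for z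
      using Cauchy_Schwarz[of z "sgn (v e)"] mult_left_mono[of "norm (sgn (v e))" 1 "norm z"]
      by (simp add: norm_sgn split: if_splits)
    then show ?thesis by (simp add: contraction_def rank_one_bounded) (simp add: rank_one_def norm_scaleC u(1))
  qed
  then have "(\<Sum>e\<in>F. \<Sum>g\<in>{u}. Re (cinner (rank_one u (sgn (v e)) (slice e (T (tens e g)))) g)) \<le> C"
    by (intro sum_pinching_le[OF T F]) (auto simp: orthonormal_def cinner_self_1 u(1))
  moreover have "cinner (rank_one u (sgn (v e)) (v e)) u = of_real (norm (v e))" for e
    by (cases "v e = 0")
       (simp_all add: rank_one_def cinner_simps cinner_self_1 u(1) sgn_div_norm cinner_self power2_eq_square)
  ultimately have "(\<Sum>e\<in>F. norm (v e)) \<le> C" by (simp add: v_def)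
  moreover have "slice e (T (tens e y)) = norm y *\<^sub>R v e" for e
    unfolding v_def by (subst u(2))
      (simp only: bounded_clinear_scaleR[OF bounded_clinear_tens] bounded_clinear_scaleR[OF bounded_clinear_slice]
        bounded_clinear_scaleR[OF trace_norm_le_clinear[OF T]])
  ultimately have "(\<Sum>e\<in>F. norm (slice e (T (tens e y)))) = norm y * (\<Sum>e\<in>F. norm (v e))"
    "(\<Sum>e\<in>F. norm (v e)) \<le> C" by (simp_all add: sum_distrib_left)
  then show ?thesis by (simp add: mult.commute[of C] mult_left_mono)
qed

text \<open>The value off the trace class is the one prescribed by
  \<open>bounded_clinear_tc\<close>, since the uniqueness argument has to identify total
  functions.\<close>

definition ptrace :: "('c \<Rightarrow> 'c) \<Rightarrow> 'b \<Rightarrow> 'b" where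
  "ptrace T = (if trace_class T then (\<lambda>y. \<Sum>\<^sub>\<infinity>e\<in>some_onb. slice e (T (tens e y))) else (\<lambda>y. 0))"

lemma orthonormal_some_onb: "F \<subseteq> some_onb \<Longrightarrow> orthonormal (F :: 'd::complex_hilbert set)"
  by (rule orthonormal_subset[OF is_onb_orthonormal[OF is_onb_some_onb]])

lemma ptrace_has_sum:
  assumes T: "trace_class T"
  shows "((\<lambda>e. slice e (T (tens e y))) has_sum ptrace T y) some_onb"
proof -
  have "(\<lambda>e. norm (slice e (T (tens e y)))) summable_on some_onb"
  proof (rule nonneg_bdd_above_summable_on)
    show "bdd_above (sum (\<lambda>e. norm (slice e (T (tens e y)))) ` {F. F \<subseteq> some_onb \<and> finite F})"
      using sum_norm_slices_le[OF trace_norm_le_trace_norm[OF T]] orthonormal_some_onb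
      by (intro bdd_aboveI[of _ "trace_norm T * norm y"]) auto
  qed simp
  then show ?thesis
    using T abs_summable_summable has_sum_infsum by (fastforce simp: ptrace_def)
qed

lemma trace_norm_le_ptrace:
  assumes T: "trace_norm_le T C"
  shows "trace_norm_le (ptrace T) C"
proof (rule trace_norm_le_limit)
  have tc: "trace_class T" by (rule trace_class_of_le[OF T])
  note Tl = trace_norm_le_clinear[OF T]
  note s = ptrace_has_sum[OF tc]
  show lim: "((\<lambda>F. \<Sum>e\<in>F. slice e (T (tens e y))) \<longlongrightarrow> ptrace T y) (finite_subsets_at_top some_onb)" for y
    using s[of y] by (simp add: has_sum_def)
  show "bounded_clinear (ptrace T)"
  proof (rule bounded_clinearI[where K=C])
    show "ptrace T (x + y) = ptrace T x + ptrace T y" for x y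
      using has_sum_add[OF s[of x] s[of y]] s[of "x + y"]
      by (simp add: bounded_clinear_add[OF bounded_clinear_tens] bounded_clinear_add[OF Tl]
          bounded_clinear_add[OF bounded_clinear_slice] has_sum_unique)
    show "ptrace T (c *\<^sub>C x) = c *\<^sub>C ptrace T x" for c x
      using has_sum_bounded_linear[OF bounded_clinear_linear[OF bounded_clinear_cscale[OF bounded_clinear_id]] s[of x], of c]
        s[of "c *\<^sub>C x"]
      by (simp add: bounded_clinear_scaleC[OF bounded_clinear_tens] bounded_clinear_scaleC[OF Tl]
          bounded_clinear_scaleC[OF bounded_clinear_slice] has_sum_unique)
    fix y
    have "\<forall>\<^sub>F F in finite_subsets_at_top some_onb. norm (\<Sum>e\<in>F. slice e (T (tens e y))) \<le> C * norm y"
      using sum_norm_slices_le[OF T] orthonormal_some_onb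
      by (intro eventually_finite_subsets_at_top_weakI order_trans[OF norm_sum]) auto
    then show "norm (ptrace T y) \<le> C * norm y"
      by (rule tendsto_upperbound[OF tendsto_norm[OF lim]]) simp
  qed
  show "\<forall>\<^sub>F F in finite_subsets_at_top some_onb. trace_norm_le (\<lambda>y. \<Sum>e\<in>F. slice e (T (tens e y))) C"
    by (intro eventually_finite_subsets_at_top_weakI trace_norm_le_slices[OF T] orthonormal_some_onb)
qed simp

text \<open>The block at \<open>e\<close> carries the coefficient \<open><x, e> <e, u>\<close>, and
  the sum of these is Parseval's identity.\<close>

lemma ptrace_rank_one:
  "ptrace (rank_one (tens x y) (tens u v)) = (\<lambda>z. cinner x u *\<^sub>C rank_one y v z)"
proof
  fix z
  have "slice e (rank_one (tens x y) (tens u v) (tens e z)) = (cinner x e * cinner e u) *\<^sub>C rank_one y v z" for e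
    by (simp add: rank_one_def bounded_clinear_scaleC[OF bounded_clinear_slice] slice_tens cinner_tens
        scaleC_scaleC mult_ac)
  moreover have "((\<lambda>e. (cinner x e * cinner e u) *\<^sub>C rank_one y v z) has_sum cinner x u *\<^sub>C rank_one y v z) some_onb"
    by (rule has_sum_bounded_linear[OF bounded_linear_scaleC_left Parseval[OF is_onb_some_onb]])
  ultimately show "ptrace (rank_one (tens x y) (tens u v)) z = cinner x u *\<^sub>C rank_one y v z"
    using ptrace_has_sum[OF trace_class_of_le[OF trace_norm_le_rank_one], of "tens x y" "tens u v" z]
    by (simp add: has_sum_unique)
qed

lemma ptrace_bounded_clinear_tc: "bounded_clinear_tc ptrace"
  unfolding bounded_clinear_tc_def
proof (intro conjI allI impI exI[of _ 1])
  show "trace_class (ptrace T)" if "trace_class T" for T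
    using trace_class_of_le trace_norm_le_ptrace trace_norm_le_trace_norm that by blast
  show "trace_norm (ptrace T) \<le> 1 * trace_norm T" if "trace_class T" for T
    using trace_norm_least[OF trace_norm_le_ptrace[OF trace_norm_le_trace_norm[OF that]]] by simp
  show "ptrace T = (\<lambda>z. 0)" if "\<not> trace_class T" for T
    using that by (simp add: ptrace_def)
  show "ptrace (\<lambda>z. S z + T z) = (\<lambda>z. ptrace S z + ptrace T z)" if S: "trace_class S" and T: "trace_class T" for S T
  proof
    fix y
    have "trace_class (\<lambda>z. S z + T z)"
      using trace_norm_le_add[OF trace_norm_le_trace_norm[OF S] trace_norm_le_trace_norm[OF T]] by (rule trace_class_of_le)
    from ptrace_has_sum[OF this, of y] has_sum_add[OF ptrace_has_sum[OF S, of y] ptrace_has_sum[OF T, of y]]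
    show "ptrace (\<lambda>z. S z + T z) y = ptrace S y + ptrace T y"
      by (simp add: bounded_clinear_add[OF bounded_clinear_slice] has_sum_unique)
  qed
  show "ptrace (\<lambda>z. c *\<^sub>C T z) = (\<lambda>z. c *\<^sub>C ptrace T z)" if T: "trace_class T" for c T
  proof
    fix y
    have "trace_class (\<lambda>z. c *\<^sub>C T z)"
      using trace_norm_le_scaleC[OF trace_norm_le_trace_norm[OF T]] by (rule trace_class_of_le)
    from ptrace_has_sum[OF this, of y]
      has_sum_bounded_linear[OF bounded_clinear_linear[OF bounded_clinear_cscale[OF bounded_clinear_id]] ptrace_has_sum[OF T, of y], of c]
    show "ptrace (\<lambda>z. c *\<^sub>C T z) y = c *\<^sub>C ptrace T y"
      by (simp add: bounded_clinear_scaleC[OF bounded_clinear_slice] has_sum_unique)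
  qed
qed

end

section \<open>Uniqueness of bounded maps on the trace class\<close>

lemma bounded_clinear_tc_le:
  assumes F: "bounded_clinear_tc F"
  obtains K where "K \<ge> 0" "\<And>T C. trace_norm_le T C \<Longrightarrow> trace_norm_le (F T) (K * C)"
proof -
  obtain K where K: "\<And>T. trace_class T \<Longrightarrow> trace_norm (F T) \<le> K * trace_norm T"
    using F by (auto simp: bounded_clinear_tc_def)
  have tc: "trace_class (F T)" if "trace_class T" for T using F that by (auto simp: bounded_clinear_tc_def)
  \<comment> \<open>The constant \<open>K\<close> may be negative, hence its absolute value.\<close>
  have "trace_norm_le (F T) (\<bar>K\<bar> * C)" if T: "trace_norm_le T C" for T C
  proof (rule trace_norm_le_mono[OF trace_norm_le_trace_norm[OF tc[OF trace_class_of_le[OF T]]]])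
    have "trace_norm (F T) \<le> K * trace_norm T" by (rule K[OF trace_class_of_le[OF T]])
    also have "\<dots> \<le> \<bar>K\<bar> * C"
      using trace_norm_least[OF T] trace_norm_nonneg[OF trace_class_of_le[OF T]] by (intro mult_mono) auto
    finally show "trace_norm (F T) \<le> \<bar>K\<bar> * C" .
  qed
  then show thesis by (intro that[of "\<bar>K\<bar>"]) auto
qed

lemma bounded_clinear_tc_add:
  "bounded_clinear_tc F \<Longrightarrow> trace_class S \<Longrightarrow> trace_class T \<Longrightarrow> F (\<lambda>z. S z + T z) = (\<lambda>z. F S z + F T z)"
  by (simp add: bounded_clinear_tc_def)

lemma bounded_clinear_tc_scaleC:
  "bounded_clinear_tc F \<Longrightarrow> trace_class T \<Longrightarrow> F (\<lambda>z. c *\<^sub>C T z) = (\<lambda>z. c *\<^sub>C F T z)"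
  by (simp add: bounded_clinear_tc_def)

text \<open>Both maps are bounded in trace norm, which dominates the operator norm, so
  \<open>F T x - G T x\<close> is at most a multiple of every \<epsilon>. Agreement thus passes to
  trace norm limits.\<close>

lemma bounded_clinear_tc_eq_closed:
  assumes F: "bounded_clinear_tc F" and G: "bounded_clinear_tc G" and T: "trace_class T"
    and approx: "\<And>\<epsilon>. \<epsilon> > 0 \<Longrightarrow> \<exists>S. trace_class S \<and> F S = G S \<and> trace_norm_le (\<lambda>z. T z - S z) \<epsilon>"
  shows "F T = G T"
proof
  fix x
  obtain K where K: "K \<ge> 0" "\<And>T C. trace_norm_le T C \<Longrightarrow> trace_norm_le (F T) (K * C)"
    using bounded_clinear_tc_le[OF F] by metis
  obtain L where L: "L \<ge> 0" "\<And>T C. trace_norm_le T C \<Longrightarrow> trace_norm_le (G T) (L * C)"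
    using bounded_clinear_tc_le[OF G] by metis
  have le: "norm (F T x - G T x) \<le> (K + L) * \<epsilon> * norm x" if \<epsilon>: "\<epsilon> > 0" for \<epsilon>
  proof -
    obtain S where S: "trace_class S" "F S = G S" "trace_norm_le (\<lambda>z. T z - S z) \<epsilon>"
      using approx[OF \<epsilon>] by blast
    define D where "D = (\<lambda>z. T z - S z)"
    have D: "trace_class D" unfolding D_def by (rule trace_class_of_le[OF S(3)])
    have TD: "T = (\<lambda>z. S z + D z)" by (simp add: D_def)
    have "F T x - G T x = F D x - G D x"
      by (subst (1 2) TD) (simp add: bounded_clinear_tc_add[OF F S(1) D] bounded_clinear_tc_add[OF G S(1) D] S(2))
    moreover have "trace_norm_le (\<lambda>x. F D x - G D x) (K * \<epsilon> + L * \<epsilon>)"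
      using K(2) L(2) S(3) unfolding D_def by (intro trace_norm_le_diff) auto
    ultimately show ?thesis using norm_le_trace_norm_le[of "\<lambda>x. F D x - G D x" "K * \<epsilon> + L * \<epsilon>" x]
      by (simp add: distrib_right)
  qed
  have "norm (F T x - G T x) \<le> 0"
  proof (rule field_le_epsilon)
    fix e :: real assume e: "e > 0"
    define \<epsilon> where "\<epsilon> = e / ((K + L) * norm x + 1)"
    have pos: "(K + L) * norm x + 1 > 0" using K(1) L(1) by (simp add: add_nonneg_pos)
    have "\<epsilon> > 0" using e pos by (simp add: \<epsilon>_def)
    then have "norm (F T x - G T x) \<le> ((K + L) * norm x) * \<epsilon>" using le[of \<epsilon>] by (simp add: mult_ac)
    also have "\<dots> \<le> ((K + L) * norm x + 1) * \<epsilon>" using \<open>\<epsilon> > 0\<close> by (intro mult_right_mono) auto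
    also have "\<dots> = 0 + e" using pos by (simp add: \<epsilon>_def)
    finally show "norm (F T x - G T x) \<le> 0 + e" .
  qed
  then show "F T x = G T x" by simp
qed

lemma rank_one_add_left: "rank_one (c *\<^sub>C x + x') y = (\<lambda>z. c *\<^sub>C rank_one x y z + rank_one x' y z)"
  by (auto simp: rank_one_def scaleC_add_right scaleC_scaleC mult.commute)

lemma rank_one_add_right: "rank_one x (c *\<^sub>C y + y') = (\<lambda>z. cnj c *\<^sub>C rank_one x y z + rank_one x y' z)"
  by (auto simp: rank_one_def cinner_simps scaleC_add_left scaleC_scaleC mult.commute)

lemma trace_class_rank_one: "trace_class (rank_one x (y::'a::complex_hilbert))"
  by (rule trace_class_of_le[OF trace_norm_le_rank_one])

lemma trace_class_cscale: "trace_class T \<Longrightarrow> trace_class (\<lambda>z. c *\<^sub>C (T z :: 'a::complex_hilbert))"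
  using trace_norm_le_scaleC trace_class_iff by blast

lemma trace_class_plus:
  "trace_class S \<Longrightarrow> trace_class T \<Longrightarrow> trace_class (\<lambda>z. S z + (T z :: 'a::complex_hilbert))"
  using trace_norm_le_add trace_class_iff by blast

lemma trace_class_diff:
  "trace_class S \<Longrightarrow> trace_class T \<Longrightarrow> trace_class (\<lambda>z. S z - (T z :: 'a::complex_hilbert))"
  using trace_norm_le_diff trace_class_iff by blast

lemma trace_class_null: "trace_class (\<lambda>z. 0 :: 'a::complex_hilbert)"
  using trace_norm_le_0 by (rule trace_class_of_le)

text \<open>Agreement spreads from rank one operators over \<open>B\<close> to those over the span,
  since \<open>rank_one\<close> is linear in the first and conjugate linear in the second argument.
  Density is then used one argument at a time, and finite rank truncations reach the whole trace
  class.\<close>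

lemma bounded_clinear_tc_unique:
  fixes F G :: "('c::complex_hilbert \<Rightarrow> 'c) \<Rightarrow> 'd::complex_hilbert \<Rightarrow> 'd"
  assumes F: "bounded_clinear_tc F" and G: "bounded_clinear_tc G"
    and dense: "closure (cspan B) = UNIV"
    and eq: "\<And>x y. x \<in> B \<Longrightarrow> y \<in> B \<Longrightarrow> F (rank_one x y) = G (rank_one x y)"
  shows "F = G"
proof
  define agree where "agree T \<longleftrightarrow> trace_class T \<and> F T = G T" for T
  have null: "agree (\<lambda>z. 0)"
    using bounded_clinear_tc_scaleC[OF F trace_class_null, of 0] bounded_clinear_tc_scaleC[OF G trace_class_null, of 0]
    by (simp add: agree_def trace_class_null)
  have add: "agree (\<lambda>z. c *\<^sub>C S z + T z)" if "agree S" "agree T" for c S T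
    using that unfolding agree_def
    by (simp add: bounded_clinear_tc_scaleC[OF F] bounded_clinear_tc_scaleC[OF G] trace_class_cscale
        bounded_clinear_tc_add[OF F] bounded_clinear_tc_add[OF G] trace_class_plus)
  have closed: "agree T" if "trace_class T" "\<And>\<epsilon>. \<epsilon> > 0 \<Longrightarrow> \<exists>S. agree S \<and> trace_norm_le (\<lambda>z. T z - S z) \<epsilon>" for T
    unfolding agree_def using bounded_clinear_tc_eq_closed[OF F G that(1)] that unfolding agree_def by blast
  have near: "\<exists>x'\<in>cspan B. norm (x - x') * norm y \<le> \<epsilon>" if \<epsilon>: "\<epsilon> > 0" for x y :: 'c and \<epsilon>
  proof -
    have "x \<in> closure (cspan B)" "\<epsilon> / (norm y + 1) > 0" using dense \<epsilon> by (auto intro!: divide_pos_pos add_nonneg_pos)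
    then obtain x' where x': "x' \<in> cspan B" "dist x' x < \<epsilon> / (norm y + 1)"
      unfolding closure_approachable by blast
    have "norm (x - x') * norm y \<le> \<epsilon> / (norm y + 1) * (norm y + 1)"
      using x'(2) \<open>\<epsilon> / (norm y + 1) > 0\<close> by (intro mult_mono) (auto simp: dist_norm norm_minus_commute)
    moreover have "norm y + 1 \<noteq> 0" using norm_ge_zero[of y] by linarith
    ultimately show ?thesis using x'(1) by (intro bexI[of _ x']) auto
  qed
  have zl: "rank_one 0 y = (\<lambda>z. 0)" and zr: "rank_one y 0 = (\<lambda>z. 0)" for y :: 'c
    by (auto simp: rank_one_def)
  have 1: "agree (rank_one x y)" if "x \<in> cspan B" "y \<in> B" for x y
    using that(1)
  proof (induction rule: complex_vector.span_induct_alt)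
    case base then show ?case using null by (simp add: zl)
  next
    case (step c x' x'')
    have "agree (rank_one x' y)"
      using eq[OF step(1) that(2)] by (simp add: agree_def trace_class_rank_one)
    then show ?case using add step(2) unfolding rank_one_add_left by blast
  qed
  have 2: "agree (rank_one x y)" if "x \<in> cspan B" "y \<in> cspan B" for x y
    using that(2)
  proof (induction rule: complex_vector.span_induct_alt)
    case base then show ?case using null by (simp add: zr)
  next
    case (step c y' y'')
    then show ?case
      using add 1[OF that(1)] unfolding rank_one_add_right by blast
  qed
  have 3: "agree (rank_one x y)" if "y \<in> cspan B" for x y
  proof (rule closed[OF trace_class_rank_one])
    fix \<epsilon> :: real assume \<epsilon>: "\<epsilon> > 0"
    obtain x' where x': "x' \<in> cspan B" "norm (x - x') * norm y \<le> \<epsilon>" using near[OF \<epsilon>] by blast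
    have "(\<lambda>z. rank_one x y z - rank_one x' y z) = rank_one (x - x') y"
      by (auto simp: rank_one_def complex_vector.scale_right_diff_distrib)
    then have "trace_norm_le (\<lambda>z. rank_one x y z - rank_one x' y z) \<epsilon>"
      using trace_norm_le_mono[OF trace_norm_le_rank_one x'(2)] by simp
    then show "\<exists>S. agree S \<and> trace_norm_le (\<lambda>z. rank_one x y z - S z) \<epsilon>"
      using 2[OF x'(1) that] by blast
  qed
  have 4: "agree (rank_one x y)" for x y
  proof (rule closed[OF trace_class_rank_one])
    fix \<epsilon> :: real assume \<epsilon>: "\<epsilon> > 0"
    obtain y' where y': "y' \<in> cspan B" "norm (y - y') * norm x \<le> \<epsilon>" using near[OF \<epsilon>] by blast
    have "(\<lambda>z. rank_one x y z - rank_one x y' z) = rank_one x (y - y')"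
      by (auto simp: rank_one_def cinner_simps complex_vector.scale_left_diff_distrib)
    then have "trace_norm_le (\<lambda>z. rank_one x y z - rank_one x y' z) \<epsilon>"
      using trace_norm_le_mono[OF trace_norm_le_rank_one, of x "y - y'" \<epsilon>] y'(2) by (simp add: mult.commute)
    then show "\<exists>S. agree S \<and> trace_norm_le (\<lambda>z. rank_one x y z - S z) \<epsilon>"
      using 3[OF y'(1)] by blast
  qed
  fix T
  show "F T = G T"
  proof (cases "trace_class T")
    case False
    then show ?thesis using F G by (simp add: bounded_clinear_tc_def)
  next
    case T: True
    note Tl = trace_class_clinear[OF T]
    have "agree T"
    proof (rule closed[OF T])
      fix \<epsilon> :: real assume \<epsilon>: "\<epsilon> > 0"
      obtain P where P: "finite P" "trace_norm_le (\<lambda>x. T (x - proj P x)) \<epsilon>"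
        using trace_class_proj_approx[OF T is_onb_some_onb \<epsilon>] by metis
      have "agree (\<lambda>z. \<Sum>e\<in>P. rank_one (T e) e z)"
        using P(1) add[OF 4, of _ 1] by (induction P) (auto simp: null)
      moreover have "(\<lambda>z. \<Sum>e\<in>P. rank_one (T e) e z) = (\<lambda>z. T (proj P z))"
        by (auto simp: rank_one_def proj_def bounded_clinear_sum[OF Tl] bounded_clinear_scaleC[OF Tl])
      ultimately show "\<exists>S. agree S \<and> trace_norm_le (\<lambda>z. T z - S z) \<epsilon>"
        using P(2) by (intro exI[of _ "\<lambda>z. T (proj P z)"]) (simp add: bounded_clinear_diff[OF Tl])
    qed
    then show ?thesis by (simp add: agree_def)
  qed
qed

section \<open>Identification of the two partial traces\<close>

context tensor_product
begin

lemma partial_trace1_eq: "partial_trace1 tens = ptrace"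
  unfolding partial_trace1_def
proof (rule the_equality)
  fix F assume F: "bounded_clinear_tc F \<and>
    (\<forall>x y u v. F (rank_one (tens x y) (tens u v)) = (\<lambda>z. cinner x u *\<^sub>C rank_one y v z))"
  show "F = ptrace"
  proof (rule bounded_clinear_tc_unique[where B="{tens x y |x y. True}"])
    show "closure (cspan {tens x y |x y. True}) = UNIV" using tensor by (simp add: hilbert_tensor_def)
    fix s t assume "s \<in> {tens x y |x y. True}" "t \<in> {tens x y |x y. True}"
    then obtain x y u v where st: "s = tens x y" "t = tens u v" by blast
    show "F (rank_one s t) = ptrace (rank_one s t)"
      unfolding st ptrace_rank_one using F by blast
  qed (use F ptrace_bounded_clinear_tc in auto)
qed (simp add: ptrace_bounded_clinear_tc ptrace_rank_one)

lemma trace_norm_le_partial_trace1: "trace_norm_le T C \<Longrightarrow> trace_norm_le (partial_trace1 tens T) C"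
  unfolding partial_trace1_eq by (rule trace_norm_le_ptrace)

lemma partial_trace1_has_sum:
  assumes "trace_class T"
  shows "((\<lambda>e. cinner (T (tens e y)) (tens e v)) has_sum cinner (partial_trace1 tens T y) v) some_onb"
  using has_sum_bounded_linear[OF bounded_linear_cinner_left ptrace_has_sum[OF assms]]
  unfolding partial_trace1_eq cinner_slice .

lemma partial_trace2_eq: "partial_trace2 tens = partial_trace1 (\<lambda>y x. tens x y)"
proof -
  have "(\<forall>x y u v. F (rank_one (tens x y) (tens u v)) = (\<lambda>z. cinner y v *\<^sub>C rank_one x u z))
      \<longleftrightarrow> (\<forall>y x v u. F (rank_one (tens x y) (tens u v)) = (\<lambda>z. cinner y v *\<^sub>C rank_one x u z))"
    for F :: "('c \<Rightarrow> 'c) \<Rightarrow> 'a \<Rightarrow> 'a" by blast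
  then show ?thesis unfolding partial_trace1_def partial_trace2_def by simp
qed

end

section \<open>Convergence in trace norm\<close>

lemma trace_norm_triangle:
  fixes S T :: "'a::complex_hilbert \<Rightarrow> 'a"
  assumes S: "trace_class S" and T: "trace_class T"
  shows "\<bar>trace_norm S - trace_norm T\<bar> \<le> trace_norm (\<lambda>x. S x - T x)"
proof -
  have D: "trace_norm_le (\<lambda>x. S x - T x) (trace_norm (\<lambda>x. S x - T x))"
    by (rule trace_norm_le_trace_norm[OF trace_class_diff[OF S T]])
  have "trace_norm_le S (trace_norm T + trace_norm (\<lambda>x. S x - T x))"
    using trace_norm_le_add[OF trace_norm_le_trace_norm[OF T] D] by simp
  moreover have "trace_norm_le T (trace_norm S + trace_norm (\<lambda>x. S x - T x))"
    using trace_norm_le_diff[OF trace_norm_le_trace_norm[OF S] D] by simp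
  ultimately show ?thesis by (auto dest!: trace_norm_least)
qed

lemma trace_norm_tendsto:
  fixes S :: "'a::complex_hilbert \<Rightarrow> 'a"
  assumes "\<And>n. trace_class (T n)" "trace_class S" "(\<lambda>n. trace_norm (\<lambda>x. T n x - S x)) \<longlonglongrightarrow> 0"
  shows "(\<lambda>n. trace_norm (T n)) \<longlonglongrightarrow> trace_norm S"
  by (rule LIM_zero_cancel, rule Lim_null_comparison[OF _ assms(3)])
     (simp add: trace_norm_triangle assms)

lemma trace_norm_imp_strong_tendsto:
  fixes S :: "'a::complex_hilbert \<Rightarrow> 'a"
  assumes "\<And>n. trace_class (T n)" "trace_class S" "(\<lambda>n. trace_norm (\<lambda>x. T n x - S x)) \<longlonglongrightarrow> 0"
  shows "(\<lambda>n. T n x) \<longlonglongrightarrow> S x"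
proof (rule LIM_zero_cancel, rule Lim_null_comparison)
  show "\<forall>\<^sub>F n in sequentially. norm (T n x - S x) \<le> trace_norm (\<lambda>x. T n x - S x) * norm x"
    using norm_le_trace_norm_le[OF trace_norm_le_trace_norm[OF trace_class_diff[OF assms(1,2)]]] by simp
  show "(\<lambda>n. trace_norm (\<lambda>x. T n x - S x) * norm x) \<longlonglongrightarrow> 0"
    by (rule tendsto_mult_left_zero[OF assms(3)])
qed

text \<open>The compression is a finite combination of rank one operators of unit trace norm, with
  matrix entries as coefficients. For a difference of operators these are the quantities that weak
  convergence controls.\<close>

lemma trace_norm_le_compressed:
  assumes T: "bounded_clinear T" and F: "finite F" "orthonormal F"
  shows "trace_norm_le (\<lambda>x. proj F (T (proj F x))) (\<Sum>e\<in>F. \<Sum>f\<in>F. cmod (cinner (T e) f))"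
proof -
  have "trace_norm_le (\<lambda>x. cinner (T e) f *\<^sub>C rank_one f e x) (cmod (cinner (T e) f))" if "e \<in> F" "f \<in> F" for e f
    using trace_norm_le_scaleC[OF trace_norm_le_rank_one[of f e], of "cinner (T e) f"]
      orthonormal_norm[OF F(2)] that by simp
  then have "trace_norm_le (\<lambda>x. \<Sum>e\<in>F. \<Sum>f\<in>F. cinner (T e) f *\<^sub>C rank_one f e x)
      (\<Sum>e\<in>F. \<Sum>f\<in>F. cmod (cinner (T e) f))"
    by (intro trace_norm_le_sum)
  moreover have "proj F (T (proj F x)) = (\<Sum>e\<in>F. \<Sum>f\<in>F. cinner (T e) f *\<^sub>C rank_one f e x)" for x
  proof -
    have "proj F (T (proj F x)) = (\<Sum>f\<in>F. \<Sum>e\<in>F. cinner (T e) f *\<^sub>C rank_one f e x)"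
      unfolding proj_def bounded_clinear_sum[OF T] bounded_clinear_scaleC[OF T] rank_one_def
      by (simp add: cinner_sum_left cinner_simps complex_vector.scale_sum_left scaleC_scaleC mult.commute)
    also have "\<dots> = (\<Sum>e\<in>F. \<Sum>f\<in>F. cinner (T e) f *\<^sub>C rank_one f e x)" by (rule sum.swap)
    finally show ?thesis .
  qed
  ultimately show ?thesis by simp
qed

text \<open>The tensor structure is separated off: weak convergence, convergent traces and small
  diagonal tails suffice. Tails are bounded by a sequence \<open>s\<close> with small limit, because
  the partial traces are controlled only in the limit.\<close>

lemma wot_tight_imp_trace_norm:
  fixes \<rho> :: "'a::complex_hilbert \<Rightarrow> 'a"
  assumes \<rho>n: "\<And>n. trace_class (\<rho>n n)" "\<And>n. positive_op (\<rho>n n)"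
    and \<rho>: "trace_class \<rho>" "positive_op \<rho>"
    and wot: "wot_tendsto \<rho>n \<rho>" and E: "is_onb E"
    and bound: "(\<lambda>n. trace_norm (\<rho>n n)) \<longlonglongrightarrow> t"
    and tight: "\<And>\<delta>. \<delta> > 0 \<Longrightarrow> \<exists>F s. finite F \<and> F \<subseteq> E \<and>
      (\<forall>n. trace_norm (\<rho>n n) - (\<Sum>e\<in>F. Re (cinner (\<rho>n n e) e)) \<le> s n) \<and> (\<exists>L\<le>\<delta>. s \<longlonglongrightarrow> L)"
  shows "(\<lambda>n. trace_norm (\<lambda>x. \<rho>n n x - \<rho> x)) \<longlonglongrightarrow> 0"
proof (rule tendstoI)
  fix \<epsilon> :: real assume \<epsilon>: "\<epsilon> > 0"
  define r where "r = trace_norm \<rho>"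
  have r0: "r \<ge> 0" unfolding r_def by (rule trace_norm_nonneg[OF \<rho>(1)])
  have t0: "t \<ge> 0" by (rule LIMSEQ_le_const[OF bound]) (simp add: trace_norm_nonneg[OF \<rho>n(1)])
  \<comment> \<open>Tightness is used at the square of \<eta>, since compression costs a square
    root; the \<open>1\<close> makes the final inequality strict and the denominator
    positive.\<close>
  define \<eta> where "\<eta> = \<epsilon> / (2 * sqrt t + 2 * sqrt r + 1)"
  have den: "2 * sqrt t + 2 * sqrt r + 1 > 0" using t0 r0 by (simp add: add_nonneg_pos)
  have \<eta>: "\<eta> > 0" using \<epsilon> den by (simp add: \<eta>_def)
  have \<eta>2: "\<eta> * (2 * sqrt t + 2 * sqrt r) < \<epsilon>"
  proof -
    have "\<eta> * (2 * sqrt t + 2 * sqrt r) < \<eta> * (2 * sqrt t + 2 * sqrt r + 1)" using \<eta> by simp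
    also have "\<dots> = \<epsilon>" using den by (simp add: \<eta>_def)
    finally show ?thesis .
  qed
  obtain F s L where F: "finite F" "F \<subseteq> E"
    and s: "\<And>n. trace_norm (\<rho>n n) - (\<Sum>e\<in>F. Re (cinner (\<rho>n n e) e)) \<le> s n"
    and L: "L \<le> \<eta>\<^sup>2" "s \<longlonglongrightarrow> L"
    using tight[of "\<eta>\<^sup>2"] \<eta> by auto
  have oF: "orthonormal F" using orthonormal_subset[OF is_onb_orthonormal[OF E] F(2)] .
  have w: "(\<lambda>n. cinner (\<rho>n n x) y) \<longlonglongrightarrow> cinner (\<rho> x) y" for x y using wot by (simp add: wot_tendsto_def)
  \<comment> \<open>Lower semicontinuity: for each finite \<open>K\<close> the sum of diagonal
    entries is bounded by that over \<open>F\<close> plus \<open>s n\<close>, and this passes to the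
    weak limit before \<open>K\<close> grows.\<close>
  have r_tail: "r - (\<Sum>e\<in>F. Re (cinner (\<rho> e) e)) \<le> L"
  proof -
    have "r \<le> (\<Sum>e\<in>F. Re (cinner (\<rho> e) e)) + L"
    proof (rule has_sum_le_finite_sums[OF trace_norm_has_sum_positive[OF \<rho> E, folded r_def]])
      fix K assume K: "finite K" "K \<subseteq> E"
      show "(\<Sum>e\<in>K. Re (cinner (\<rho> e) e)) \<le> (\<Sum>e\<in>F. Re (cinner (\<rho> e) e)) + L"
      proof (rule LIMSEQ_le)
        show "(\<lambda>n. \<Sum>e\<in>K. Re (cinner (\<rho>n n e) e)) \<longlonglongrightarrow> (\<Sum>e\<in>K. Re (cinner (\<rho> e) e))"
          by (intro tendsto_intros w)
        show "(\<lambda>n. (\<Sum>e\<in>F. Re (cinner (\<rho>n n e) e)) + s n) \<longlonglongrightarrow> (\<Sum>e\<in>F. Re (cinner (\<rho> e) e)) + L"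
          by (intro tendsto_intros w L)
        have "(\<Sum>e\<in>K. Re (cinner (\<rho>n n e) e)) \<le> (\<Sum>e\<in>F. Re (cinner (\<rho>n n e) e)) + s n" for n
          using finite_sum_le_has_sum[OF trace_norm_has_sum_positive[OF \<rho>n(1) \<rho>n(2) E] K
              positive_op_ge[OF \<rho>n(2)], of n] s[of n] by linarith
        then show "\<exists>N. \<forall>n\<ge>N. (\<Sum>e\<in>K. Re (cinner (\<rho>n n e) e)) \<le> (\<Sum>e\<in>F. Re (cinner (\<rho>n n e) e)) + s n"
          by blast
      qed
    qed
    then show ?thesis by linarith
  qed
  \<comment> \<open>The outer terms are the compression errors of \<rho>n and \<rho>; the middle
    term is a difference of finite matrices and tends to zero.\<close>
  define b where "b n = 2 * sqrt (s n * trace_norm (\<rho>n n))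
      + (\<Sum>e\<in>F. \<Sum>f\<in>F. cmod (cinner (\<rho>n n e) f - cinner (\<rho> e) f)) + 2 * sqrt (L * r)" for n
  have le_b: "trace_norm (\<lambda>x. \<rho>n n x - \<rho> x) \<le> b n" for n
  proof (rule trace_norm_least)
    let ?P = "proj F"
    have lin: "bounded_clinear (\<lambda>x. \<rho>n n x - \<rho> x)"
      by (rule trace_class_clinear[OF trace_class_diff[OF \<rho>n(1) \<rho>(1)]])
    note Pl = contractionD(1)[OF contraction_proj[OF oF F(1)]]
    have "trace_norm_le (\<lambda>x. \<rho>n n x - ?P (\<rho>n n (?P x))) (2 * sqrt (s n * trace_norm (\<rho>n n)))"
      by (rule trace_norm_le_compression[OF \<rho>n E F s])
    moreover have "trace_norm_le (\<lambda>x. \<rho> x - ?P (\<rho> (?P x))) (2 * sqrt (L * r))"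
      unfolding r_def by (rule trace_norm_le_compression[OF \<rho> E F r_tail[unfolded r_def]])
    moreover have "trace_norm_le (\<lambda>x. ?P (\<rho>n n (?P x) - \<rho> (?P x)))
        (\<Sum>e\<in>F. \<Sum>f\<in>F. cmod (cinner (\<rho>n n e) f - cinner (\<rho> e) f))"
      using trace_norm_le_compressed[OF lin F(1) oF] by (simp add: cinner_diff_left)
    ultimately have "trace_norm_le (\<lambda>x. (\<rho>n n x - ?P (\<rho>n n (?P x))) + ?P (\<rho>n n (?P x) - \<rho> (?P x))
        - (\<rho> x - ?P (\<rho> (?P x)))) (b n)"
      unfolding b_def by (intro trace_norm_le_diff trace_norm_le_add)
    then show "trace_norm_le (\<lambda>x. \<rho>n n x - \<rho> x) (b n)"
      by (simp add: bounded_clinear_diff[OF Pl])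
  qed
  have "b \<longlonglongrightarrow> 2 * sqrt (L * t) + (\<Sum>e\<in>F. \<Sum>f\<in>F. cmod (cinner (\<rho> e) f - cinner (\<rho> e) f)) + 2 * sqrt (L * r)"
    unfolding b_def by (intro tendsto_intros w L bound)
  moreover have "2 * sqrt (L * t) + (\<Sum>e\<in>F. \<Sum>f\<in>F. cmod (cinner (\<rho> e) f - cinner (\<rho> e) f)) + 2 * sqrt (L * r) < \<epsilon>"
  proof -
    have "sqrt L \<le> \<eta>" using L(1) \<eta> by (simp add: real_le_lsqrt)
    then have "sqrt L * (2 * sqrt t + 2 * sqrt r) \<le> \<eta> * (2 * sqrt t + 2 * sqrt r)"
      using t0 r0 by (intro mult_right_mono) auto
    then show ?thesis using \<eta>2 by (simp add: real_sqrt_mult algebra_simps)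
  qed
  ultimately have "\<forall>\<^sub>F n in sequentially. b n < \<epsilon>" by (rule order_tendstoD(2))
  then show "\<forall>\<^sub>F n in sequentially. dist (trace_norm (\<lambda>x. \<rho>n n x - \<rho> x)) 0 < \<epsilon>"
  proof eventually_elim
    case (elim n)
    then show ?case
      using le_b[of n] trace_norm_nonneg[OF trace_class_diff[OF \<rho>n(1) \<rho>(1)], of n] by simp
  qed
qed

section \<open>Product bases and partial traces of positive operators\<close>

context tensor_product
begin

abbreviation tens_onb :: "'c set" where
  "tens_onb \<equiv> (\<lambda>(e, f). tens e f) ` (some_onb \<times> some_onb)"

text \<open>Totality is checked one factor at a time: a vector orthogonal to all
  \<open>tens e f\<close> has vanishing slices at each \<open>e\<close>, then vanishing slices in
  the other factor at every \<open>y\<close>, and so is orthogonal to all product vectors.\<close>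

lemma is_onb_tens_onb: "is_onb tens_onb"
proof (rule is_onb_total)
  show "orthonormal tens_onb" by (rule orthonormal_tens) (rule orthonormal_some_onb, simp)+
  show "total tens_onb" unfolding total_def
  proof (intro allI impI)
    fix z assume z: "\<forall>e\<in>tens_onb. cinner z e = 0"
    have ta: "total (some_onb :: 'a set)" and tb: "total (some_onb :: 'b set)"
      using total_of_dense_span is_onb_some_onb unfolding is_onb_def by blast+
    have "slice e z = 0" if "e \<in> some_onb" for e
    proof -
      have "cinner (slice e z) f = 0" if "f \<in> some_onb" for f
        using z \<open>e \<in> some_onb\<close> that by (auto simp: cinner_slice)
      then show ?thesis using tb unfolding total_def by blast
    qed
    then have 1: "cinner z (tens e y) = 0" if "e \<in> some_onb" for e y
      using that by (simp add: cinner_slice[symmetric])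
    have "adj_op (\<lambda>x. tens x y) z = 0" for y
    proof -
      have "cinner (adj_op (\<lambda>x. tens x y) z) e = 0" if "e \<in> some_onb" for e
        using 1[OF that] by (simp add: cinner_adj'[OF bounded_clinear_tens_left])
      then show ?thesis using ta unfolding total_def by blast
    qed
    then have "cinner z (tens x y) = 0" for x y
      by (simp add: cinner_adj'[OF bounded_clinear_tens_left, symmetric])
    moreover have "total {tens x y |x y. True}"
      using tensor by (intro total_of_dense_span) (simp add: hilbert_tensor_def)
    ultimately show "z = 0" unfolding total_def by blast
  qed
qed

lemma partial_trace1_trace_class:
  "trace_class T \<Longrightarrow> trace_class (partial_trace1 tens T)"
  by (rule trace_class_of_le[OF trace_norm_le_partial_trace1[OF trace_norm_le_trace_norm]])

lemma partial_trace1_Re_has_sum: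
  assumes "trace_class T"
  shows "((\<lambda>e. Re (cinner (T (tens e y)) (tens e y))) has_sum Re (cinner (partial_trace1 tens T y) y)) some_onb"
  by (rule has_sum_Re[OF partial_trace1_has_sum[OF assms]])

lemma partial_trace1_positive:
  assumes "trace_class T" "positive_op T"
  shows "positive_op (partial_trace1 tens T)"
proof (rule positive_opI[OF trace_class_clinear[OF partial_trace1_trace_class[OF assms(1)]]])
  fix y
  show "Re (cinner (partial_trace1 tens T y) y) \<ge> 0"
    by (rule has_sum_nonneg[OF partial_trace1_Re_has_sum[OF assms(1)]]) (rule positive_op_ge[OF assms(2)])
  have "((\<lambda>e::'a. 0) has_sum Im (cinner (partial_trace1 tens T y) y)) some_onb"
    using has_sum_Im[OF partial_trace1_has_sum[OF assms(1), of y y]] by (simp add: positive_op_Im[OF assms(2)])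
  then show "Im (cinner (partial_trace1 tens T y) y) = 0"
    by (rule has_sum_unique) (rule has_sum_0_simp)
qed

lemma sum_le_partial_trace1:
  assumes "trace_class T" "positive_op T" "finite K" "K \<subseteq> some_onb"
  shows "(\<Sum>e\<in>K. Re (cinner (T (tens e y)) (tens e y))) \<le> Re (cinner (partial_trace1 tens T y) y)"
  by (rule finite_sum_le_has_sum[OF partial_trace1_Re_has_sum[OF assms(1)] assms(3,4)])
     (rule positive_op_ge[OF assms(2)])

lemma finite_subset_tens_onb:
  assumes "finite K" "K \<subseteq> tens_onb"
  obtains A B where "finite A" "A \<subseteq> some_onb" "finite B" "B \<subseteq> some_onb" "K \<subseteq> (\<lambda>(e, f). tens e f) ` (A \<times> B)"
proof -
  obtain P where P: "finite P" "P \<subseteq> some_onb \<times> some_onb" "K = (\<lambda>(e, f). tens e f) ` P"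
    using finite_subset_image[OF assms] by blast
  have "P \<subseteq> fst ` P \<times> snd ` P" by force
  then show thesis using P by (intro that[of "fst ` P" "snd ` P"]) auto
qed

lemma sum_tens_image:
  assumes "A \<subseteq> some_onb" "B \<subseteq> some_onb"
  shows "sum h ((\<lambda>(e, f). tens e f) ` (A \<times> B)) = (\<Sum>e\<in>A. \<Sum>f\<in>B. h (tens e f))"
  by (subst sum.reindex[OF inj_on_tens])
     (use assms orthonormal_some_onb in \<open>auto simp: sum.cartesian_product case_prod_unfold\<close>)

text \<open>For positive operators the trace norm is a sum of diagonal entries, and over the product
  basis this can be arranged by columns. Positivity allows any finite set of product vectors to be
  enlarged to a rectangle.\<close>

lemma trace_norm_partial_trace1:
  assumes T: "trace_class T" "positive_op T"
  shows "trace_norm (partial_trace1 tens T) = trace_norm T"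
proof (rule antisym)
  show "trace_norm (partial_trace1 tens T) \<le> trace_norm T"
    by (rule trace_norm_least[OF trace_norm_le_partial_trace1[OF trace_norm_le_trace_norm[OF T(1)]]])
  note pc = partial_trace1_trace_class[OF T(1)] and pp = partial_trace1_positive[OF T]
  show "trace_norm T \<le> trace_norm (partial_trace1 tens T)"
  proof (rule has_sum_le_finite_sums[OF trace_norm_has_sum_positive[OF T is_onb_tens_onb]])
    fix K assume "finite K" "K \<subseteq> tens_onb"
    then obtain A B where AB: "finite A" "A \<subseteq> some_onb" "finite B" "B \<subseteq> some_onb"
      and K: "K \<subseteq> (\<lambda>(e, f). tens e f) ` (A \<times> B)" by (rule finite_subset_tens_onb)
    have "(\<Sum>z\<in>K. Re (cinner (T z) z)) \<le> (\<Sum>z\<in>(\<lambda>(e, f). tens e f) ` (A \<times> B). Re (cinner (T z) z))"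
      using AB K positive_op_ge[OF T(2)] by (intro sum_mono2) auto
    also have "\<dots> = (\<Sum>f\<in>B. \<Sum>e\<in>A. Re (cinner (T (tens e f)) (tens e f)))"
      unfolding sum_tens_image[OF AB(2,4)] by (rule sum.swap)
    also have "\<dots> \<le> (\<Sum>f\<in>B. Re (cinner (partial_trace1 tens T f) f))"
      by (intro sum_mono sum_le_partial_trace1 T AB)
    also have "\<dots> \<le> trace_norm (partial_trace1 tens T)"
      by (rule finite_sum_le_has_sum[OF trace_norm_has_sum_positive[OF pc pp is_onb_some_onb] AB(3,4)])
         (rule positive_op_ge[OF pp])
    finally show "(\<Sum>z\<in>K. Re (cinner (T z) z)) \<le> trace_norm (partial_trace1 tens T)" .
  qed
qed

end

lemma sum_tail_le_trace_norm:
  fixes A :: "'a::complex_hilbert \<Rightarrow> 'a"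
  assumes "trace_class A" "positive_op A" "finite K" "F \<subseteq> K" "K \<subseteq> some_onb"
  shows "(\<Sum>e\<in>K - F. Re (cinner (A e) e)) \<le> trace_norm A - (\<Sum>e\<in>F. Re (cinner (A e) e))"
proof -
  have "(\<Sum>e\<in>K. Re (cinner (A e) e)) \<le> trace_norm A"
    by (rule finite_sum_le_has_sum[OF trace_norm_has_sum_positive[OF assms(1,2) is_onb_some_onb] assms(3,5)])
       (rule positive_op_ge[OF assms(2)])
  then show ?thesis using sum_diff[OF assms(3,4)] by (metis diff_right_mono)
qed

context tensor_product
begin

text \<open>A pair outside \<open>F1 \<times> F2\<close> has its first index outside
  \<open>F1\<close>, or its first index in \<open>F1\<close> and its second outside
  \<open>F2\<close>. Entries of the first kind are bounded by the tail of the second partial trace,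
  which acts on the first factor; those of the second kind by the tail of the first.\<close>

lemma trace_norm_tail_le:
  assumes T: "trace_class T" "positive_op T"
    and F1: "finite F1" "F1 \<subseteq> some_onb" and F2: "finite F2" "F2 \<subseteq> some_onb"
  shows "trace_norm T - (\<Sum>z\<in>(\<lambda>(e, f). tens e f) ` (F1 \<times> F2). Re (cinner (T z) z))
    \<le> (trace_norm (partial_trace2 tens T) - (\<Sum>e\<in>F1. Re (cinner (partial_trace2 tens T e) e)))
     + (trace_norm (partial_trace1 tens T) - (\<Sum>f\<in>F2. Re (cinner (partial_trace1 tens T f) f)))"
    (is "_ - ?G \<le> ?t1 + ?t2")
proof -
  interpret sw: tensor_product "\<lambda>y x. tens x y" by (rule swap)
  note pc1 = partial_trace1_trace_class[OF T(1)] and pp1 = partial_trace1_positive[OF T]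
  note pc2 = sw.partial_trace1_trace_class[OF T(1), folded partial_trace2_eq]
    and pp2 = sw.partial_trace1_positive[OF T, folded partial_trace2_eq]
  let ?a = "\<lambda>e f. Re (cinner (T (tens e f)) (tens e f))"
  have a0: "?a e f \<ge> 0" for e f by (rule positive_op_ge[OF T(2)])
  have "trace_norm T \<le> ?G + ?t1 + ?t2"
  proof (rule has_sum_le_finite_sums[OF trace_norm_has_sum_positive[OF T is_onb_tens_onb]])
    fix K assume "finite K" "K \<subseteq> tens_onb"
    then obtain A B where AB: "finite A" "A \<subseteq> some_onb" "finite B" "B \<subseteq> some_onb"
      and K: "K \<subseteq> (\<lambda>(e, f). tens e f) ` (A \<times> B)" by (rule finite_subset_tens_onb)
    \<comment> \<open>The enlarged rectangle contains \<open>F1 \<times> F2\<close>, so that the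
      splitting below is exact; the extra entries are nonnegative.\<close>
    define A' where "A' = A \<union> F1"
    define B' where "B' = B \<union> F2"
    have A': "finite A'" "A' \<subseteq> some_onb" "F1 \<subseteq> A'" and B': "finite B'" "B' \<subseteq> some_onb" "F2 \<subseteq> B'"
      using AB F1 F2 by (auto simp: A'_def B'_def)
    have "(\<Sum>z\<in>K. Re (cinner (T z) z)) \<le> (\<Sum>z\<in>(\<lambda>(e, f). tens e f) ` (A' \<times> B'). Re (cinner (T z) z))"
      using A' B' K positive_op_ge[OF T(2)] by (intro sum_mono2) (auto simp: A'_def B'_def)
    also have "\<dots> = (\<Sum>e\<in>A'. \<Sum>f\<in>B'. ?a e f)" by (rule sum_tens_image[OF A'(2) B'(2)])
    also have "\<dots> = (\<Sum>e\<in>F1. \<Sum>f\<in>B'. ?a e f) + (\<Sum>e\<in>A'-F1. \<Sum>f\<in>B'. ?a e f)"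
      using sum.subset_diff[OF A'(3,1), of "\<lambda>e. \<Sum>f\<in>B'. ?a e f"] by simp
    also have "(\<Sum>e\<in>F1. \<Sum>f\<in>B'. ?a e f) = (\<Sum>e\<in>F1. \<Sum>f\<in>F2. ?a e f) + (\<Sum>e\<in>F1. \<Sum>f\<in>B'-F2. ?a e f)"
      by (simp only: sum.subset_diff[OF B'(3,1)] sum.distrib add.commute)
    also have "(\<Sum>e\<in>F1. \<Sum>f\<in>F2. ?a e f) = ?G" by (rule sum_tens_image[OF F1(2) F2(2), symmetric])
    also have "(\<Sum>e\<in>A'-F1. \<Sum>f\<in>B'. ?a e f) \<le> (\<Sum>e\<in>A'-F1. Re (cinner (partial_trace2 tens T e) e))"
      unfolding partial_trace2_eq by (intro sum_mono sw.sum_le_partial_trace1 T B')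
    also have "\<dots> \<le> ?t1" by (rule sum_tail_le_trace_norm[OF pc2 pp2 A'(1,3,2)])
    also have "(\<Sum>e\<in>F1. \<Sum>f\<in>B'-F2. ?a e f) = (\<Sum>f\<in>B'-F2. \<Sum>e\<in>F1. ?a e f)" by (rule sum.swap)
    also have "\<dots> \<le> (\<Sum>f\<in>B'-F2. Re (cinner (partial_trace1 tens T f) f))"
      by (intro sum_mono sum_le_partial_trace1 T F1)
    also have "\<dots> \<le> ?t2" by (rule sum_tail_le_trace_norm[OF pc1 pp1 B'(1,3,2)])
    finally show "(\<Sum>z\<in>K. Re (cinner (T z) z)) \<le> ?G + ?t1 + ?t2" by simp
  qed
  then show ?thesis by linarith
qed

end

theorem theorem1p4:
  fixes tens :: "'a::complex_hilbert \<Rightarrow> 'b::complex_hilbert \<Rightarrow> 'c::complex_hilbert"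
    and \<rho>1 :: "'a \<Rightarrow> 'a" and \<rho>2 :: "'b \<Rightarrow> 'b"
    and \<rho>n :: "nat \<Rightarrow> 'c \<Rightarrow> 'c" and \<rho> :: "'c \<Rightarrow> 'c"
  assumes "separable (UNIV :: 'a set)" and "infinite_cdim (UNIV :: 'a set)"
    and "separable (UNIV :: 'b set)" and "infinite_cdim (UNIV :: 'b set)"
    and "hilbert_tensor tens"
    and "\<rho>1 \<in> trace_class_pos" and "\<rho>2 \<in> trace_class_pos"
    and "\<And>n. \<rho>n n \<in> trace_class_pos" and "\<rho> \<in> trace_class_pos"
    and "wot_tendsto \<rho>n \<rho>"
    and "(\<lambda>n. trace_norm (\<lambda>y. partial_trace1 tens (\<rho>n n) y - \<rho>2 y)
            + trace_norm (\<lambda>x. partial_trace2 tens (\<rho>n n) x - \<rho>1 x)) \<longlonglongrightarrow> 0"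
  shows "(\<lambda>n. trace_norm (\<lambda>z. \<rho>n n z - \<rho> z)) \<longlonglongrightarrow> 0
    \<and> op_trace \<rho> = op_trace \<rho>1 \<and> op_trace \<rho>1 = op_trace \<rho>2
    \<and> (density_op \<rho> \<longleftrightarrow> density_op \<rho>1 \<and> density_op \<rho>2)"
proof -
  interpret tensor_product tens by standard (rule assms(5))
  interpret sw: tensor_product "\<lambda>y x. tens x y" by (rule swap)
  have \<rho>1: "trace_class \<rho>1" "positive_op \<rho>1" and \<rho>2: "trace_class \<rho>2" "positive_op \<rho>2"
    and \<rho>: "trace_class \<rho>" "positive_op \<rho>"
    and \<rho>n: "\<And>n. trace_class (\<rho>n n)" "\<And>n. positive_op (\<rho>n n)"
    using assms(6-9) by (auto simp: trace_class_pos_def)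
  define \<sigma>2 where "\<sigma>2 n = partial_trace1 tens (\<rho>n n)" for n
  define \<sigma>1 where "\<sigma>1 n = partial_trace2 tens (\<rho>n n)" for n
  have \<sigma>2: "trace_class (\<sigma>2 n)" "trace_norm (\<sigma>2 n) = trace_norm (\<rho>n n)" for n
    unfolding \<sigma>2_def by (rule partial_trace1_trace_class[OF \<rho>n(1)] trace_norm_partial_trace1[OF \<rho>n])+
  have \<sigma>1: "trace_class (\<sigma>1 n)" "trace_norm (\<sigma>1 n) = trace_norm (\<rho>n n)" for n
    unfolding \<sigma>1_def partial_trace2_eq
    by (rule sw.partial_trace1_trace_class[OF \<rho>n(1)] sw.trace_norm_partial_trace1[OF \<rho>n])+
  have nn: "trace_norm (\<lambda>y. \<sigma>2 n y - \<rho>2 y) \<ge> 0" "trace_norm (\<lambda>x. \<sigma>1 n x - \<rho>1 x) \<ge> 0" for n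
    by (intro trace_norm_nonneg trace_class_diff \<sigma>1 \<sigma>2 \<rho>1 \<rho>2)+
  \<comment> \<open>Both summands of the hypothesis are nonnegative, so each is dominated by the
    sum.\<close>
  have conv2: "(\<lambda>n. trace_norm (\<lambda>y. \<sigma>2 n y - \<rho>2 y)) \<longlonglongrightarrow> 0"
    by (rule Lim_null_comparison[OF _ assms(11)]) (use nn in \<open>simp flip: \<sigma>1_def \<sigma>2_def\<close>)
  have conv1: "(\<lambda>n. trace_norm (\<lambda>x. \<sigma>1 n x - \<rho>1 x)) \<longlonglongrightarrow> 0"
    by (rule Lim_null_comparison[OF _ assms(11)]) (use nn in \<open>simp flip: \<sigma>1_def \<sigma>2_def\<close>)
  \<comment> \<open>A positive operator has the same trace norm as its partial traces, so this
    single sequence tends both to \<open>trace_norm \<rho>1\<close> and to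
    \<open>trace_norm \<rho>2\<close>.\<close>
  have lim1: "(\<lambda>n. trace_norm (\<rho>n n)) \<longlonglongrightarrow> trace_norm \<rho>1"
    using trace_norm_tendsto[OF \<sigma>1(1) \<rho>1(1) conv1] by (simp add: \<sigma>1(2))
  have lim2: "(\<lambda>n. trace_norm (\<rho>n n)) \<longlonglongrightarrow> trace_norm \<rho>2"
    using trace_norm_tendsto[OF \<sigma>2(1) \<rho>2(1) conv2] by (simp add: \<sigma>2(2))
  have conv: "(\<lambda>n. trace_norm (\<lambda>z. \<rho>n n z - \<rho> z)) \<longlonglongrightarrow> 0"
  proof (rule wot_tight_imp_trace_norm[OF \<rho>n \<rho> assms(10) is_onb_tens_onb lim1])
    fix \<delta> :: real assume \<delta>: "\<delta> > 0"
    obtain F1 where F1: "finite F1" "F1 \<subseteq> some_onb"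
      "dist (\<Sum>e\<in>F1. Re (cinner (\<rho>1 e) e)) (trace_norm \<rho>1) \<le> \<delta>/2"
      using has_sum_finite_approximation[OF trace_norm_has_sum_positive[OF \<rho>1 is_onb_some_onb], of "\<delta>/2"] \<delta> by auto
    obtain F2 where F2: "finite F2" "F2 \<subseteq> some_onb"
      "dist (\<Sum>e\<in>F2. Re (cinner (\<rho>2 e) e)) (trace_norm \<rho>2) \<le> \<delta>/2"
      using has_sum_finite_approximation[OF trace_norm_has_sum_positive[OF \<rho>2 is_onb_some_onb], of "\<delta>/2"] \<delta> by auto
    \<comment> \<open>\<open>s n\<close> is the bound of \<open>trace_norm_tail_le\<close>; its
      limit \<open>L\<close> is the same expression for \<rho>1 and \<rho>2, to which each factor
      contributes at most half of \<delta>.\<close>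
    define s where "s n = (trace_norm (\<sigma>1 n) - (\<Sum>e\<in>F1. Re (cinner (\<sigma>1 n e) e)))
      + (trace_norm (\<sigma>2 n) - (\<Sum>f\<in>F2. Re (cinner (\<sigma>2 n f) f)))" for n
    define L where "L = (trace_norm \<rho>1 - (\<Sum>e\<in>F1. Re (cinner (\<rho>1 e) e)))
      + (trace_norm \<rho>2 - (\<Sum>f\<in>F2. Re (cinner (\<rho>2 f) f)))"
    have "s \<longlonglongrightarrow> L" unfolding s_def L_def \<sigma>1(2) \<sigma>2(2)
      by (intro tendsto_intros lim1 lim2 trace_norm_imp_strong_tendsto[OF \<sigma>1(1) \<rho>1(1) conv1]
          trace_norm_imp_strong_tendsto[OF \<sigma>2(1) \<rho>2(1) conv2])
    moreover have "L \<le> \<delta>" using F1(3) F2(3) unfolding L_def dist_real_def by linarith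
    moreover have "trace_norm (\<rho>n n) - (\<Sum>z\<in>(\<lambda>(e, f). tens e f) ` (F1 \<times> F2). Re (cinner (\<rho>n n z) z)) \<le> s n" for n
      unfolding s_def \<sigma>1_def \<sigma>2_def by (rule trace_norm_tail_le[OF \<rho>n F1(1,2) F2(1,2)])
    moreover have "(\<lambda>(e, f). tens e f) ` (F1 \<times> F2) \<subseteq> tens_onb" using F1 F2 by auto
    ultimately show "\<exists>F s. finite F \<and> F \<subseteq> tens_onb \<and>
      (\<forall>n. trace_norm (\<rho>n n) - (\<Sum>e\<in>F. Re (cinner (\<rho>n n e) e)) \<le> s n) \<and> (\<exists>L\<le>\<delta>. s \<longlonglongrightarrow> L)"
      using F1(1) F2(1) by (intro exI[of _ "(\<lambda>(e, f). tens e f) ` (F1 \<times> F2)"] exI[of _ s]) auto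
  qed
  \<comment> \<open>Trace norm convergence is needed here: weak convergence of positive operators
    alone would give only an inequality between the traces.\<close>
  have "trace_norm \<rho> = trace_norm \<rho>1"
    using trace_norm_tendsto[OF \<rho>n(1) \<rho>(1) conv] lim1 by (rule LIMSEQ_unique)
  moreover have "trace_norm \<rho>1 = trace_norm \<rho>2" using lim1 lim2 by (rule LIMSEQ_unique)
  ultimately have "op_trace \<rho> = op_trace \<rho>1" "op_trace \<rho>1 = op_trace \<rho>2"
    by (simp_all add: op_trace_positive \<rho> \<rho>1 \<rho>2)
  then show ?thesis using conv assms(6,7,9) by (auto simp: density_op_def)
qed

end
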